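(* Let $p$ be an odd prime such that $p^r=4u+1$ for some integers $u,r\ge1$. Then the flat manifold $\mathcal{X}_{\Gamma_{p^r}}$ with fundamental group the Bieberbach group $\Gamma_{p^r}\le B_{p^r}/[P_{p^r},P_{p^r}]$ (defined in the context) and holonomy group $\mathbb{Z}_{p^r}$ is a Calabi–Yau flat manifold of (real) dimension $2u(4u+1)$.
   Context: $B_n$ is the Artin braid group with standard generators $\sigma_1,\ldots,\sigma_{n-1}$, $P_n$ is the pure braid group (kernel of $\sigma\colon B_n\to S_n$, $\sigma_i\mapsto(i,\,i+1)$), and $[P_n,P_n]$ its commutator subgroup. For $1\le i<j\le n$, $A_{i,j}=\sigma_{j-1}\cdots\sigma_{i+1}\sigma_i^2\sigma_{i+1}^{-1}\cdots\sigma_{j-1}^{-1}$; the same symbol denotes its class in $B_n/[P_n,P_n]$. The classes $A_{i,j}$ form a basis of the free abelian group $P_n/[P_n,P_n]\cong\mathbb{Z}^{n(n-1)/2}$. Definition of $\Gamma_{p^r}$: put $n=p^r$ and $$\delta_{0,n}=\sigma_{n-1}\cdots\sigma_{\frac{n+1}{2}}\,\sigma_{\frac{n-1}{2}}^{-1}\cdots\sigma_{1}^{-1}\in B_n/[P_n,P_n].$$ $\Gamma_{p^r}$ is the subgroup of $B_{n}/[P_{n},P_{n}]$ generated by $A_{1,2}\,\delta_{0,n}$ and the elements $A_{a,b}^{p^r}$ for $1\le a<b\le n$. It is a Bieberbach group (torsion-free crystallographic group) of dimension $n(n-1)/2$ with holonomy group $\mathbb{Z}_{p^r}$. A flat manifold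 is a closed Riemannian manifold of zero curvature; to each Bieberbach group $\Gamma$ of dimension $N$ corresponds the closed flat $N$-manifold $\mathcal{X}_\Gamma$ with fundamental group $\Gamma$. A Kähler manifold is a $2m$-real-dimensional manifold endowed with a Riemannian metric, a complex structure and a symplectic structure which are compatible at every point. A Calabi–Yau manifold is a Kähler manifold (of complex dimension $m$) with holonomy group contained in $SU(m)$; "$\mathcal{X}_\Gamma$ is Calabi–Yau" means that it admits such a structure. *)

theory Defs
  imports
    "HOL-Analysis.Analysis"
    "HOL-Algebra.Algebra"
    "Jordan_Normal_Form.Schur_Decomposition"
begin

text \<open>The Artin braid group on \<open>n\<close> strands by its standard presentation: \<open>Pos i\<close> and \<open>Neg i\<close> stand
  for the generator \<open>\<sigma>\<close> of index \<open>i\<close> and for its inverse, and group elements are classes of words.\<close>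

datatype letter = Pos nat | Neg nat

fun strand :: "letter \<Rightarrow> nat" where
  "strand (Pos i) = i"
| "strand (Neg i) = i"

definition braid_words :: "nat \<Rightarrow> letter list set" where
  "braid_words n = {w. \<forall>l\<in>set w. 1 \<le> strand l \<and> strand l < n}"

inductive braid_equiv :: "nat \<Rightarrow> letter list \<Rightarrow> letter list \<Rightarrow> bool" for n where
  refl: "braid_equiv n w w"
| sym: "braid_equiv n v w \<Longrightarrow> braid_equiv n w v"
| trans: "braid_equiv n u v \<Longrightarrow> braid_equiv n v w \<Longrightarrow> braid_equiv n u w"
| cong: "braid_equiv n v v' \<Longrightarrow> braid_equiv n w w' \<Longrightarrow> braid_equiv n (v @ w) (v' @ w')"
| right_inv: "1 \<le> i \<Longrightarrow> i < n \<Longrightarrow> braid_equiv n [Pos i, Neg i] []"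
| left_inv: "1 \<le> i \<Longrightarrow> i < n \<Longrightarrow> braid_equiv n [Neg i, Pos i] []"
| far: "1 \<le> i \<Longrightarrow> i + 2 \<le> j \<Longrightarrow> j < n \<Longrightarrow> braid_equiv n [Pos i, Pos j] [Pos j, Pos i]"
| near: "1 \<le> i \<Longrightarrow> i + 1 < n \<Longrightarrow>
    braid_equiv n [Pos i, Pos (i + 1), Pos i] [Pos (i + 1), Pos i, Pos (i + 1)]"

definition braid_class :: "nat \<Rightarrow> letter list \<Rightarrow> letter list set" where
  "braid_class n w = {v. braid_equiv n w v}"

definition braid_group :: "nat \<Rightarrow> letter list set monoid" where
  "braid_group n =
    \<lparr>carrier = braid_class n ` braid_words n,
     mult = (\<lambda>C D. \<Union>x\<in>C. \<Union>y\<in>D. braid_class n (x @ y)),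
     one = braid_class n []\<rparr>"

fun word_perm :: "letter list \<Rightarrow> nat \<Rightarrow> nat" where
  "word_perm [] = id"
| "word_perm (l # w) = Transposition.transpose (strand l) (strand l + 1) \<circ> word_perm w"

text \<open>\<open>word_perm\<close> is constant on every braid class, so the image below is a singleton.\<close>

definition braid_perm :: "letter list set \<Rightarrow> nat \<Rightarrow> nat" where
  "braid_perm C = the_elem (word_perm ` C)"

definition pure_braid_group :: "nat \<Rightarrow> letter list set set" where
  "pure_braid_group n = kernel (braid_group n) (sym_group n) braid_perm"

definition pure_commutator :: "nat \<Rightarrow> letter list set set" where
  "pure_commutator n = derived (braid_group n) (pure_braid_group n)"

definition braid_quotient :: "nat \<Rightarrow> letter list set set monoid" where
  "braid_quotient n = braid_group n Mod pure_commutator n"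

definition quotient_class :: "nat \<Rightarrow> letter list \<Rightarrow> letter list set set" where
  "quotient_class n w = pure_commutator n #>\<^bsub>braid_group n\<^esub> braid_class n w"

definition A_word :: "nat \<Rightarrow> nat \<Rightarrow> letter list" where
  "A_word i j = map Pos (rev [i + 1..<j]) @ [Pos i, Pos i] @ map Neg [i + 1..<j]"

text \<open>For odd \<open>n\<close>, positive letters of indices \<open>n - 1\<close> down to \<open>(n + 1) / 2\<close>, then negative letters
  of indices \<open>(n - 1) / 2\<close> down to \<open>1\<close>.\<close>

definition delta_word :: "nat \<Rightarrow> letter list" where
  "delta_word n = map Pos (rev [(n + 1) div 2..<n]) @ map Neg (rev [1..<(n + 1) div 2])"

definition Gamma_group :: "nat \<Rightarrow> letter list set set monoid" where
  "Gamma_group n = (braid_quotient n)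
    \<lparr>carrier := generate (braid_quotient n)
      (insert (quotient_class n (A_word 1 2) \<otimes>\<^bsub>braid_quotient n\<^esub> quotient_class n (delta_word n))
        {quotient_class n (A_word a b) [^]\<^bsub>braid_quotient n\<^esub> n | a b. 1 \<le> a \<and> a < b \<and> b \<le> n})\<rparr>"

definition isometry_group :: "('a::metric_space \<Rightarrow> 'a) monoid" where
  "isometry_group =
    \<lparr>carrier = {f. surj f \<and> (\<forall>x y. dist (f x) (f y) = dist x y)}, mult = (\<circ>), one = id\<rparr>"

text \<open>Discreteness is for the usual (compact-open) topology of the isometry group of a Euclidean
  space; a subgroup is discrete iff some neighbourhood of the identity meets it only in the
  identity, and the isometries moving each point of the unit ball by less than \<open>e\<close> form a
  neighbourhood basis.  The orbit space \<open>X = E / G\<close> of a Bieberbach group \<open>G\<close> is the closed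
  flat manifold with fundamental group \<open>G\<close>.\<close>

definition discrete_isometries :: "('a::euclidean_space \<Rightarrow> 'a) set \<Rightarrow> bool" where
  "discrete_isometries G \<longleftrightarrow> (\<exists>e>0. \<forall>f\<in>G. (\<forall>x\<in>cball 0 1. dist (f x) x < e) \<longrightarrow> f = id)"

definition cocompact :: "('a::euclidean_space \<Rightarrow> 'a) set \<Rightarrow> bool" where
  "cocompact G \<longleftrightarrow> (\<exists>K. compact K \<and> (\<Union>f\<in>G. f ` K) = UNIV)"

definition bieberbach_group :: "('a::euclidean_space \<Rightarrow> 'a) set \<Rightarrow> bool" where
  "bieberbach_group G \<longleftrightarrow>
    subgroup G isometry_group \<and> discrete_isometries G \<and> cocompact G \<and>
    (\<forall>f\<in>G. \<forall>k>0. (f ^^ k) = id \<longrightarrow> f = id)"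

text \<open>Tensor fields on \<open>E / G\<close> are represented by their lifts to \<open>E\<close>, that is, by \<open>G\<close>-invariant
  tensor fields on \<open>E\<close>, whose tangent spaces are all identified with \<open>E\<close>.\<close>

abbreviation deriv_along ::
    "('a::real_normed_vector \<Rightarrow> 'b::real_normed_vector) \<Rightarrow> 'a \<Rightarrow> 'a \<Rightarrow> 'b" where
  "deriv_along f x v \<equiv> frechet_derivative f (at x) v"

text \<open>All iterated directional derivatives exist and are differentiable, hence \<open>f\<close> is infinitely
  differentiable on the open set \<open>U\<close> (coinduction gives the largest such class).\<close>

coinductive smooth_on ::
    "'a::euclidean_space set \<Rightarrow> ('a \<Rightarrow> 'b::real_normed_vector) \<Rightarrow> bool" for U where
  "(\<forall>x\<in>U. f differentiable at x) \<Longrightarrow> (\<forall>v. smooth_on U (\<lambda>x. deriv_along f x v)) \<Longrightarrow> smooth_on U f"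

type_synonym 'a form2 = "'a \<Rightarrow> 'a \<Rightarrow> 'a \<Rightarrow> real"
type_synonym 'a endo = "'a \<Rightarrow> 'a \<Rightarrow> 'a"

definition smooth_form2 :: "('a::euclidean_space \<Rightarrow> 'a) set \<Rightarrow> 'a form2 \<Rightarrow> bool" where
  "smooth_form2 G b \<longleftrightarrow>
    (\<forall>x. bilinear (b x)) \<and>
    (\<forall>v w. smooth_on UNIV (\<lambda>x. b x v w)) \<and>
    (\<forall>f\<in>G. \<forall>x v w. b (f x) (deriv_along f x v) (deriv_along f x w) = b x v w)"

definition riemannian_metric :: "('a::euclidean_space \<Rightarrow> 'a) set \<Rightarrow> 'a form2 \<Rightarrow> bool" where
  "riemannian_metric G g \<longleftrightarrow>
    smooth_form2 G g \<and> (\<forall>x v w. g x v w = g x w v) \<and> (\<forall>x v. v \<noteq> 0 \<longrightarrow> g x v v > 0)"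

definition symplectic_form :: "('a::euclidean_space \<Rightarrow> 'a) set \<Rightarrow> 'a form2 \<Rightarrow> bool" where
  "symplectic_form G \<omega> \<longleftrightarrow>
    smooth_form2 G \<omega> \<and> (\<forall>x v. \<omega> x v v = 0) \<and> (\<forall>x v. v \<noteq> 0 \<longrightarrow> (\<exists>w. \<omega> x v w \<noteq> 0)) \<and>
    (\<forall>x u v w. deriv_along (\<lambda>y. \<omega> y v w) x u + deriv_along (\<lambda>y. \<omega> y w u) x v
             + deriv_along (\<lambda>y. \<omega> y u v) x w = 0)"

definition linear_complex_structure :: "('a::euclidean_space \<Rightarrow> 'a) \<Rightarrow> bool" where
  "linear_complex_structure J \<longleftrightarrow> linear J \<and> (\<forall>v. J (J v) = - v)"

text \<open>The last conjunct provides holomorphic coordinates near every point: a diffeomorphism \<open>\<phi>\<close> of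
  a neighbourhood \<open>U\<close> onto an open set, with inverse \<open>\<psi>\<close>, taking \<open>J\<close> to the complex structure of
  the complex vector space \<open>(E, J0)\<close>.\<close>

definition complex_structure :: "('a::euclidean_space \<Rightarrow> 'a) set \<Rightarrow> 'a endo \<Rightarrow> bool" where
  "complex_structure G J \<longleftrightarrow>
    (\<forall>x. linear_complex_structure (J x)) \<and>
    (\<forall>v. smooth_on UNIV (\<lambda>x. J x v)) \<and>
    (\<forall>f\<in>G. \<forall>x v. J (f x) (deriv_along f x v) = deriv_along f x (J x v)) \<and>
    (\<forall>x. \<exists>U (\<phi> :: 'a \<Rightarrow> 'a) \<psi> J0. open U \<and> x \<in> U \<and> open (\<phi> ` U) \<and> (\<forall>y\<in>U. \<psi> (\<phi> y) = y) \<and>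
      smooth_on U \<phi> \<and> smooth_on (\<phi> ` U) \<psi> \<and> linear_complex_structure J0 \<and>
      (\<forall>y\<in>U. \<forall>v. deriv_along \<phi> y (J y v) = J0 (deriv_along \<phi> y v)))"

definition kaehler_structure ::
    "('a::euclidean_space \<Rightarrow> 'a) set \<Rightarrow> 'a form2 \<Rightarrow> 'a endo \<Rightarrow> 'a form2 \<Rightarrow> bool" where
  "kaehler_structure G g J \<omega> \<longleftrightarrow>
    riemannian_metric G g \<and> complex_structure G J \<and> symplectic_form G \<omega> \<and>
    (\<forall>x v w. g x v w = \<omega> x v (J x w))"

text \<open>\<open>christoffel g x u v\<close> is the covariant derivative at \<open>x\<close>, in direction \<open>u\<close>, of the constant
  vector field \<open>v\<close>, given by Koszul's formula.\<close>

definition christoffel :: "'a::euclidean_space form2 \<Rightarrow> 'a \<Rightarrow> 'a \<Rightarrow> 'a \<Rightarrow> 'a" where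
  "christoffel g x u v = (THE z. \<forall>w. 2 * g x z w =
     deriv_along (\<lambda>y. g y v w) x u + deriv_along (\<lambda>y. g y u w) x v
     - deriv_along (\<lambda>y. g y u v) x w)"

definition riemann_curvature :: "'a::euclidean_space form2 \<Rightarrow> 'a \<Rightarrow> 'a \<Rightarrow> 'a \<Rightarrow> 'a \<Rightarrow> 'a" where
  "riemann_curvature g x u v w =
     deriv_along (\<lambda>y. christoffel g y v w) x u - deriv_along (\<lambda>y. christoffel g y u w) x v
     + christoffel g x u (christoffel g x v w) - christoffel g x v (christoffel g x u w)"

definition flat_metric :: "'a::euclidean_space form2 \<Rightarrow> bool" where
  "flat_metric g \<longleftrightarrow> (\<forall>x u v w. riemann_curvature g x u v w = 0)"

definition parallel_along ::
    "'a::euclidean_space form2 \<Rightarrow> (real \<Rightarrow> 'a) \<Rightarrow> (real \<Rightarrow> 'a) \<Rightarrow> bool" where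
  "parallel_along g c V \<longleftrightarrow>
    continuous_on {0..1} V \<and>
    (\<exists>S. finite S \<and> (\<forall>t\<in>{0..1} - S.
      (V has_vector_derivative - christoffel g (c t) (vector_derivative c (at t)) (V t)) (at t)))"

text \<open>A loop in \<open>E / G\<close> based at the image of \<open>x\<close> lifts to a path \<open>c\<close> from \<open>x\<close> to \<open>f x\<close> with
  \<open>f \<in> G\<close>, and the tangent spaces at \<open>x\<close> and \<open>f x\<close> are identified by the derivative of \<open>f\<close>.\<close>

definition holonomy ::
    "('a::euclidean_space \<Rightarrow> 'a) set \<Rightarrow> 'a form2 \<Rightarrow> 'a \<Rightarrow> ('a \<Rightarrow> 'a) set" where
  "holonomy G g x = {h. \<exists>f\<in>G. \<exists>c. c piecewise_C1_differentiable_on {0..1} \<and> c 0 = x \<and> c 1 = f x \<and>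
     (\<forall>v. \<exists>V. parallel_along g c V \<and> V 0 = v \<and> V 1 = deriv_along f x (h v))}"

definition holonomy_group ::
    "('a::euclidean_space \<Rightarrow> 'a) set \<Rightarrow> 'a form2 \<Rightarrow> 'a \<Rightarrow> ('a \<Rightarrow> 'a) monoid" where
  "holonomy_group G g x = \<lparr>carrier = holonomy G g x, mult = (\<circ>), one = id\<rparr>"

definition standard_metric :: "'a::euclidean_space form2" where
  "standard_metric x v w = inner v w"

definition special_unitary :: "nat \<Rightarrow> complex mat set" where
  "special_unitary m = {M \<in> carrier_mat m m. M * mat_adjoint M = 1\<^sub>m m \<and> Determinant.det M = 1}"

text \<open>The complex-linear map sending the standard basis of the \<open>m\<close>-dimensional complex coordinate
  space to \<open>e 0, \<dots>, e (m - 1)\<close>.\<close>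

definition frame_map ::
    "nat \<Rightarrow> ('a::euclidean_space \<Rightarrow> 'a) \<Rightarrow> (nat \<Rightarrow> 'a) \<Rightarrow> complex Matrix.vec \<Rightarrow> 'a" where
  "frame_map m j e z = (\<Sum>i<m. Re (vec_index z i) *\<^sub>R e i + Im (vec_index z i) *\<^sub>R j (e i))"

text \<open>Unitary for the hermitian form whose real part is \<open>b\<close>.\<close>

definition unitary_frame ::
    "nat \<Rightarrow> ('a::euclidean_space \<Rightarrow> 'a \<Rightarrow> real) \<Rightarrow> ('a \<Rightarrow> 'a) \<Rightarrow> (nat \<Rightarrow> 'a) \<Rightarrow> bool" where
  "unitary_frame m b j e \<longleftrightarrow> DIM('a) = 2 * m \<and>
    (\<forall>i<m. \<forall>k<m. b (e i) (e k) = (if i = k then 1 else 0) \<and> b (e i) (j (e k)) = 0)"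

definition holonomy_in_SU ::
    "nat \<Rightarrow> ('a::euclidean_space \<Rightarrow> 'a) set \<Rightarrow> 'a form2 \<Rightarrow> 'a endo \<Rightarrow> bool" where
  "holonomy_in_SU m G g J \<longleftrightarrow>
    (\<forall>x. \<exists>e. unitary_frame m (g x) (J x) e \<and>
      (\<forall>h\<in>holonomy G g x. \<exists>M\<in>special_unitary m. \<forall>z\<in>carrier_vec m.
        h (frame_map m (J x) e z) = frame_map m (J x) e (M *\<^sub>v z)))"

definition calabi_yau_structure ::
    "nat \<Rightarrow> ('a::euclidean_space \<Rightarrow> 'a) set \<Rightarrow> 'a form2 \<Rightarrow> 'a endo \<Rightarrow> 'a form2 \<Rightarrow> bool" where
  "calabi_yau_structure m G g J \<omega> \<longleftrightarrow> kaehler_structure G g J \<omega> \<and> holonomy_in_SU m G g J"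

end

theory Submission
  imports Defs
begin

text \<open>
  Let \<open>n = p ^ r\<close>. The assignment \<open>v \<mapsto> s\<^sub>i v + e\<^bsub>{i,i+1}\<^esub> / 2\<close> for the generator of index \<open>i\<close> is an
  affine action of the braid group on the real functions on pairs of strands. It kills the
  commutators of pure braids and sends \<open>A i j\<close> to the translation by \<open>e\<^bsub>{i,j}\<^esub>\<close>, so the \<open>A i j\<close> are
  independent modulo those commutators. Conjugation permutes them as it permutes the pairs, hence
  \<open>\<Gamma>\<close> is generated by a lattice with basis \<open>A i j ^ n\<close> and by an element \<open>\<alpha>\<close> that rotates this basis,
  the pairs forming \<open>(n - 1) / 2\<close> free orbits of the \<open>n\<close>-cycle of \<open>\<alpha>\<close>; the power \<open>\<alpha> ^ n\<close> lies in the
  group generated by the \<open>A i j\<close> because a Coxeter element of the symmetric group has order \<open>n\<close>.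

  In every cocompact realization by isometries the lattice acts by translations, and discreteness
  makes a lattice basis linearly independent. So the holonomy is generated by a linear
  map \<open>R\<close> permuting a vector space basis in \<open>2 u\<close> orbits of length \<open>n\<close>. The flat metric
  making this basis orthonormal is invariant, interchanging the orbits in pairs up to sign is
  an invariant complex structure. As \<open>n\<close> is odd, every power of \<open>R\<close> is a square, so in a complex basis
  it is the square of a permutation matrix and has determinant one.
\<close>

text \<open>The realization by isometries is arbitrary, so the group is first characterized
  abstractly (\<open>twisted_lattice\<close>): every element is \<open>E m\<close> times a power of
  \<open>\<alpha>\<close>, conjugation by \<open>\<alpha>\<close> rotates the index of
  \<open>E\<close>, and the power of \<open>\<alpha>\<close> with exponent n * n is
  \<open>E s\<close>. Since \<open>s (0, 0) = 1\<close>, these data decide when two such products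
  agree, so they determine the group up to isomorphism; existence follows by comparison with an
  explicit group of isometries. The exponent is n * n because the n-th power of
  \<open>\<alpha>\<close> has exponent 1 at the pair {1, 2}, whereas the lattice contains only n-th
  powers of pure generators. This 1 comes from the factor \<open>A_word 1 2\<close>: on the orbit of
  {1, 2} the half translations of \<open>delta_word n\<close> cancel, so each application of
  \<open>\<alpha>\<close> raises the sum over that orbit by exactly 1. The same count excludes
  torsion in the explicit model. Independence over the integers does not by itself give independence
  over the reals; simultaneous Dirichlet approximation turns a real relation into a lattice vector
  that is too short. With n = 4u + 1 the number of orbits of pairs is 2u, so they can be paired
  off.\<close>

lemma (in group) inv_cancel_left:
  assumes "x \<in> carrier G" "y \<in> carrier G"
  shows "inv x \<otimes> (x \<otimes> y) = y" "x \<otimes> (inv x \<otimes> y) = y"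
  using assms by (simp_all flip: m_assoc)

section \<open>The braid group\<close>

lemma braid_class_eq_iff: "braid_class n v = braid_class n w \<longleftrightarrow> braid_equiv n v w"
proof
  assume "braid_class n v = braid_class n w"
  moreover have "w \<in> braid_class n w"
    by (simp add: braid_class_def braid_equiv.refl)
  ultimately show "braid_equiv n v w"
    by (simp add: braid_class_def set_eq_iff)
next
  assume "braid_equiv n v w"
  then have "braid_equiv n v x \<longleftrightarrow> braid_equiv n w x" for x
    by (meson braid_equiv.sym braid_equiv.trans)
  then show "braid_class n v = braid_class n w"
    by (simp add: braid_class_def)
qed

lemma braid_words_append [simp]: "v @ w \<in> braid_words n \<longleftrightarrow> v \<in> braid_words n \<and> w \<in> braid_words n"
  by (auto simp: braid_words_def)

lemma braid_words_Nil [simp]: "[] \<in> braid_words n"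
  by (simp add: braid_words_def)

lemma braid_words_Cons [simp]:
  "l # w \<in> braid_words n \<longleftrightarrow> 1 \<le> strand l \<and> strand l < n \<and> w \<in> braid_words n"
  by (auto simp: braid_words_def)

lemma carrier_braid_group: "carrier (braid_group n) = braid_class n ` braid_words n"
  by (simp add: braid_group_def)

lemma one_braid_group: "\<one>\<^bsub>braid_group n\<^esub> = braid_class n []"
  by (simp add: braid_group_def)

lemma mult_braid_class:
  "braid_class n v \<otimes>\<^bsub>braid_group n\<^esub> braid_class n w = braid_class n (v @ w)"
proof -
  have "braid_class n (x @ y) = braid_class n (v @ w)"
    if "x \<in> braid_class n v" "y \<in> braid_class n w" for x y
    using that braid_equiv.sym[OF braid_equiv.cong[of n v x w y]]
    unfolding braid_class_eq_iff by (simp add: braid_class_def)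
  moreover have "v \<in> braid_class n v" "w \<in> braid_class n w"
    by (auto simp: braid_class_def intro: braid_equiv.refl)
  ultimately have "(\<Union>x\<in>braid_class n v. \<Union>y\<in>braid_class n w. braid_class n (x @ y)) = braid_class n (v @ w)"
    by blast
  then show ?thesis
    by (simp add: braid_group_def)
qed

fun inv_letter :: "letter \<Rightarrow> letter" where
  "inv_letter (Pos i) = Neg i"
| "inv_letter (Neg i) = Pos i"

definition inv_word :: "letter list \<Rightarrow> letter list" where
  "inv_word w = map inv_letter (rev w)"

lemma strand_inv_letter [simp]: "strand (inv_letter l) = strand l"
  by (cases l) auto

lemma inv_word_simps [simp]:
  "inv_word [] = []" "inv_word (l # w) = inv_word w @ [inv_letter l]"
  by (auto simp: inv_word_def)

lemma inv_word_in_braid_words [simp]: "inv_word w \<in> braid_words n \<longleftrightarrow> w \<in> braid_words n"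
  by (auto simp: inv_word_def braid_words_def)

lemma inv_word_equiv:
  assumes "w \<in> braid_words n"
  shows "braid_equiv n (inv_word w @ w) []"
  using assms
proof (induction w)
  case Nil
  then show ?case by (simp add: braid_equiv.refl)
next
  case (Cons l w)
  then have "1 \<le> strand l" "strand l < n" by auto
  then have "braid_equiv n [inv_letter l, l] []"
    by (cases l) (auto intro: braid_equiv.left_inv braid_equiv.right_inv)
  then have "braid_equiv n (inv_word w @ [inv_letter l, l] @ w) (inv_word w @ [] @ w)"
    by (intro braid_equiv.cong braid_equiv.refl)
  moreover have "braid_equiv n (inv_word w @ w) []"
    using Cons by simp
  ultimately show ?case by (simp add: braid_equiv.trans[of n _ "inv_word w @ w"])
qed

lemma group_braid_group: "group (braid_group n)"
proof (rule groupI)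
  fix x y z
  assume "x \<in> carrier (braid_group n)" "y \<in> carrier (braid_group n)" "z \<in> carrier (braid_group n)"
  then show "x \<otimes>\<^bsub>braid_group n\<^esub> y \<otimes>\<^bsub>braid_group n\<^esub> z = x \<otimes>\<^bsub>braid_group n\<^esub> (y \<otimes>\<^bsub>braid_group n\<^esub> z)"
    by (auto simp: carrier_braid_group mult_braid_class)
next
  fix x
  assume "x \<in> carrier (braid_group n)"
  then obtain w where w: "w \<in> braid_words n" "x = braid_class n w"
    by (auto simp: carrier_braid_group)
  then have "braid_class n (inv_word w) \<otimes>\<^bsub>braid_group n\<^esub> x = \<one>\<^bsub>braid_group n\<^esub>"
    by (simp add: mult_braid_class one_braid_group braid_class_eq_iff inv_word_equiv)
  with w show "\<exists>y\<in>carrier (braid_group n). y \<otimes>\<^bsub>braid_group n\<^esub> x = \<one>\<^bsub>braid_group n\<^esub>"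
    by (auto simp: carrier_braid_group)
qed (auto simp: carrier_braid_group mult_braid_class one_braid_group)

section \<open>The permutation of a braid and the quotient by commutators of pure braids\<close>

lemma word_perm_append: "word_perm (v @ w) = word_perm v \<circ> word_perm w"
  by (induction v) (auto simp: o_assoc)

lemma transpose_braid:
  "Transposition.transpose i (Suc i) (Transposition.transpose (Suc i) (Suc (Suc i)) (Transposition.transpose i (Suc i) x)) =
   Transposition.transpose (Suc i) (Suc (Suc i)) (Transposition.transpose i (Suc i) (Transposition.transpose (Suc i) (Suc (Suc i)) x))"
  by (auto simp: Transposition.transpose_def)

lemma transpose_far:
  fixes i j :: nat
  assumes "i + 2 \<le> j"
  shows "Transposition.transpose i (Suc i) (Transposition.transpose j (Suc j) x) =
         Transposition.transpose j (Suc j) (Transposition.transpose i (Suc i) x)"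
  using assms by (auto simp: Transposition.transpose_def)

lemma word_perm_equiv: "braid_equiv n v w \<Longrightarrow> word_perm v = word_perm w"
proof (induction rule: braid_equiv.induct)
  case (far i j)
  then show ?case using transpose_far[of i j] by (auto simp: fun_eq_iff)
next
  case (near i)
  then show ?case by (auto simp: fun_eq_iff transpose_braid)
qed (auto simp: word_perm_append)

lemma word_perm_permutes:
  assumes "w \<in> braid_words n"
  shows "word_perm w permutes {1..n}"
  using assms
proof (induction w)
  case Nil
  show ?case using permutes_id[of "{1..n}"] by (simp add: id_def)
next
  case (Cons l w)
  then have "Transposition.transpose (strand l) (strand l + 1) permutes {1..n}"
    by (intro permutes_swap_id) auto
  with Cons have "Transposition.transpose (strand l) (strand l + 1) \<circ> word_perm w permutes {1..n}"
    by (intro permutes_compose) auto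
  then show ?case by (simp only: word_perm.simps)
qed

lemma braid_perm_class: "braid_perm (braid_class n w) = word_perm w"
proof -
  have "word_perm ` braid_class n w = {word_perm w}"
    unfolding braid_class_def
    by (auto dest: word_perm_equiv intro: braid_equiv.refl)
  then show ?thesis by (simp add: braid_perm_def)
qed

lemma braid_perm_hom: "group_hom (braid_group n) (sym_group n) braid_perm"
proof -
  have "braid_perm \<in> hom (braid_group n) (sym_group n)"
  proof (rule homI)
    fix x assume "x \<in> carrier (braid_group n)"
    then show "braid_perm x \<in> carrier (sym_group n)"
      unfolding carrier_braid_group
      by (metis (no_types, lifting) braid_perm_class imageE sym_group_carrier word_perm_permutes)
  next
    fix x y assume "x \<in> carrier (braid_group n)" "y \<in> carrier (braid_group n)"
    then show "braid_perm (x \<otimes>\<^bsub>braid_group n\<^esub> y) = braid_perm x \<otimes>\<^bsub>sym_group n\<^esub> braid_perm y"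
      by (auto simp: carrier_braid_group braid_perm_class sym_group_mult mult_braid_class word_perm_append)
  qed
  then show ?thesis
    by (simp add: group_hom_def group_hom_axioms_def group_braid_group sym_group_is_group)
qed

lemma pure_braid_group_eq:
  "pure_braid_group n = braid_class n ` {w \<in> braid_words n. word_perm w = id}"
  by (auto simp: pure_braid_group_def kernel_def carrier_braid_group braid_perm_class sym_group_one)

lemma pure_braid_group_normal: "pure_braid_group n \<lhd> braid_group n"
  unfolding pure_braid_group_def by (rule group_hom.normal_kernel[OF braid_perm_hom])

lemma pure_commutator_normal: "pure_commutator n \<lhd> braid_group n"
  unfolding pure_commutator_def
  by (rule group.derived_is_normal[OF group_braid_group pure_braid_group_normal])

lemma group_braid_quotient: "group (braid_quotient n)"
  unfolding braid_quotient_def by (rule normal.factorgroup_is_group[OF pure_commutator_normal])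

lemma carrier_braid_quotient: "carrier (braid_quotient n) = quotient_class n ` braid_words n"
  unfolding braid_quotient_def
  by (auto simp: carrier_FactGroup carrier_braid_group quotient_class_def[abs_def])

lemma quotient_class_closed [simp]:
  "w \<in> braid_words n \<Longrightarrow> quotient_class n w \<in> carrier (braid_quotient n)"
  by (auto simp: carrier_braid_quotient)

lemma quotient_class_append:
  assumes "v \<in> braid_words n" "w \<in> braid_words n"
  shows "quotient_class n (v @ w) = quotient_class n v \<otimes>\<^bsub>braid_quotient n\<^esub> quotient_class n w"
  using assms unfolding braid_quotient_def quotient_class_def
  by (auto simp: normal.rcos_sum[OF pure_commutator_normal] carrier_braid_group mult_braid_class)

lemma quotient_class_Nil [simp]: "quotient_class n [] = \<one>\<^bsub>braid_quotient n\<^esub>"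
proof -
  interpret group "braid_group n" by (rule group_braid_group)
  have "pure_commutator n \<subseteq> carrier (braid_group n)"
    using normal_imp_subgroup[OF pure_commutator_normal] subgroup.subset by blast
  then show ?thesis
    unfolding braid_quotient_def quotient_class_def
    by (simp add: one_braid_group[symmetric] coset_mult_one)
qed

lemma quotient_class_equiv: "braid_equiv n v w \<Longrightarrow> quotient_class n v = quotient_class n w"
  by (simp add: quotient_class_def braid_class_eq_iff[symmetric])

lemma quotient_class_inv:
  assumes "w \<in> braid_words n"
  shows "quotient_class n (inv_word w) = inv\<^bsub>braid_quotient n\<^esub> quotient_class n w"
proof -
  interpret group "braid_quotient n" by (rule group_braid_quotient)
  have "quotient_class n (inv_word w) \<otimes>\<^bsub>braid_quotient n\<^esub> quotient_class n w = \<one>\<^bsub>braid_quotient n\<^esub>"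
    using assms quotient_class_equiv[OF inv_word_equiv[OF assms]]
    by (simp add: quotient_class_append[symmetric])
  then show ?thesis using assms by (intro inv_equality[symmetric]) auto
qed

text \<open>The product v w is the commutator of v and w times w v, and a commutator of pure braids
  is absorbed into the coset.\<close>

lemma quotient_class_pure_commute:
  assumes "v \<in> braid_words n" "w \<in> braid_words n" "word_perm v = id" "word_perm w = id"
  shows "quotient_class n v \<otimes>\<^bsub>braid_quotient n\<^esub> quotient_class n w
       = quotient_class n w \<otimes>\<^bsub>braid_quotient n\<^esub> quotient_class n v"
proof -
  interpret B: group "braid_group n" by (rule group_braid_group)
  interpret N: normal "pure_commutator n" "braid_group n" by (rule pure_commutator_normal)
  let ?v = "braid_class n v" and ?w = "braid_class n w"
  have vw: "?v \<in> carrier (braid_group n)" "?w \<in> carrier (braid_group n)"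
    using assms by (auto simp: carrier_braid_group)
  have "?v \<in> pure_braid_group n" "?w \<in> pure_braid_group n"
    using assms by (auto simp: pure_braid_group_eq)
  then have c: "?v \<otimes>\<^bsub>braid_group n\<^esub> ?w \<otimes>\<^bsub>braid_group n\<^esub> inv\<^bsub>braid_group n\<^esub> ?v \<otimes>\<^bsub>braid_group n\<^esub> inv\<^bsub>braid_group n\<^esub> ?w
      \<in> pure_commutator n" (is "?c \<in> _")
    unfolding pure_commutator_def derived_def by (intro generate.incl) auto
  have "?v \<otimes>\<^bsub>braid_group n\<^esub> ?w = ?c \<otimes>\<^bsub>braid_group n\<^esub> (?w \<otimes>\<^bsub>braid_group n\<^esub> ?v)"
    using vw by (simp add: B.m_assoc B.inv_cancel_left)
  moreover have "pure_commutator n #>\<^bsub>braid_group n\<^esub> (?c \<otimes>\<^bsub>braid_group n\<^esub> (?w \<otimes>\<^bsub>braid_group n\<^esub> ?v))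
      = pure_commutator n #>\<^bsub>braid_group n\<^esub> ?c #>\<^bsub>braid_group n\<^esub> (?w \<otimes>\<^bsub>braid_group n\<^esub> ?v)"
    using vw by (subst B.coset_mult_assoc) (auto simp: N.subset)
  moreover have "pure_commutator n #>\<^bsub>braid_group n\<^esub> ?c = pure_commutator n"
    using vw c by (intro B.coset_join2 N.subgroup_axioms) auto
  ultimately have "pure_commutator n #>\<^bsub>braid_group n\<^esub> (?v \<otimes>\<^bsub>braid_group n\<^esub> ?w)
      = pure_commutator n #>\<^bsub>braid_group n\<^esub> (?w \<otimes>\<^bsub>braid_group n\<^esub> ?v)"
    by simp
  then show ?thesis
    using quotient_class_append[OF assms(1,2)] quotient_class_append[OF assms(2,1)]
    by (simp add: quotient_class_def mult_braid_class)
qed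

section \<open>The affine action on functions of pairs of strands\<close>

abbreviation swap :: "nat \<Rightarrow> nat \<Rightarrow> nat" where
  "swap i \<equiv> Transposition.transpose i (Suc i)"

text \<open>The constant 1/2 makes two successive crossings of the same strands translate by 1.
  Functions live on all sets of naturals, so no side condition on pairs arises.\<close>

fun crossing :: "letter \<Rightarrow> (nat set \<Rightarrow> real) \<Rightarrow> nat set \<Rightarrow> real" where
  "crossing (Pos i) v x = v (swap i ` x) + (if x = {i, Suc i} then 1/2 else 0)"
| "crossing (Neg i) v x = v (swap i ` x) - (if x = {i, Suc i} then 1/2 else 0)"

fun act :: "letter list \<Rightarrow> (nat set \<Rightarrow> real) \<Rightarrow> nat set \<Rightarrow> real" where
  "act [] = id"
| "act (l # w) = crossing l \<circ> act w"

lemma act_append: "act (v @ w) = act v \<circ> act w"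
  by (induction v) (auto simp: o_assoc)

lemma swap_image_involutory [simp]: "swap i ` swap i ` x = x"
  by (simp add: image_comp)

lemma swap_image_eq_iff: "swap i ` x = y \<longleftrightarrow> x = swap i ` y"
  by (metis swap_image_involutory)

text \<open>In the relation \<open>near\<close>, each of the three pairs from {i, i+1, i+2} receives
  1/2 exactly once on either side. In \<open>far\<close>, each swap fixes the pair of the other. For
  the inverse relations the two halves cancel, since a swap fixes its own pair.\<close>

lemma act_equiv: "braid_equiv n v w \<Longrightarrow> act v = act w"
proof (induction rule: braid_equiv.induct)
  case (far i j)
  have "swap i j = j" "swap i (Suc j) = Suc j" "swap j i = i" "swap j (Suc i) = Suc i"
    using far by (auto simp: Transposition.transpose_def)
  moreover have "swap i ` swap j ` x = swap j ` swap i ` x" for x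
    using transpose_far[of i j] far by (simp add: image_image)
  ultimately have "crossing (Pos i) (crossing (Pos j) v) x = crossing (Pos j) (crossing (Pos i) v) x" for v x
    by (simp add: swap_image_eq_iff[where y = "{_, _}"])
  then show ?case by (simp add: fun_eq_iff)
next
  case (near i)
  have "swap i (Suc (Suc i)) = Suc (Suc i)" "swap (Suc i) i = i"
    by (auto simp: Transposition.transpose_def)
  moreover have "swap i ` swap (Suc i) ` swap i ` x = swap (Suc i) ` swap i ` swap (Suc i) ` x" for x
    by (simp add: image_image transpose_braid)
  ultimately have "crossing (Pos i) (crossing (Pos (Suc i)) (crossing (Pos i) v)) x
      = crossing (Pos (Suc i)) (crossing (Pos i) (crossing (Pos (Suc i)) v)) x" for v x
    by (simp add: swap_image_eq_iff[where y = "{_, _}"] insert_commute)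
  then show ?case by (simp add: fun_eq_iff)
next
  case (right_inv i)
  show ?case by (simp add: fun_eq_iff swap_image_eq_iff[where y = "{_, _}"] insert_commute)
next
  case (left_inv i)
  show ?case by (simp add: fun_eq_iff swap_image_eq_iff[where y = "{_, _}"] insert_commute)
qed (simp_all add: act_append)

lemma bij_word_perm: "bij (word_perm w)"
proof (induction w)
  case (Cons l w)
  then show ?case unfolding word_perm.simps by (intro bij_comp bij_transpose)
qed (simp only: word_perm.simps bij_id)

text \<open>Every word acts as an affine map: the linear part permutes the arguments and the
  translation part is the image of the zero function.\<close>

lemma act_eq: "act w v x = act w (\<lambda>_. 0) x + v (inv' (word_perm w) ` x)"
proof (induction w arbitrary: x)
  case Nil
  show ?case by (simp add: inv_id[unfolded id_def])
next
  case (Cons l w)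
  have "inv' (word_perm (l # w)) = inv' (word_perm w) \<circ> swap (strand l)"
    unfolding word_perm.simps using o_inv_distrib[OF bij_transpose bij_word_perm]
    by (simp add: inv_transpose_eq)
  then have "inv' (word_perm (l # w)) ` x = inv' (word_perm w) ` swap (strand l) ` x"
    by (simp only: image_comp)
  then show ?case using Cons[of "swap (strand l) ` x"]
    by (cases l) (auto simp del: word_perm.simps)
qed

lemma act_pure: "word_perm w = id \<Longrightarrow> act w v x = act w (\<lambda>_. 0) x + v x"
  by (subst act_eq) simp

lemma inv_word_inv_word [simp]: "inv_word (inv_word w) = w"
proof -
  have "inv_letter (inv_letter l) = l" for l
    by (cases l) auto
  then show ?thesis by (simp add: inv_word_def rev_map comp_def)
qed

lemma act_inv_word:
  assumes "w \<in> braid_words n"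
  shows "act (inv_word w) (act w v) = v"
  using act_equiv[OF inv_word_equiv[OF assms]] by (simp add: act_append fun_eq_iff)

lemma word_perm_inv_word:
  assumes "w \<in> braid_words n"
  shows "word_perm (inv_word w) = inv' (word_perm w)"
proof -
  have *: "word_perm (inv_word w) \<circ> word_perm w = id"
    using word_perm_equiv[OF inv_word_equiv[OF assms]]
    by (simp only: word_perm_append word_perm.simps)
  have "word_perm (inv_word w) x = inv' (word_perm w) x" for x
    using fun_cong[OF *, of "inv' (word_perm w) x"]
    by (simp add: surj_f_inv_f bij_is_surj bij_word_perm)
  then show ?thesis by blast
qed

text \<open>By \<open>act_pure\<close> pure words act by translations, and translations commute.
  Hence the classes of pure words acting trivially form a subgroup \<open>N\<close> that contains
  every commutator of pure braids.\<close>

lemma pure_commutator_act: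
  assumes "C \<in> pure_commutator n"
  obtains w where "w \<in> braid_words n" "C = braid_class n w" "word_perm w = id" "act w = id"
proof -
  interpret B: group "braid_group n" by (rule group_braid_group)
  have inv_class: "inv\<^bsub>braid_group n\<^esub> braid_class n w = braid_class n (inv_word w)" if "w \<in> braid_words n" for w
  proof (rule B.inv_equality)
    show "braid_class n (inv_word w) \<otimes>\<^bsub>braid_group n\<^esub> braid_class n w = \<one>\<^bsub>braid_group n\<^esub>"
      using that by (simp add: mult_braid_class one_braid_group braid_class_eq_iff inv_word_equiv)
  qed (use that in \<open>simp_all add: carrier_braid_group\<close>)
  define N where "N = {braid_class n w |w. w \<in> braid_words n \<and> word_perm w = id \<and> act w = id}"
  have N: "braid_class n w \<in> N" if "w \<in> braid_words n" "word_perm w = id" "act w = id" for w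
    using that unfolding N_def by blast
  have "subgroup N (braid_group n)"
  proof (rule B.subgroupI)
    show "N \<subseteq> carrier (braid_group n)"
      by (auto simp: N_def carrier_braid_group)
    have "braid_class n [] \<in> N" by (rule N) (simp_all only: braid_words_Nil word_perm.simps act.simps)
    then show "N \<noteq> {}" by blast
  next
    fix C assume "C \<in> N"
    then obtain w where w: "w \<in> braid_words n" "word_perm w = id" "act w = id" "C = braid_class n w"
      unfolding N_def by blast
    have "act (inv_word w) = id"
      using act_inv_word[OF w(1)] w(3) by (simp add: fun_eq_iff)
    then show "inv\<^bsub>braid_group n\<^esub> C \<in> N"
      unfolding w(4) inv_class[OF w(1)]
      using w by (intro N) (simp_all only: inv_word_in_braid_words word_perm_inv_word inv_id)
  next
    fix C D assume "C \<in> N" "D \<in> N"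
    then obtain v w where *: "v \<in> braid_words n" "w \<in> braid_words n" "C = braid_class n v" "D = braid_class n w"
      "word_perm v = id" "word_perm w = id" "act v = id" "act w = id"
      unfolding N_def by blast
    show "C \<otimes>\<^bsub>braid_group n\<^esub> D \<in> N"
      unfolding *(3,4) mult_braid_class
      by (rule N) (use * in \<open>simp_all add: word_perm_append act_append\<close>)
  qed
  moreover have "D \<otimes>\<^bsub>braid_group n\<^esub> E \<otimes>\<^bsub>braid_group n\<^esub> inv\<^bsub>braid_group n\<^esub> D \<otimes>\<^bsub>braid_group n\<^esub> inv\<^bsub>braid_group n\<^esub> E \<in> N"
    if DE: "D \<in> pure_braid_group n" "E \<in> pure_braid_group n" for D E
  proof -
    obtain v w where v: "v \<in> braid_words n" "word_perm v = id" "D = braid_class n v"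
      and w: "w \<in> braid_words n" "word_perm w = id" "E = braid_class n w"
      using DE unfolding pure_braid_group_eq by blast
    have comm: "act v (act w f) = act w (act v f)" for f
      by (rule ext) (simp add: act_pure[OF v(2), of "act w f"] act_pure[OF v(2), of f]
          act_pure[OF w(2), of "act v f"] act_pure[OF w(2), of f])
    have inverse: "act w (act (inv_word w) f) = f" "act v (act (inv_word v) f) = f" for f
      using act_inv_word[of "inv_word w" n f] act_inv_word[of "inv_word v" n f] v w
      by simp_all
    have "act v (act w (act (inv_word v) (act (inv_word w) f))) = f" for f
      by (simp only: comm inverse)
    then have "act (v @ w @ inv_word v @ inv_word w) = id"
      by (simp add: act_append fun_eq_iff)
    moreover have "word_perm (v @ w @ inv_word v @ inv_word w) = id"
      using v w by (simp add: word_perm_append word_perm_inv_word)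
    ultimately have "braid_class n (v @ w @ inv_word v @ inv_word w) \<in> N"
      using v w by (intro N) simp_all
    then show ?thesis
      by (simp add: v w inv_class mult_braid_class)
  qed
  ultimately have "pure_commutator n \<subseteq> N"
    unfolding pure_commutator_def derived_def
    by (intro B.generate_subgroup_incl) blast+
  with assms that show ?thesis unfolding N_def by blast
qed

text \<open>Words with the same class differ by a factor that acts trivially. So
  \<open>quotient_act\<close> below may choose any representative.\<close>

lemma act_quotient_class:
  assumes "v \<in> braid_words n" "w \<in> braid_words n" "quotient_class n v = quotient_class n w"
  shows "act v = act w"
proof -
  interpret B: group "braid_group n" by (rule group_braid_group)
  interpret N: normal "pure_commutator n" "braid_group n" by (rule pure_commutator_normal)
  have "braid_class n v \<in> quotient_class n v"
    unfolding quotient_class_def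
    by (rule B.rcos_self) (use assms N.subgroup_axioms in \<open>auto simp: carrier_braid_group\<close>)
  then obtain C where "C \<in> pure_commutator n" "braid_class n v = C \<otimes>\<^bsub>braid_group n\<^esub> braid_class n w"
    unfolding assms(3) by (auto simp: quotient_class_def r_coset_def)
  moreover from this(1) obtain c where "C = braid_class n c" "act c = id"
    by (rule pure_commutator_act)
  ultimately have "braid_equiv n v (c @ w)" "act c = id"
    by (simp_all add: mult_braid_class braid_class_eq_iff)
  then show ?thesis
    using act_equiv[of n v "c @ w"] by (simp add: act_append)
qed

definition quotient_act :: "nat \<Rightarrow> letter list set set \<Rightarrow> (nat set \<Rightarrow> real) \<Rightarrow> nat set \<Rightarrow> real" where
  "quotient_act n g = act (SOME w. w \<in> braid_words n \<and> quotient_class n w = g)"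

lemma quotient_act_class:
  assumes "w \<in> braid_words n"
  shows "quotient_act n (quotient_class n w) = act w"
  unfolding quotient_act_def
proof (rule someI2[of _ w])
  show "act x = act w" if "x \<in> braid_words n \<and> quotient_class n x = quotient_class n w" for x
    using that assms act_quotient_class by blast
qed (use assms in auto)

lemma quotient_act_mult:
  assumes "g \<in> carrier (braid_quotient n)" "h \<in> carrier (braid_quotient n)"
  shows "quotient_act n (g \<otimes>\<^bsub>braid_quotient n\<^esub> h) = quotient_act n g \<circ> quotient_act n h"
  using assms
  by (auto simp: carrier_braid_quotient quotient_act_class act_append simp flip: quotient_class_append)

lemma quotient_act_one: "quotient_act n \<one>\<^bsub>braid_quotient n\<^esub> = id"
  using quotient_act_class[of "[]" n] by simp

section \<open>Conjugation of the pure generators\<close>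

lemma swap_le: "i < k \<Longrightarrow> swap k i = i"
  by (simp add: Transposition.transpose_def)

lemma swap_ge: "Suc k < i \<Longrightarrow> swap k i = i"
  by (simp add: Transposition.transpose_def)

text \<open>\<open>S k\<close> stands for conjugation by the generator of index k. The axioms
  isolate what the index computation uses; \<open>square\<close> is the one that relies on pure
  braids commuting in the quotient.\<close>

locale braid_action =
  fixes C :: "'g set" and S :: "nat \<Rightarrow> 'g \<Rightarrow> 'g" and A :: "nat \<Rightarrow> nat \<Rightarrow> 'g" and n :: nat
  assumes A_in: "\<lbrakk>1 \<le> i; i < j; j \<le> n\<rbrakk> \<Longrightarrow> A i j \<in> C"
    and far: "\<lbrakk>1 \<le> i; i + 2 \<le> j; j < n; x \<in> C\<rbrakk> \<Longrightarrow> S i (S j x) = S j (S i x)"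
    and near: "\<lbrakk>1 \<le> i; i + 1 < n; x \<in> C\<rbrakk> \<Longrightarrow>
      S i (S (Suc i) (S i x)) = S (Suc i) (S i (S (Suc i) x))"
    and step: "\<lbrakk>1 \<le> i; i < j; j < n\<rbrakk> \<Longrightarrow> A i (Suc j) = S j (A i j)"
    and square: "\<lbrakk>1 \<le> i; i < j; j \<le> n; 1 \<le> k; k < n\<rbrakk> \<Longrightarrow> S k (S k (A i j)) = A i j"
    and base: "\<lbrakk>1 \<le> i; i < n; 1 \<le> k; k < n; k = i \<or> i + 2 \<le> k \<or> k + 2 \<le> i\<rbrakk> \<Longrightarrow>
      S k (A i (Suc i)) = A i (Suc i)"
    and turn: "\<lbrakk>1 \<le> i; i + 1 < n\<rbrakk> \<Longrightarrow> S i (A i (Suc (Suc i))) = A (Suc i) (Suc (Suc i))"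
begin

lemma above: "\<lbrakk>1 \<le> i; i < j; j < k; k < n\<rbrakk> \<Longrightarrow> S k (A i j) = A i j"
proof (induction j)
  case (Suc j)
  show ?case
  proof (cases "i = j")
    case False
    then have "S k (A i (Suc j)) = S j (S k (A i j))"
      using Suc far[of j k "A i j", symmetric] A_in by (simp add: step)
    with False Suc show ?thesis by (simp add: step)
  qed (use Suc base in simp)
qed simp

lemma below: "\<lbrakk>1 \<le> k; k + 2 \<le> i; i < j; j \<le> n\<rbrakk> \<Longrightarrow> S k (A i j) = A i j"
proof (induction j)
  case (Suc j)
  show ?case
  proof (cases "i = j")
    case False
    then have "S k (A i (Suc j)) = S j (S k (A i j))"
      using Suc far[of k j] A_in by (simp add: step)
    with False Suc show ?thesis by (simp add: step)
  qed (use Suc base in simp)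
qed simp

text \<open>The critical case is j = k + 1: the braid relation exchanges the outer
  \<open>S k\<close> for an inner \<open>S (Suc k)\<close>, which fixes \<open>A i k\<close> by
  \<open>above\<close>.\<close>

lemma between: "\<lbrakk>1 \<le> i; i < k; k + 1 < j; j \<le> n\<rbrakk> \<Longrightarrow> S k (A i j) = A i j"
proof (induction j)
  case (Suc j)
  show ?case
  proof (cases "j = Suc k")
    case True
    then have "S k (A i (Suc j)) = S (Suc k) (S k (S (Suc k) (A i k)))"
      using Suc near[of k] A_in by (simp add: step)
    with True Suc above show ?thesis by (simp add: step)
  next
    case False
    then have "S k (A i (Suc j)) = S j (S k (A i j))"
      using Suc far[of k j] A_in by (simp add: step)
    with False Suc show ?thesis by (simp add: step)
  qed
qed simp

lemma lower_end: "\<lbrakk>1 \<le> i; i + 1 < j; j \<le> n\<rbrakk> \<Longrightarrow> S i (A i j) = A (Suc i) j"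
proof (induction j)
  case (Suc j)
  show ?case
  proof (cases "j = Suc i")
    case True
    with Suc turn show ?thesis by simp
  next
    case False
    then have "S i (A i (Suc j)) = S j (S i (A i j))"
      using Suc far[of i j] A_in by (simp add: step)
    with False Suc show ?thesis by (simp add: step)
  qed
qed simp

text \<open>Cases 2 and 6 move an end of the pair upwards, directly by \<open>step\<close> and
  \<open>lower_end\<close>. Cases 4 and 7 move it back and therefore need \<open>square\<close>. In
  all other cases the pair is fixed.\<close>

lemma conj:
  assumes "1 \<le> k" "k < n" "1 \<le> i" "i < j" "j \<le> n"
  shows "S k (A i j) = A (Min (swap k ` {i, j})) (Max (swap k ` {i, j}))"
proof -
  consider "j < k" | "j = k" | "Suc k = j" "i = k" | "Suc k = j" "i < k" | "k + 1 < j" "i < k" | "k + 1 < j" "i = k"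
    | "k + 1 < j" "i = Suc k" | "k + 2 \<le> i"
    using assms by linarith
  then show ?thesis
  proof cases
    case 1
    with assms show ?thesis by (simp add: above swap_le)
  next
    case 2
    with assms show ?thesis by (simp add: step swap_le)
  next
    case 3
    with assms base[of k k] show ?thesis by (auto simp: insert_commute)
  next
    case 4
    then have "S k (A i j) = A i k"
      using assms square[of i k k] by (auto simp: step)
    with 4 assms show ?thesis by (auto simp: swap_le)
  next
    case 5
    with assms show ?thesis by (simp add: between swap_le swap_ge)
  next
    case 6
    with assms show ?thesis by (simp add: lower_end swap_ge)
  next
    case 7
    then have "S k (A i j) = S k (S k (A k j))"
      using assms by (simp add: lower_end)
    with 7 assms show ?thesis by (simp add: square swap_ge)
  next
    case 8
    with assms show ?thesis by (simp add: below swap_ge)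
  qed
qed

end

lemma (in group) conj_mult:
  assumes "g \<in> carrier G" "h \<in> carrier G" "x \<in> carrier G"
  shows "g \<otimes> (h \<otimes> x \<otimes> inv h) \<otimes> inv g = (g \<otimes> h) \<otimes> x \<otimes> inv (g \<otimes> h)"
  using assms by (simp add: m_assoc inv_mult_group)

lemma (in group) conj_commute:
  assumes "g \<in> carrier G" "x \<in> carrier G" "g \<otimes> x = x \<otimes> g"
  shows "g \<otimes> x \<otimes> inv g = x"
  using assms by (simp add: m_assoc)

definition pairs :: "nat \<Rightarrow> nat set set" where
  "pairs n = {{i, j} |i j. 1 \<le> i \<and> i < j \<and> j \<le> n}"

text \<open>Indexing by the unordered pair lets a permutation act on the index simply by taking
  images.\<close>

definition pure_gen :: "nat \<Rightarrow> nat set \<Rightarrow> letter list set set" where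
  "pure_gen n x = quotient_class n (A_word (Min x) (Max x))"

lemma A_word_step: "i < j \<Longrightarrow> A_word i (Suc j) = Pos j # A_word i j @ [Neg j]"
  by (simp add: A_word_def)

lemma A_word_base: "A_word i (Suc i) = [Pos i, Pos i]"
  by (simp add: A_word_def)

lemma A_word_in: "\<lbrakk>1 \<le> i; i < j; j \<le> n\<rbrakk> \<Longrightarrow> A_word i j \<in> braid_words n"
  by (auto simp: A_word_def braid_words_def)

lemma word_perm_A_word: "i < j \<Longrightarrow> word_perm (A_word i j) = id"
proof (induction j)
  case (Suc j)
  then show ?case
    by (cases "i = j") (auto simp: A_word_base A_word_step word_perm_append fun_eq_iff)
qed simp

text \<open>Conjugation by the letter of index j moves the pair {i, j} to {i, j + 1}, and the half
  translations of the letter and of its inverse cancel.\<close>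

lemma act_A_word: "i < j \<Longrightarrow> act (A_word i j) v x = v x + (if x = {i, j} then 1 else 0)"
proof (induction j arbitrary: v x)
  case (Suc j)
  show ?case
  proof (cases "i = j")
    case True
    then show ?thesis
      by (simp add: A_word_base swap_image_eq_iff[where y = "{_, _}"] insert_commute)
  next
    case False
    with Suc show ?thesis
      by (simp add: A_word_step act_append swap_image_eq_iff[where y = "{_, _}"] swap_le insert_commute)
  qed
qed simp

context
  fixes n :: nat
begin

interpretation group "braid_quotient n" by (rule group_braid_quotient)

lemma pure_gen_closed: "x \<in> pairs n \<Longrightarrow> pure_gen n x \<in> carrier (braid_quotient n)"
  by (auto simp: pairs_def pure_gen_def A_word_in)

lemma pure_gen_conj_letter:
  assumes "1 \<le> k" "k < n" "x \<in> pairs n"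
  shows "quotient_class n [Pos k] \<otimes>\<^bsub>braid_quotient n\<^esub> pure_gen n x \<otimes>\<^bsub>braid_quotient n\<^esub>
    inv\<^bsub>braid_quotient n\<^esub> quotient_class n [Pos k] = pure_gen n (swap k ` x)"
proof -
  let ?s = "\<lambda>k. quotient_class n [Pos k]"
  let ?S = "\<lambda>k x. ?s k \<otimes>\<^bsub>braid_quotient n\<^esub> x \<otimes>\<^bsub>braid_quotient n\<^esub> inv\<^bsub>braid_quotient n\<^esub> ?s k"
  let ?A = "\<lambda>i j. quotient_class n (A_word i j)"
  have s_far: "?s i \<otimes>\<^bsub>braid_quotient n\<^esub> ?s j = ?s j \<otimes>\<^bsub>braid_quotient n\<^esub> ?s i" if "1 \<le> i" "i + 2 \<le> j" "j < n" for i j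
    using that quotient_class_equiv[OF braid_equiv.far[OF that]]
    by (simp flip: quotient_class_append)
  have s_near: "?s i \<otimes>\<^bsub>braid_quotient n\<^esub> (?s (Suc i) \<otimes>\<^bsub>braid_quotient n\<^esub> ?s i)
      = ?s (Suc i) \<otimes>\<^bsub>braid_quotient n\<^esub> (?s i \<otimes>\<^bsub>braid_quotient n\<^esub> ?s (Suc i))" if "1 \<le> i" "i + 1 < n" for i
    using that quotient_class_equiv[OF braid_equiv.near[OF that]]
    by (simp flip: quotient_class_append)
  have s_closed: "?s i \<in> carrier (braid_quotient n)" if "1 \<le> i" "i < n" for i
    using that by simp
  have conj_word: "?S k (quotient_class n w) = quotient_class n (Pos k # w @ [Neg k])"
    if "1 \<le> k" "k < n" "w \<in> braid_words n" for k w
    using that quotient_class_inv[of "[Pos k]" n] quotient_class_append[of "[Pos k]" n "w @ [Neg k]"]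
      quotient_class_append[of w n "[Neg k]"]
    by (simp add: m_assoc)
  interpret braid_action "carrier (braid_quotient n)" ?S ?A n
  proof unfold_locales
    fix i j x assume "1 \<le> i" "i + 2 \<le> j" "j < n" "x \<in> carrier (braid_quotient n)"
    then show "?S i (?S j x) = ?S j (?S i x)"
      using s_far[of i j] by (simp add: conj_mult s_closed)
  next
    fix i x assume *: "1 \<le> i" "i + 1 < n" "x \<in> carrier (braid_quotient n)"
    then show "?S i (?S (Suc i) (?S i x)) = ?S (Suc i) (?S i (?S (Suc i) x))"
      using s_near[of i] by (simp add: conj_mult s_closed)
  next
    fix i j k assume *: "1 \<le> i" "i < j" "j \<le> n" "1 \<le> k" "k < n"
    have "?S k (?S k (?A i j)) = quotient_class n [Pos k, Pos k] \<otimes>\<^bsub>braid_quotient n\<^esub> ?A i j \<otimes>\<^bsub>braid_quotient n\<^esub>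
        inv\<^bsub>braid_quotient n\<^esub> quotient_class n [Pos k, Pos k]"
      using * quotient_class_append[of "[Pos k]" n "[Pos k]"] by (simp add: conj_mult A_word_in)
    \<comment> \<open>The square of a generator is a pure braid, so it commutes with
      \<open>?A i j\<close> in the quotient.\<close>
    also have "\<dots> = ?A i j"
      using * by (intro conj_commute quotient_class_pure_commute)
        (auto simp: A_word_in word_perm_A_word fun_eq_iff)
    finally show "?S k (?S k (?A i j)) = ?A i j" .
  next
    fix i k assume *: "1 \<le> i" "i < n" "1 \<le> k" "k < n" "k = i \<or> i + 2 \<le> k \<or> k + 2 \<le> i"
    then have ki: "?s k \<otimes>\<^bsub>braid_quotient n\<^esub> ?s i = ?s i \<otimes>\<^bsub>braid_quotient n\<^esub> ?s k"
      using s_far[of i k] s_far[of k i] by auto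
    have "?A i (Suc i) = ?s i \<otimes>\<^bsub>braid_quotient n\<^esub> ?s i"
      using * by (simp add: A_word_base flip: quotient_class_append)
    moreover have "?s k \<otimes>\<^bsub>braid_quotient n\<^esub> (?s i \<otimes>\<^bsub>braid_quotient n\<^esub> ?s i) = (?s i \<otimes>\<^bsub>braid_quotient n\<^esub> ?s i) \<otimes>\<^bsub>braid_quotient n\<^esub> ?s k"
      using * s_closed ki by (metis m_assoc)
    ultimately show "?S k (?A i (Suc i)) = ?A i (Suc i)"
      using * s_closed conj_commute by simp
  next
    fix i assume *: "1 \<le> i" "i + 1 < n"
    have "?A i (Suc (Suc i)) = ?S (Suc i) (?s i \<otimes>\<^bsub>braid_quotient n\<^esub> ?s i)"
      using * conj_word[of "Suc i" "[Pos i, Pos i]"] quotient_class_append[of "[Pos i]" n "[Pos i]"]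
      by (simp add: A_word_step A_word_base)
    then have "?S i (?A i (Suc (Suc i))) = ?s i \<otimes>\<^bsub>braid_quotient n\<^esub> ?s (Suc i) \<otimes>\<^bsub>braid_quotient n\<^esub> (?s i \<otimes>\<^bsub>braid_quotient n\<^esub> ?s i)
       \<otimes>\<^bsub>braid_quotient n\<^esub> inv\<^bsub>braid_quotient n\<^esub> (?s i \<otimes>\<^bsub>braid_quotient n\<^esub> ?s (Suc i))"
      using * by (simp add: conj_mult s_closed)
    \<comment> \<open>The braid relation is applied twice: s_i s_(i+1) s_i s_i = s_(i+1) s_i s_(i+1)
      s_i = s_(i+1) s_(i+1) s_i s_(i+1).\<close>
    also have "?s i \<otimes>\<^bsub>braid_quotient n\<^esub> ?s (Suc i) \<otimes>\<^bsub>braid_quotient n\<^esub> (?s i \<otimes>\<^bsub>braid_quotient n\<^esub> ?s i)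
        = ?s (Suc i) \<otimes>\<^bsub>braid_quotient n\<^esub> ?s (Suc i) \<otimes>\<^bsub>braid_quotient n\<^esub> (?s i \<otimes>\<^bsub>braid_quotient n\<^esub> ?s (Suc i))"
      using * s_closed s_near[of i] by (simp flip: m_assoc) (simp add: m_assoc)
    also have "\<dots> \<otimes>\<^bsub>braid_quotient n\<^esub> inv\<^bsub>braid_quotient n\<^esub> (?s i \<otimes>\<^bsub>braid_quotient n\<^esub> ?s (Suc i))
        = ?s (Suc i) \<otimes>\<^bsub>braid_quotient n\<^esub> ?s (Suc i)"
      using * s_closed by (simp add: m_assoc)
    also have "\<dots> = ?A (Suc i) (Suc (Suc i))"
      using * by (simp add: A_word_base flip: quotient_class_append)
    finally show "?S i (?A i (Suc (Suc i))) = ?A (Suc i) (Suc (Suc i))" .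
  next
    fix i j assume *: "1 \<le> i" "i < j" "j < n"
    then show "?A i (Suc j) = ?S j (?A i j)"
      by (simp add: conj_word A_word_in A_word_step)
  qed (simp add: A_word_in)
  obtain i j where "x = {i, j}" "1 \<le> i" "i < j" "j \<le> n"
    using assms(3) unfolding pairs_def by blast
  with conj[of k i j] assms show ?thesis
    by (simp add: pure_gen_def)
qed

end

section \<open>Powers of a Coxeter element\<close>

text \<open>Passing a generator through \<open>c = s\<^sub>m \<dots> s\<^sub>1\<close> lowers its index. This gives
  \<open>c ^ m = s\<^sub>1 \<dots> s\<^sub>m c' ^ m\<close>, where \<open>c' = s\<^bsub>m-1\<^esub> \<dots> s\<^sub>1\<close>, that is \<open>c ^ (m + 1) = c' ^ m\<close>.\<close>

locale coxeter_words =
  fixes R :: "nat list \<Rightarrow> nat list \<Rightarrow> bool" and n :: nat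
  assumes R_refl: "R w w"
    and R_sym: "R v w \<Longrightarrow> R w v"
    and R_trans: "R u v \<Longrightarrow> R v w \<Longrightarrow> R u w"
    and R_cong: "\<lbrakk>R v v'; R w w'; set (v @ w) \<subseteq> {1..<n}; set (v' @ w') \<subseteq> {1..<n}\<rbrakk> \<Longrightarrow> R (v @ w) (v' @ w')"
    and R_square: "\<lbrakk>1 \<le> i; i < n\<rbrakk> \<Longrightarrow> R [i, i] []"
    and R_far: "\<lbrakk>1 \<le> i; i + 2 \<le> j; j < n\<rbrakk> \<Longrightarrow> R [i, j] [j, i]"
    and R_near: "\<lbrakk>1 \<le> i; i + 1 < n\<rbrakk> \<Longrightarrow> R [i, Suc i, i] [Suc i, i, Suc i]"
begin

lemma R_in_context:
  assumes "R v w" "set (u @ v @ u') \<subseteq> {1..<n}" "set w \<subseteq> {1..<n}"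
  shows "R (u @ v @ u') (u @ w @ u')"
  using assms by (intro R_cong R_refl) auto

definition cox :: "nat \<Rightarrow> nat list" where
  "cox m = rev [1..<Suc m]"

lemma cox_0 [simp]: "cox 0 = []"
  by (simp add: cox_def)

lemma cox_Suc: "cox (Suc m) = Suc m # cox m"
  by (simp add: cox_def)

lemma set_cox: "set (cox m) = {1..m}"
  by (auto simp: cox_def)

lemma cox_commute: "\<lbrakk>m + 2 \<le> i; i < n\<rbrakk> \<Longrightarrow> R (cox m @ [i]) (i # cox m)"
proof (induction m)
  case 0
  show ?case by (simp add: R_refl)
next
  case (Suc m)
  have "R ([Suc m] @ (cox m @ [i]) @ []) ([Suc m] @ (i # cox m) @ [])"
    using Suc by (intro R_in_context) (auto simp: set_cox)
  moreover have "R ([] @ [Suc m, i] @ cox m) ([] @ [i, Suc m] @ cox m)"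
    using Suc by (intro R_in_context R_far) (auto simp: set_cox)
  ultimately show ?case by (auto simp: cox_Suc intro: R_trans)
qed

lemma cox_shift: "\<lbrakk>2 \<le> i; i \<le> m; m < n\<rbrakk> \<Longrightarrow> R (cox m @ [i]) ((i - 1) # cox m)"
proof (induction m)
  case (Suc m)
  show ?case
  proof (cases "i = Suc m")
    case True
    with Suc obtain l where l: "m = Suc l" by (cases m) auto
    \<comment> \<open>The top index cannot be handled by induction: it slides left past
      \<open>cox l\<close>, after which the braid relation applies to the first three
      letters.\<close>
    have "R ([Suc m, m] @ (cox l @ [i]) @ []) ([Suc m, m] @ (i # cox l) @ [])"
      using Suc True l by (intro R_in_context cox_commute) (auto simp: set_cox)
    moreover have "R ([] @ [Suc m, m, Suc m] @ cox l) ([] @ [m, Suc m, m] @ cox l)"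
      using Suc l by (intro R_in_context R_sym[OF R_near]) (auto simp: set_cox)
    ultimately show ?thesis using True l by (auto simp: cox_Suc intro: R_trans)
  next
    case False
    then have "R ([Suc m] @ (cox m @ [i]) @ []) ([Suc m] @ ((i - 1) # cox m) @ [])"
      using Suc by (intro R_in_context) (auto simp: set_cox)
    moreover have "R ([] @ [Suc m, i - 1] @ cox m) ([] @ [i - 1, Suc m] @ cox m)"
      using Suc False by (intro R_in_context R_sym[OF R_far]) (auto simp: set_cox)
    ultimately show ?thesis by (auto simp: cox_Suc intro: R_trans)
  qed
qed simp

lemma cox_shift_interval:
  "\<lbrakk>1 \<le> i; m < n; j \<le> m\<rbrakk> \<Longrightarrow> R (cox m @ [Suc i..<Suc j]) ([i..<j] @ cox m)"
proof (induction j)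
  case (Suc j)
  show ?case
  proof (cases "i \<le> j")
    case True
    have "R ([] @ (cox m @ [Suc i..<Suc j]) @ [Suc j]) ([] @ ([i..<j] @ cox m) @ [Suc j])"
      using Suc by (intro R_in_context) (auto simp: set_cox)
    moreover have "R ([i..<j] @ (cox m @ [Suc j]) @ []) ([i..<j] @ ((Suc j - 1) # cox m) @ [])"
      using Suc True by (intro R_in_context cox_shift) (auto simp: set_cox)
    ultimately show ?thesis using True by (auto intro: R_trans)
  qed (simp add: R_refl)
qed (simp add: R_refl)

lemma rev_cancel: "set w \<subseteq> {1..<n} \<Longrightarrow> R (rev w @ w) []"
proof (induction w)
  case (Cons i w)
  then have "R (rev w @ [i, i] @ w) (rev w @ [] @ w)"
    by (intro R_in_context R_square) auto
  with Cons show ?case by (auto intro: R_trans)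
qed (simp add: R_refl)

lemma cox_cancel: "m < n \<Longrightarrow> R (cox m @ [1..<Suc m]) []"
  unfolding cox_def by (rule rev_cancel) auto

abbreviation cox_pow :: "nat \<Rightarrow> nat \<Rightarrow> nat list" where
  "cox_pow m k \<equiv> concat (replicate k (cox m))"

lemma set_cox_pow: "set (cox_pow m k) \<subseteq> {1..m}"
  by (induction k) (auto simp: set_cox)

text \<open>A further factor \<open>cox (Suc m)\<close> lowers every index of the ascending interval
  by one when it passes to the right; its own first letter \<open>Suc m\<close> then refills the top
  of the interval.\<close>

lemma cox_pow_reduce:
  assumes "Suc m < n"
  shows "k \<le> Suc m \<Longrightarrow> R (cox_pow (Suc m) k) ([Suc (Suc m) - k..<Suc (Suc m)] @ cox_pow m k)"
proof (induction k)
  case (Suc k)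
  let ?I = "[Suc (Suc m) - k..<Suc (Suc m)]"
  have *: "set (cox_pow m k) \<subseteq> {1..<n}" "set (cox_pow (Suc m) k) \<subseteq> {1..<n}"
    using set_cox_pow[where m = m and k = k] set_cox_pow[where m = "Suc m" and k = k] assms by auto
  have "R (cox (Suc m) @ cox_pow (Suc m) k @ []) (cox (Suc m) @ (?I @ cox_pow m k) @ [])"
    using Suc assms * by (intro R_in_context) (auto simp: set_cox)
  moreover have "R ([] @ (cox (Suc m) @ [Suc (Suc m - k)..<Suc (Suc m)]) @ cox_pow m k)
      ([] @ ([Suc m - k..<Suc m] @ cox (Suc m)) @ cox_pow m k)"
    using Suc assms * by (intro R_in_context cox_shift_interval) (auto simp: set_cox)
  ultimately have "R (cox (Suc m) @ cox_pow (Suc m) k) (([Suc m - k..<Suc m] @ [Suc m]) @ cox m @ cox_pow m k)"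
    using Suc.prems by (auto simp: cox_Suc Suc_diff_le intro: R_trans)
  then show ?case
    using Suc.prems by (simp add: upt_Suc_append[of "Suc m - k" "Suc m"])
qed (simp add: R_refl)

lemma cox_pow_trivial: "m < n \<Longrightarrow> R (cox_pow m (Suc m)) []"
proof (induction m)
  case 0
  show ?case by (simp add: R_refl)
next
  case (Suc m)
  have *: "set (cox_pow m (Suc m)) \<subseteq> {1..<n}" "set (cox_pow (Suc m) (Suc m)) \<subseteq> {1..<n}"
    using set_cox_pow[where m = m and k = "Suc m"] set_cox_pow[where m = "Suc m" and k = "Suc m"] Suc.prems by auto
  have "R (cox (Suc m) @ cox_pow (Suc m) (Suc m) @ []) (cox (Suc m) @ ([Suc (Suc m) - Suc m..<Suc (Suc m)] @ cox_pow m (Suc m)) @ [])"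
    using * Suc.prems cox_pow_reduce[of m "Suc m"] by (intro R_in_context) (auto simp: set_cox)
  then have "R (cox_pow (Suc m) (Suc (Suc m))) ([] @ (cox (Suc m) @ [1..<Suc (Suc m)]) @ cox_pow m (Suc m))"
    by simp
  moreover have "R ([] @ (cox (Suc m) @ [1..<Suc (Suc m)]) @ cox_pow m (Suc m)) ([] @ [] @ cox_pow m (Suc m))"
    using * Suc.prems cox_cancel[of "Suc m"] by (intro R_in_context) (auto simp: set_cox)
  ultimately show ?case
    using Suc by (auto intro: R_trans)
qed

end

section \<open>The subgroup generated by the pure generators\<close>

lemma pairs_eq: "pairs n = {x. x \<subseteq> {1..n} \<and> card x = 2}"
proof -
  have "x \<in> pairs n" if x: "x \<subseteq> {1..n}" "card x = 2" for x
  proof -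
    obtain i j where "x = {i, j}" "i \<noteq> j"
      using x(2) by (auto simp: card_2_iff)
    then obtain i j where "x = {i, j}" "i < j"
      by (metis insert_commute linorder_neqE_nat)
    with x(1) show ?thesis
      unfolding pairs_def by (intro CollectI exI[of _ i] exI[of _ j]) auto
  qed
  moreover have "x \<subseteq> {1..n} \<and> card x = 2" if "x \<in> pairs n" for x
    using that unfolding pairs_def by force
  ultimately show ?thesis by blast
qed

lemma finite_pairs [simp]: "finite (pairs n)"
  by (simp add: pairs_eq)

lemma card_pairs: "card (pairs n) = n * (n - 1) div 2"
  unfolding pairs_eq using n_subsets[of "{1..n}" 2] by (simp add: choose_two)

lemma pairs_image:
  assumes "p permutes {1..n}" "x \<in> pairs n"
  shows "p ` x \<in> pairs n"
proof -
  have "inj_on p x" using permutes_inj[OF assms(1)] by (rule inj_on_subset) simp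
  then show ?thesis
    using assms permutes_image[OF assms(1)] by (auto simp: pairs_eq card_image)
qed

lemma pairs_swap: "\<lbrakk>1 \<le> k; k < n; x \<in> pairs n\<rbrakk> \<Longrightarrow> swap k ` x \<in> pairs n"
  by (intro pairs_image permutes_swap_id) auto

locale braid_quot =
  fixes n :: nat and Q (structure)
  assumes Q_eq: "Q = braid_quotient n"
begin

sublocale group Q
  unfolding Q_eq by (rule group_braid_quotient)

abbreviation q :: "letter list \<Rightarrow> letter list set set" where
  "q \<equiv> quotient_class n"

abbreviation gen :: "nat set \<Rightarrow> letter list set set" where
  "gen \<equiv> pure_gen n"

lemma q_closed [simp]: "w \<in> braid_words n \<Longrightarrow> q w \<in> carrier Q"
  by (simp add: Q_eq)

lemma q_append: "\<lbrakk>v \<in> braid_words n; w \<in> braid_words n\<rbrakk> \<Longrightarrow> q (v @ w) = q v \<otimes> q w"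
  by (simp add: Q_eq quotient_class_append)

lemma q_Cons: "l # w \<in> braid_words n \<Longrightarrow> q (l # w) = q [l] \<otimes> q w"
  using q_append[of "[l]" w] by simp

lemma gen_closed [simp]: "x \<in> pairs n \<Longrightarrow> gen x \<in> carrier Q"
  by (simp add: Q_eq pure_gen_closed)

lemma gen_conj_letter:
  assumes "1 \<le> strand l" "strand l < n" "x \<in> pairs n"
  shows "q [l] \<otimes> gen x \<otimes> inv q [l] = gen (swap (strand l) ` x)"
proof (cases l)
  case (Pos k)
  with assms show ?thesis by (simp add: Q_eq pure_gen_conj_letter)
next
  case (Neg k)
  let ?y = "swap k ` x"
  have k: "1 \<le> k" "k < n" using assms Neg by auto
  then have y: "?y \<in> pairs n" using assms pairs_swap by blast
  have s: "q [Neg k] = inv q [Pos k]"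
    using quotient_class_inv[of "[Pos k]" n] k by (simp add: Q_eq)
  have "q [Pos k] \<otimes> gen ?y \<otimes> inv q [Pos k] = gen x"
    using k y pure_gen_conj_letter[of k n ?y] by (simp add: Q_eq)
  then have "inv q [Pos k] \<otimes> gen x \<otimes> inv (inv q [Pos k]) = gen ?y"
    using k y by (simp add: m_assoc inv_cancel_left flip: \<open>_ = gen x\<close>)
  then show ?thesis
    using Neg s by simp
qed

lemma gen_conj:
  "\<lbrakk>w \<in> braid_words n; x \<in> pairs n\<rbrakk> \<Longrightarrow> q w \<otimes> gen x \<otimes> inv q w = gen (word_perm w ` x)"
proof (induction w arbitrary: x)
  case Nil
  then show ?case by (simp add: Q_eq[symmetric] quotient_class_Nil[of n, folded Q_eq] id_def)
next
  case (Cons l w)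
  have "q (l # w) \<otimes> gen x \<otimes> inv q (l # w) = q [l] \<otimes> (q w \<otimes> gen x \<otimes> inv q w) \<otimes> inv q [l]"
    using Cons.prems by (simp add: q_Cons[of l w] conj_mult)
  also have "\<dots> = gen (swap (strand l) ` word_perm w ` x)"
    using Cons pairs_image[OF word_perm_permutes] by (simp add: gen_conj_letter)
  finally show ?case by (simp add: image_image)
qed

definition P :: "letter list set set set" where
  "P = generate Q (gen ` pairs n)"

lemma carrier_Q: "carrier Q = q ` braid_words n"
  by (simp add: Q_eq carrier_braid_quotient)

lemma gen_in_P: "x \<in> pairs n \<Longrightarrow> gen x \<in> P"
  by (auto simp: P_def intro: generate.incl)

lemma P_normal: "P \<lhd> Q"
  unfolding P_def
proof (rule normal_generateI)
  show "gen ` pairs n \<subseteq> carrier Q" by auto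
  fix h g assume "h \<in> gen ` pairs n" "g \<in> carrier Q"
  then obtain x w where "x \<in> pairs n" "h = gen x" "w \<in> braid_words n" "g = q w"
    by (auto simp: carrier_Q)
  then show "g \<otimes> h \<otimes> inv g \<in> gen ` pairs n"
    using pairs_image[OF word_perm_permutes] by (simp add: gen_conj)
qed

lemma P_subgroup: "subgroup P Q"
  by (rule normal_imp_subgroup[OF P_normal])

lemma P_closed: "g \<in> P \<Longrightarrow> g \<in> carrier Q"
  using subgroup.subset[OF P_subgroup] by blast

text \<open>The classes of pure words form a subgroup containing the generators of \<open>P\<close>.
  Purity is what makes \<open>P\<close> commutative and lets it act by translations.\<close>

lemma P_pure:
  assumes "g \<in> P"
  obtains w where "w \<in> braid_words n" "g = q w" "word_perm w = id"
proof -
  define N where "N = {q w |w. w \<in> braid_words n \<and> word_perm w = id}"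
  have N: "q w \<in> N" if "w \<in> braid_words n" "word_perm w = id" for w
    using that unfolding N_def by blast
  have "subgroup N Q"
  proof (rule subgroupI)
    show "N \<subseteq> carrier Q" by (auto simp: N_def)
    have "q [] \<in> N" by (rule N) (simp_all only: braid_words_Nil word_perm.simps)
    then show "N \<noteq> {}" by blast
  next
    fix g assume "g \<in> N"
    then obtain w where "w \<in> braid_words n" "word_perm w = id" "g = q w"
      unfolding N_def by blast
    then show "inv g \<in> N"
      using N[of "inv_word w"] by (simp add: Q_eq quotient_class_inv word_perm_inv_word)
  next
    fix g h assume "g \<in> N" "h \<in> N"
    then obtain v w where "v \<in> braid_words n" "word_perm v = id" "g = q v"
        "w \<in> braid_words n" "word_perm w = id" "h = q w"
      unfolding N_def by blast
    then show "g \<otimes> h \<in> N"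
      using N[of "v @ w"] by (simp add: q_append word_perm_append)
  qed
  moreover have "gen ` pairs n \<subseteq> N"
    by (auto simp: pairs_def pure_gen_def intro!: N A_word_in word_perm_A_word)
  ultimately have "P \<subseteq> N" unfolding P_def by (rule generate_subgroup_incl[rotated])
  with assms that show ?thesis unfolding N_def by blast
qed

lemma P_commute: "\<lbrakk>g \<in> P; h \<in> P\<rbrakk> \<Longrightarrow> g \<otimes> h = h \<otimes> g"
  by (metis P_pure Q_eq quotient_class_pure_commute)

section \<open>Integer coordinates on the abelian group \<open>P\<close>, packaged as
  \<open>K\<close> so that finite products are available\<close>

definition K where "K = Q\<lparr>carrier := P\<rparr>"

lemma K_simps [simp]: "carrier K = P" "g \<otimes>\<^bsub>K\<^esub> h = g \<otimes> h" "\<one>\<^bsub>K\<^esub> = \<one>"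
  by (simp_all add: K_def)

lemma comm_group_K: "comm_group K"
  unfolding K_def
  by (rule group.group_comm_groupI[OF subgroup_imp_group[OF P_subgroup]]) (simp add: P_commute)

interpretation K: comm_group K by (rule comm_group_K)

text \<open>The image of the origin; for an element of \<open>P\<close> this is its whole
  translation vector, so \<open>shift\<close> is additive there.\<close>

definition shift :: "letter list set set \<Rightarrow> nat set \<Rightarrow> real" where
  "shift g = quotient_act n g (\<lambda>_. 0)"

lemma act_mult: "\<lbrakk>g \<in> carrier Q; h \<in> carrier Q\<rbrakk> \<Longrightarrow> quotient_act n (g \<otimes> h) v = quotient_act n g (quotient_act n h v)"
  by (simp add: Q_eq quotient_act_mult)

lemma act_P: "g \<in> P \<Longrightarrow> quotient_act n g v x = v x + shift g x"
  by (metis P_pure act_pure add.commute quotient_act_class shift_def)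

lemma shift_mult: "\<lbrakk>g \<in> P; h \<in> P\<rbrakk> \<Longrightarrow> shift (g \<otimes> h) x = shift g x + shift h x"
  using act_mult[of g h "\<lambda>_. 0"] act_P[of g "shift h" x]
  by (simp add: P_closed shift_def)

lemma shift_one: "shift \<one> x = 0"
  by (simp add: shift_def Q_eq quotient_act_one)

lemma shift_gen:
  assumes "x \<in> pairs n"
  shows "shift (gen x) y = (if y = x then 1 else 0)"
proof -
  obtain i j where "x = {i, j}" "1 \<le> i" "i < j" "j \<le> n"
    using assms unfolding pairs_def by blast
  then show ?thesis
    by (simp add: pure_gen_def shift_def quotient_act_class A_word_in act_A_word)
qed

lemma shift_inv: "g \<in> P \<Longrightarrow> shift (inv\<^bsub>K\<^esub> g) x = - shift g x"
  using shift_mult[of "inv\<^bsub>K\<^esub> g" g x] K.l_inv[of g] K.inv_closed[of g] by (simp add: shift_one)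

lemma shift_nat_pow: "g \<in> P \<Longrightarrow> shift (g [^]\<^bsub>K\<^esub> (k::nat)) x = real k * shift g x"
  using K.nat_pow_closed[of g]
  by (induction k) (auto simp: shift_one shift_mult algebra_simps)

lemma shift_int_pow:
  assumes "g \<in> P"
  shows "shift (g [^]\<^bsub>K\<^esub> (k::int)) x = real_of_int k * shift g x"
proof (cases k rule: int_cases2)
  case (nonneg m)
  with assms show ?thesis by (simp add: int_pow_int shift_nat_pow)
next
  case (nonpos m)
  have "g [^]\<^bsub>K\<^esub> m \<in> P"
    using assms K.nat_pow_closed[of g m] by simp
  with assms nonpos show ?thesis by (simp add: K.int_pow_neg_int shift_nat_pow shift_inv)
qed

definition prod_gen :: "(nat set \<Rightarrow> int) \<Rightarrow> letter list set set" where
  "prod_gen m = finprod K (\<lambda>x. gen x [^]\<^bsub>K\<^esub> m x) (pairs n)"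

lemma gen_pow_in_P: "x \<in> pairs n \<Longrightarrow> gen x [^]\<^bsub>K\<^esub> (k::int) \<in> P"
  using K.int_pow_closed[of "gen x" k] gen_in_P by simp

lemma prod_gen_in_P [simp]: "prod_gen m \<in> P"
  unfolding prod_gen_def
  using K.finprod_closed[of "\<lambda>x. gen x [^]\<^bsub>K\<^esub> m x" "pairs n"] gen_pow_in_P by auto

lemma prod_gen_add: "prod_gen (\<lambda>x. m x + m' x) = prod_gen m \<otimes> prod_gen m'"
proof -
  have "prod_gen (\<lambda>x. m x + m' x) = finprod K (\<lambda>x. gen x [^]\<^bsub>K\<^esub> m x \<otimes>\<^bsub>K\<^esub> gen x [^]\<^bsub>K\<^esub> m' x) (pairs n)"
    unfolding prod_gen_def
    by (rule K.finprod_cong') (auto simp: gen_pow_in_P gen_in_P K.int_pow_mult subgroup.m_closed[OF P_subgroup])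
  also have "\<dots> = prod_gen m \<otimes>\<^bsub>K\<^esub> prod_gen m'"
    unfolding prod_gen_def by (rule K.finprod_multf) (auto simp: gen_pow_in_P)
  finally show ?thesis by simp
qed

lemma prod_gen_cong: "(\<And>x. x \<in> pairs n \<Longrightarrow> m x = m' x) \<Longrightarrow> prod_gen m = prod_gen m'"
  unfolding prod_gen_def by (rule K.finprod_cong') (auto simp: gen_pow_in_P)

lemma prod_gen_0: "prod_gen (\<lambda>_. 0) = \<one>"
  unfolding prod_gen_def using K.finprod_one[of "pairs n"] by simp

text \<open>The translation vector reads off the exponents. This is the independence of the pure
  generators modulo commutators.\<close>

lemma shift_prod_gen: "shift (prod_gen m) x = (if x \<in> pairs n then real_of_int (m x) else 0)"
proof -
  have "shift (finprod K (\<lambda>x. gen x [^]\<^bsub>K\<^esub> m x) Y) x = (if x \<in> Y then real_of_int (m x) else 0)"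
    if "finite Y" "Y \<subseteq> pairs n" for Y
    using that
  proof (induction Y)
    case empty
    show ?case by (simp add: shift_one)
  next
    case (insert y Y)
    have *: "finprod K (\<lambda>x. gen x [^]\<^bsub>K\<^esub> m x) Y \<in> P"
      using K.finprod_closed[of "\<lambda>x. gen x [^]\<^bsub>K\<^esub> m x" Y] gen_pow_in_P insert by auto
    have "finprod K (\<lambda>x. gen x [^]\<^bsub>K\<^esub> m x) (insert y Y)
        = gen y [^]\<^bsub>K\<^esub> m y \<otimes>\<^bsub>K\<^esub> finprod K (\<lambda>x. gen x [^]\<^bsub>K\<^esub> m x) Y"
      using insert by (intro K.finprod_insert) (auto simp: gen_pow_in_P)
    with insert * show ?case
      by (auto simp: shift_mult gen_pow_in_P shift_int_pow gen_in_P shift_gen)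
  qed
  then show ?thesis by (simp add: prod_gen_def)
qed

lemma prod_gen_single:
  assumes "x \<in> pairs n"
  shows "prod_gen (\<lambda>y. if y = x then 1 else 0) = gen x"
proof -
  have "prod_gen (\<lambda>y. if y = x then 1 else 0) = finprod K (\<lambda>y. if x = y then gen x else \<one>\<^bsub>K\<^esub>) (pairs n)"
    unfolding prod_gen_def
    by (rule K.finprod_cong') (simp_all add: gen_in_P subgroup.one_closed[OF P_subgroup])
  also have "\<dots> = gen x"
    using K.finprod_singleton[OF assms finite_pairs, of "\<lambda>_. gen x"] by (simp add: gen_in_P assms)
  finally show ?thesis .
qed

lemma prod_gen_nat_pow: "prod_gen m [^] (k::nat) = prod_gen (\<lambda>x. int k * m x)"
proof (induction k)
  case (Suc k)
  then have "prod_gen m [^] Suc k = prod_gen (\<lambda>x. int k * m x + m x)"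
    by (simp add: prod_gen_add)
  then show ?case by (simp add: algebra_simps)
qed (simp add: prod_gen_0)

lemma prod_gen_neg: "inv prod_gen m = prod_gen (\<lambda>x. - m x)"
  by (rule inv_equality) (simp_all add: prod_gen_add[symmetric] prod_gen_0 P_closed)

lemma P_eq: "P = range prod_gen"
proof -
  have "subgroup (range prod_gen) Q"
  proof (rule subgroupI)
    show "range prod_gen \<subseteq> carrier Q" using P_closed by auto
  qed (auto simp: prod_gen_neg simp flip: prod_gen_add)
  moreover have "gen ` pairs n \<subseteq> range prod_gen"
    by (metis image_subsetI prod_gen_single rangeI)
  ultimately have "P \<subseteq> range prod_gen"
    unfolding P_def by (rule generate_subgroup_incl[rotated])
  then show ?thesis by auto
qed

text \<open>Every element of \<open>P\<close> is some \<open>prod_gen m\<close>, and its exponents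
  are visible in \<open>shift\<close>. Identities in \<open>P\<close> can thus be checked on
  translation vectors.\<close>

lemma shift_inj_P:
  assumes "g \<in> P" "h \<in> P" "\<And>x. x \<in> pairs n \<Longrightarrow> shift g x = shift h x"
  shows "g = h"
proof -
  obtain m m' where "g = prod_gen m" "h = prod_gen m'"
    using assms P_eq by auto
  with assms(3) show ?thesis
    by (auto simp: shift_prod_gen intro!: prod_gen_cong)
qed

text \<open>Conjugating a translation by an affine map applies the linear part to the vector. The
  translation part of \<open>q w\<close> cancels because \<open>q w\<close> carries
  \<open>?V\<close> back to the origin.\<close>

lemma shift_conj:
  assumes "w \<in> braid_words n" "g \<in> P"
  shows "shift (q w \<otimes> g \<otimes> inv q w) x = shift g (inv' (word_perm w) ` x)"
proof -
  let ?V = "quotient_act n (inv q w) (\<lambda>_. 0)" and ?p = "inv' (word_perm w)"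
  have U: "quotient_act n (q w) v x = quotient_act n (q w) (\<lambda>_. 0) x + v (?p ` x)" for v
    using assms act_eq[of w v x] by (simp add: quotient_act_class)
  have "quotient_act n (q w) ?V = (\<lambda>_. 0)"
    using assms act_mult[of "q w" "inv q w" "\<lambda>_. 0"] by (simp add: quotient_act_one[of n, folded Q_eq])
  then have "quotient_act n (q w) (\<lambda>_. 0) x + ?V (?p ` x) = 0"
    using U[of ?V] by simp
  moreover have "shift (q w \<otimes> g \<otimes> inv q w) x = quotient_act n (q w) (quotient_act n g ?V) x"
    using assms by (simp add: shift_def act_mult P_closed)
  moreover have "quotient_act n g ?V (?p ` x) = ?V (?p ` x) + shift g (?p ` x)"
    using assms by (simp add: act_P)
  ultimately show ?thesis
    using U[of "quotient_act n g ?V"] by simp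
qed

text \<open>A generator is its square times its inverse, and the square lies in \<open>P\<close>.
  Hence signs of letters are invisible modulo \<open>P\<close>.\<close>

lemma coset_letter:
  assumes "1 \<le> strand l" "strand l < n"
  shows "P #> q [l] = P #> q [Pos (strand l)]"
proof (cases l)
  case (Neg k)
  then have k: "1 \<le> k" "k < n" using assms by auto
  have "{k, Suc k} \<in> pairs n"
    using k unfolding pairs_def by force
  then have P: "q [Pos k, Pos k] \<in> P"
    using gen_in_P[of "{k, Suc k}"] by (simp add: pure_gen_def A_word_base)
  have "braid_equiv n ([Pos k] @ [Pos k, Neg k]) ([Pos k] @ [])"
    using k by (intro braid_equiv.cong braid_equiv.refl braid_equiv.right_inv)
  then have "q [Pos k] = q [Pos k, Pos k] \<otimes> q [Neg k]"
    using k quotient_class_equiv q_append[of "[Pos k, Pos k]" "[Neg k]"] by fastforce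
  then have "P #> q [Pos k] = P #> q [Pos k, Pos k] #> q [Neg k]"
    using k subgroup.subset[OF P_subgroup] by (simp add: coset_mult_assoc)
  also have "\<dots> = P #> q [Neg k]"
    using k P P_subgroup by (simp add: coset_join2)
  finally show ?thesis using Neg by simp
qed simp

lemma coset_mult: "\<lbrakk>g \<in> carrier Q; h \<in> carrier Q\<rbrakk> \<Longrightarrow> P #> (g \<otimes> h) = (P #> g) <#> (P #> h)"
  by (simp add: normal.rcos_sum[OF P_normal])

lemma coset_word: "w \<in> braid_words n \<Longrightarrow> P #> q w = P #> q (map Pos (map strand w))"
proof (induction w)
  case (Cons l w)
  moreover have "map Pos (map strand w) \<in> braid_words n"
    using Cons by (auto simp: braid_words_def)
  ultimately show ?case
    using coset_letter[of l]
    by (simp add: q_Cons[of l w] q_Cons[of "Pos (strand l)" "map Pos (map strand w)"] coset_mult del: map_map)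
qed simp

text \<open>Modulo \<open>P\<close> the generators become involutions, so equality of cosets
  satisfies the relations of the symmetric group required by \<open>coxeter_words\<close>.\<close>

lemma coxeter_pow_coset:
  assumes "n > 0"
  shows "P #> q (concat (replicate n (map Pos (rev [1..<n])))) = P"
proof -
  let ?R = "\<lambda>v w. P #> q (map Pos v) = P #> q (map Pos w)"
  have in_words: "map Pos w \<in> braid_words n" if "set w \<subseteq> {1..<n}" for w
    using that by (auto simp: braid_words_def)
  interpret coxeter_words ?R n
  proof unfold_locales
    fix v v' w w' assume "?R v v'" "?R w w'" "set (v @ w) \<subseteq> {1..<n}" "set (v' @ w') \<subseteq> {1..<n}"
    then show "?R (v @ w) (v' @ w')"
      using in_words by (simp add: q_append coset_mult)
  next
    fix i assume i: "1 \<le> i" "i < n"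
    have "P #> q [Pos i, Pos i] = P #> q ([Pos i] @ [Neg i])"
      using i coset_letter[of "Neg i"] q_append[of "[Pos i]" "[Neg i]"] q_append[of "[Pos i]" "[Pos i]"]
      by (simp add: coset_mult)
    then show "?R [i, i] []"
      using quotient_class_equiv[OF braid_equiv.right_inv[OF i]] by simp
  next
    fix i j assume "1 \<le> i" "i + 2 \<le> j" "j < n"
    then show "?R [i, j] [j, i]"
      using quotient_class_equiv[OF braid_equiv.far[of i j n]] by simp
  next
    fix i assume "1 \<le> i" "i + 1 < n"
    then show "?R [i, Suc i, i] [Suc i, i, Suc i]"
      using quotient_class_equiv[OF braid_equiv.near[of i n]] by simp
  qed auto
  obtain m where m: "n = Suc m" using assms by (cases n) auto
  have "?R (cox_pow m (Suc m)) []"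
    using cox_pow_trivial[of m] m by simp
  moreover have "map Pos (cox_pow m (Suc m)) = concat (replicate n (map Pos (rev [1..<n])))"
    by (simp only: map_concat map_replicate cox_def m)
  ultimately have "P #> q (concat (replicate n (map Pos (rev [1..<n])))) = P #> q []"
    by simp
  then show ?thesis
    using subgroup.subset[OF P_subgroup] by (simp add: Q_eq[symmetric] quotient_class_Nil[of n, folded Q_eq] coset_mult_one)
qed

end

section \<open>Lattices extended by a cyclic rotation\<close>

text \<open>The argument moves one position back in its orbit, so the unit vector at position j goes
  to position j + 1. Adding n before subtracting 1 avoids truncation at position 0.\<close>

definition rot :: "nat \<Rightarrow> (nat \<times> nat \<Rightarrow> int) \<Rightarrow> nat \<times> nat \<Rightarrow> int" where
  "rot n m x = m (fst x, (snd x + n - 1) mod n)"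

lemma sum_rotate:
  fixes f :: "nat \<Rightarrow> real"
  assumes "n > 0"
  shows "(\<Sum>j<n. f ((j + n - 1) mod n)) = (\<Sum>j<n. f j)"
proof (rule sum.reindex_bij_witness[of _ "\<lambda>j. (j + 1) mod n" "\<lambda>j. (j + n - 1) mod n"])
  fix j assume "j \<in> {..<n}"
  then have j: "j < n" by simp
  show "((j + n - 1) mod n + 1) mod n = j"
    using j assms by (cases j) simp_all
  show "((j + 1) mod n + n - 1) mod n = j"
    using j by (cases "Suc j = n") auto
qed (use assms in simp_all)

text \<open>The common frame for Gamma and for the explicit group of isometries. The inverse of
  \<open>\<alpha>\<close> is controlled by \<open>power\<close>, so natural exponents suffice in
  normal forms.\<close>

locale rotation_extension = group G for G (structure) +
  fixes \<alpha> and E :: "(nat \<times> nat \<Rightarrow> int) \<Rightarrow> 'a" and n :: nat and s :: "nat \<times> nat \<Rightarrow> int"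
  assumes \<alpha>_closed [simp]: "\<alpha> \<in> carrier G"
    and E_closed [simp]: "E m \<in> carrier G"
    and E_add: "E (\<lambda>x. m x + m' x) = E m \<otimes> E m'"
    and twist: "\<alpha> \<otimes> E m = E (rot n m) \<otimes> \<alpha>"
    and power: "\<alpha> [^] (n * n) = E s"
    and n_pos: "n > 0"
begin

lemma E_0: "E (\<lambda>_. 0) = \<one>"
proof -
  have "E (\<lambda>_. 0) \<otimes> E (\<lambda>_. 0) = E (\<lambda>_. 0)"
    using E_add[of "\<lambda>_. 0" "\<lambda>_. 0"] by simp
  then show ?thesis using l_cancel_one'[of "E (\<lambda>_. 0)" "E (\<lambda>_. 0)"] by simp
qed

lemma E_nat_pow: "E m [^] (k::nat) = E (\<lambda>x. int k * m x)"
  by (induction k) (simp_all add: E_0 algebra_simps flip: E_add)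

lemma E_neg: "inv E m = E (\<lambda>x. - m x)"
  by (rule inv_equality) (simp_all add: E_add[symmetric] E_0)

lemma pow_twist: "\<alpha> [^] (i::nat) \<otimes> E m = E ((rot n ^^ i) m) \<otimes> \<alpha> [^] i"
proof (induction i arbitrary: m)
  case (Suc i)
  have "\<alpha> [^] Suc i \<otimes> E m = \<alpha> [^] i \<otimes> (\<alpha> \<otimes> E m)"
    by (simp add: m_assoc)
  also have "\<dots> = (\<alpha> [^] i \<otimes> E (rot n m)) \<otimes> \<alpha>"
    by (simp add: twist m_assoc)
  also have "\<dots> = E ((rot n ^^ i) (rot n m)) \<otimes> \<alpha> [^] Suc i"
    by (simp add: Suc m_assoc)
  finally show ?case by (simp only: funpow_Suc_right o_apply)
qed simp

lemma pow_mult_square: "\<alpha> [^] (n * n * i) = E (\<lambda>x. int i * s x)"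
  using nat_pow_pow[of \<alpha> "n * n" i] by (simp add: power E_nat_pow)

lemma product_mult:
  "(E m \<otimes> \<alpha> [^] (i::nat)) \<otimes> (E m' \<otimes> \<alpha> [^] (i'::nat)) = E (\<lambda>x. m x + (rot n ^^ i) m' x) \<otimes> \<alpha> [^] (i + i')"
proof -
  have "(E m \<otimes> \<alpha> [^] i) \<otimes> (E m' \<otimes> \<alpha> [^] i') = E m \<otimes> (\<alpha> [^] i \<otimes> E m') \<otimes> \<alpha> [^] i'"
    by (simp add: m_assoc)
  then show ?thesis by (simp add: pow_twist E_add m_assoc nat_pow_mult)
qed

definition products :: "'a set" where
  "products = {E m \<otimes> \<alpha> [^] i |m (i::nat). True}"

lemma products_subgroup: "subgroup products G"
proof (rule subgroupI)
  show "products \<subseteq> carrier G" by (auto simp: products_def)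
  show "products \<noteq> {}" unfolding products_def by blast
next
  fix g assume "g \<in> products"
  then obtain m and i :: nat where g: "g = E m \<otimes> \<alpha> [^] i" unfolding products_def by blast
  \<comment> \<open>With this l the exponent i + l is a multiple of n * n, so the inverse of the
    i-th power of \<open>\<alpha>\<close> is its l-th power up to a lattice element.\<close>
  define l where "l = n * n * i - i"
  have "i + l = n * n * i" using n_pos by (simp add: l_def)
  then have "\<alpha> [^] i \<otimes> \<alpha> [^] l = E (\<lambda>x. int i * s x)"
    by (simp only: nat_pow_mult \<alpha>_closed pow_mult_square)
  then have "\<alpha> [^] i \<otimes> (\<alpha> [^] l \<otimes> inv E (\<lambda>x. int i * s x)) = \<one>"
    by (simp flip: m_assoc)
  then have "inv (\<alpha> [^] l \<otimes> inv E (\<lambda>x. int i * s x)) = \<alpha> [^] i"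
    by (rule inv_equality) simp_all
  then have "inv (\<alpha> [^] i) = \<alpha> [^] l \<otimes> inv E (\<lambda>x. int i * s x)"
    by (metis inv_inv E_closed \<alpha>_closed m_closed nat_pow_closed inv_closed)
  then have "inv g = \<alpha> [^] l \<otimes> (E (\<lambda>x. - (int i * s x)) \<otimes> E (\<lambda>x. - m x))"
    by (simp add: g inv_mult_group E_neg m_assoc)
  also have "\<dots> = E ((rot n ^^ l) (\<lambda>x. - (int i * s x) + - m x)) \<otimes> \<alpha> [^] l"
    by (simp only: E_add[symmetric] pow_twist)
  finally show "inv g \<in> products" unfolding products_def by blast
next
  fix g g' assume "g \<in> products" "g' \<in> products"
  then obtain m m' and i i' :: nat where "g = E m \<otimes> \<alpha> [^] i" "g' = E m' \<otimes> \<alpha> [^] i'"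
    unfolding products_def by blast
  then have "g \<otimes> g' = E (\<lambda>x. m x + (rot n ^^ i) m' x) \<otimes> \<alpha> [^] (i + i')"
    by (simp only: product_mult)
  then show "g \<otimes> g' \<in> products" unfolding products_def by blast
qed

end

text \<open>\<open>E\<close> ignores the values of m outside the finite box of indices. The
  normalization \<open>s_0\<close> forces a power of \<open>\<alpha>\<close> inside the lattice to
  have an exponent divisible by n * n.\<close>

locale twisted_lattice = rotation_extension +
  fixes N :: nat
  assumes E_eq_iff: "E m = E m' \<longleftrightarrow> (\<forall>x\<in>{..<N} \<times> {..<n}. m x = m' x)"
    and decomp: "g \<in> carrier G \<Longrightarrow> \<exists>m (i::nat). g = E m \<otimes> \<alpha> [^] i"
    and s_0: "s (0, 0) = 1"
    and N_pos: "N > 0"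

lemma (in rotation_extension) products_twisted_lattice:
  assumes "\<And>m m'. E m = E m' \<longleftrightarrow> (\<forall>x\<in>{..<N} \<times> {..<n}. m x = m' x)" "s (0, 0) = 1" "N > 0"
  shows "twisted_lattice (G\<lparr>carrier := products\<rparr>) \<alpha> E n s N"
proof -
  interpret H: group "G\<lparr>carrier := products\<rparr>"
    by (rule subgroup_imp_group[OF products_subgroup])
  have pow: "g [^]\<^bsub>G\<lparr>carrier := products\<rparr>\<^esub> (k::nat) = g [^] k" for g k
    by (rule nat_pow_consistent[symmetric])
  have "E m = E m \<otimes> \<alpha> [^] (0::nat)" "\<alpha> = E (\<lambda>_. 0) \<otimes> \<alpha> [^] (1::nat)" for m
    by (simp_all add: E_0)
  then have "E m \<in> products" "\<alpha> \<in> products" for m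
    unfolding products_def by blast+
  moreover have "\<exists>m (i::nat). g = E m \<otimes> \<alpha> [^] i" if "g \<in> products" for g
    using that unfolding products_def by blast
  ultimately show ?thesis
    using assms by unfold_locales (simp_all add: pow E_add twist power n_pos)
qed

section \<open>The generators of the Bieberbach group\<close>

lemma word_perm_strands: "word_perm w = word_perm (map Pos (map strand w))"
  by (induction w) auto

lemma word_perm_descending:
  assumes "a \<le> b"
  shows "word_perm (map Pos (rev [a..<b])) i = (if i = a then b else if a < i \<and> i \<le> b then i - 1 else i)"
  using assms
proof (induction b rule: dec_induct)
  case (step b)
  then show ?case
    by (auto simp: Transposition.transpose_def)
qed simp

lemma inv_image_eq_iff: "bij p \<Longrightarrow> inv' p ` x = y \<longleftrightarrow> x = p ` y"
  by (metis bij_betw_imp_inj_on bij_betw_imp_surj_on image_f_inv_f image_inv_f_f)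

text \<open>The new letter b carries each pair {i, b} to {i, b + 1} and adds its own half at {b, b +
  1}.\<close>

lemma act_descending_Pos:
  assumes "a \<le> b"
  shows "act (map Pos (rev [a..<b])) (\<lambda>_. 0) x = (if \<exists>i\<in>{a..<b}. x = {i, b} then 1 / 2 else 0)"
  using assms
proof (induction b arbitrary: x rule: dec_induct)
  case (step b)
  have "swap b ` x = {i, b} \<longleftrightarrow> x = {i, Suc b}" if "i < b" for i
    using that by (simp add: swap_image_eq_iff swap_le)
  then have "(\<exists>i\<in>{a..<b}. swap b ` x = {i, b}) \<longleftrightarrow> (\<exists>i\<in>{a..<b}. x = {i, Suc b})"
    by auto
  moreover have "\<not> (\<exists>i\<in>{a..<b}. x = {i, Suc b})" if "x = {b, Suc b}"
    using that by (auto simp: doubleton_eq_iff)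
  moreover have "{a..<Suc b} = insert b {a..<b}"
    using step by auto
  ultimately show ?case
    using step by auto
qed simp

lemma act_descending_Neg:
  assumes "a \<le> b"
  shows "act (map Neg (rev [a..<b])) (\<lambda>_. 0) x = (if \<exists>i\<in>{a..<b}. x = {i, b} then - 1 / 2 else 0)"
  using assms
proof (induction b arbitrary: x rule: dec_induct)
  case (step b)
  have "swap b ` x = {i, b} \<longleftrightarrow> x = {i, Suc b}" if "i < b" for i
    using that by (simp add: swap_image_eq_iff swap_le)
  then have "(\<exists>i\<in>{a..<b}. swap b ` x = {i, b}) \<longleftrightarrow> (\<exists>i\<in>{a..<b}. x = {i, Suc b})"
    by auto
  moreover have "\<not> (\<exists>i\<in>{a..<b}. x = {i, Suc b})" if "x = {b, Suc b}"
    using that by (auto simp: doubleton_eq_iff)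
  moreover have "{a..<Suc b} = insert b {a..<b}"
    using step by auto
  ultimately show ?case
    using step by auto
qed simp

text \<open>The number h is both the index after which the signs in \<open>delta_word n\<close>
  change and the number of orbits of pairs under the n-cycle.\<close>

locale odd_braid_quot = braid_quot +
  fixes h :: nat
  assumes n_eq: "n = 2 * h + 1" and h_pos: "h \<ge> 1"
begin

lemma n_bounds: "3 \<le> n" "Suc h < n" "0 < n"
  using n_eq h_pos by simp_all

lemma q_Nil [simp]: "\<one>\<^bsub>braid_quotient n\<^esub> = \<one>"
  by (simp add: Q_eq)

definition cyc :: "nat \<Rightarrow> nat" where
  "cyc i = (if i = 1 then n else if 1 < i \<and> i \<le> n then i - 1 else i)"

definition alpha_word :: "letter list" where
  "alpha_word = A_word 1 2 @ delta_word n"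

definition alpha :: "letter list set set" where
  "alpha = q alpha_word"

lemma delta_word_eq:
  "delta_word n = map Pos (rev [Suc h..<n]) @ map Neg (rev [1..<Suc h])"
proof -
  have "(n + 1) div 2 = Suc h" using n_eq by simp
  then show ?thesis by (simp only: delta_word_def)
qed

lemma strand_delta_word: "map strand (delta_word n) = rev [1..<n]"
proof -
  have "[1..<Suc h + h] = [1..<Suc h] @ [Suc h..<Suc h + h]"
    by (rule upt_add_eq_append) simp
  moreover have "Suc h + h = n" using n_eq by simp
  ultimately have "[1..<n] = [1..<Suc h] @ [Suc h..<n]" by (simp only:)
  then show ?thesis by (simp add: delta_word_eq comp_def del: upt_Suc)
qed

lemma delta_word_in: "delta_word n \<in> braid_words n"
  using n_bounds by (auto simp: delta_word_eq braid_words_def simp del: upt_Suc)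

lemma alpha_word_in: "alpha_word \<in> braid_words n"
  using A_word_in[of 1 2 n] n_bounds by (simp add: alpha_word_def delta_word_in)

lemma alpha_closed [simp]: "alpha \<in> carrier Q"
  by (simp add: alpha_def alpha_word_in)

lemma word_perm_alpha: "word_perm alpha_word = cyc"
proof -
  have "word_perm alpha_word = word_perm (map Pos (rev [1..<n]))"
    using word_perm_strands[of "delta_word n"]
    by (simp add: alpha_word_def word_perm_append word_perm_A_word strand_delta_word)
  then show ?thesis
    using word_perm_descending[of 1 n] n_bounds by (simp add: fun_eq_iff cyc_def)
qed

lemma bij_cyc: "bij cyc"
  using bij_word_perm[of alpha_word] by (simp add: word_perm_alpha)

text \<open>The negative letters put -1/2 on the pairs {i, h + 1} with i at most h; the positive
  letters, applied afterwards, carry strand h + 1 to n and add 1/2 on the pairs {i, n} with larger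
  i.\<close>

lemma act_delta:
  "act (delta_word n) (\<lambda>_. 0) x =
    (if \<exists>i\<in>{Suc h..<n}. x = {i, n} then 1 / 2 else 0) - (if \<exists>i\<in>{1..<Suc h}. x = {i, n} then 1 / 2 else 0)"
proof -
  let ?c = "word_perm (map Pos (rev [Suc h..<n]))"
  have c: "?c (Suc h) = n" "i < Suc h \<Longrightarrow> ?c i = i" for i
    using word_perm_descending[of "Suc h" n] n_bounds by simp_all
  have "inv' ?c ` x = {i, Suc h} \<longleftrightarrow> x = {i, n}" if "i < Suc h" for i
    using that c by (simp add: inv_image_eq_iff bij_word_perm)
  then have "(\<exists>i\<in>{1..<Suc h}. inv' ?c ` x = {i, Suc h}) \<longleftrightarrow> (\<exists>i\<in>{1..<Suc h}. x = {i, n})"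
    by auto
  then show ?thesis
    unfolding delta_word_eq act_append o_apply
    using n_bounds
    by (subst act_eq, subst act_descending_Neg, simp, subst act_descending_Pos, simp) simp
qed

section \<open>The orbits of pairs under the n-cycle\<close>

lemma cyc_pow:
  assumes "1 \<le> i" "i \<le> n"
  shows "j \<le> n \<Longrightarrow> (cyc ^^ j) i = (if j < i then i - j else n + i - j)"
proof (induction j)
  case (Suc j)
  then have "(cyc ^^ Suc j) i = cyc (if j < i then i - j else n + i - j)"
    by simp
  also have "\<dots> = (if Suc j < i then i - Suc j else n + i - Suc j)"
    using Suc.prems assms by (auto simp: cyc_def)
  finally show ?case .
qed (use assms in simp)

text \<open>\<open>k + 1\<close> is the cyclic distance of the two strands of the pair \<open>ix (k, j)\<close>; as \<open>n\<close> is odd, the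
  distances \<open>1, \<dots>, h\<close> label the orbits.\<close>

definition ix :: "nat \<times> nat \<Rightarrow> nat set" where
  "ix x = (cyc ^^ snd x) ` {1, fst x + 2}"

abbreviation IX :: "(nat \<times> nat) set" where
  "IX \<equiv> {..<h} \<times> {..<n}"

lemma ix_eq:
  assumes "k < h" "j < n"
  shows "ix (k, j) = {if j < 1 then 1 else n + 1 - j, if j < k + 2 then k + 2 - j else n + (k + 2) - j}"
  using assms cyc_pow[of 1 j] cyc_pow[of "k + 2" j] n_bounds by (simp add: ix_def)

lemma cyc_ix:
  assumes "(k, j) \<in> IX"
  shows "cyc ` ix (k, (j + n - 1) mod n) = ix (k, j)"
proof (cases j)
  case 0
  have "cyc ((cyc ^^ (n - 1)) i) = i" if "1 \<le> i" "i \<le> n" for i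
  proof -
    have "cyc ((cyc ^^ (n - 1)) i) = (cyc ^^ Suc (n - 1)) i" by simp
    also have "\<dots> = i" using that cyc_pow[of i n] n_bounds by simp
    finally show ?thesis .
  qed
  then show ?thesis
    using assms 0 n_bounds by (simp add: ix_def)
next
  case (Suc j')
  then have "(j + n - 1) mod n = j'" using assms by simp
  with Suc show ?thesis by (simp add: ix_def image_image)
qed

lemma inv_cyc_ix: "(k, j) \<in> IX \<Longrightarrow> inv' cyc ` ix (k, j) = ix (k, (j + n - 1) mod n)"
  using cyc_ix by (simp add: inv_image_eq_iff bij_cyc)

text \<open>Surjectivity is explicit: the cyclic distance of the pair gives the orbit and one of its
  strands gives the position. Injectivity then follows by counting.\<close>

lemma bij_ix: "bij_betw ix IX (pairs n)"
proof -
  have "ix x \<in> pairs n" if ins: "x \<in> IX" for x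
  proof -
    obtain k j where x: "x = (k, j)" "k < h" "j < n" using ins by auto
    let ?a = "if j < 1 then 1 else n + 1 - j" and ?b = "if j < k + 2 then k + 2 - j else n + (k + 2) - j"
    have "?a \<noteq> ?b" "1 \<le> ?a" "?a \<le> n" "1 \<le> ?b" "?b \<le> n"
      using x n_eq by auto
    then have "{?a, ?b} \<in> pairs n" unfolding pairs_eq by auto
    then show ?thesis using x by (simp only: ix_eq)
  qed
  moreover have "x \<in> ix ` IX" if x: "x \<in> pairs n" for x
  proof -
    obtain a b where ab: "x = {a, b}" "1 \<le> a" "a < b" "b \<le> n"
      using x unfolding pairs_def by blast
    show ?thesis
    proof (cases "b - a \<le> h")
      case True
      let ?k = "b - a - 1" and ?j = "if a = 1 then 0 else n + 1 - a"
      have kj: "?k < h" "?j < n" using ab True by auto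
      have "ix (?k, ?j) = x"
        unfolding ix_eq[OF kj] using ab by auto
      with kj show ?thesis by force
    next
      case False
      \<comment> \<open>For a distance above h the circle is traversed the other way, with b in the
        role of strand 1.\<close>
      let ?k = "n - (b - a) - 1" and ?j = "n + 1 - b"
      have kj: "?k < h" "?j < n" using ab False n_eq by auto
      have "?k + 2 = ?j + a" using ab by auto
      then have "ix (?k, ?j) = x"
        unfolding ix_eq[OF kj] using ab by auto
      with kj show ?thesis by force
    qed
  qed
  ultimately have image: "ix ` IX = pairs n" by blast
  moreover have "n * (n - 1) div 2 = h * n"
    using n_eq by simp
  then have "card IX = card (pairs n)"
    by (simp add: card_pairs)
  ultimately show ?thesis
    using eq_card_imp_inj_on[of IX ix] by (simp add: bij_betw_def)
qed

lemma ix_in: "x \<in> IX \<Longrightarrow> ix x \<in> pairs n"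
  using bij_ix by (auto simp: bij_betw_def)

text \<open>Modulo \<open>P\<close> the factor \<open>A_word 1 2\<close> disappears and the signs in
  \<open>delta_word n\<close> are forgotten. What remains is the Coxeter word, whose n-th power is
  trivial.\<close>

lemma alpha_pow_in_P: "alpha [^] n \<in> P"
proof -
  let ?c = "map Pos (rev [1..<n])"
  have c: "?c \<in> braid_words n" by (auto simp: braid_words_def)
  have "{1, 2} \<in> pairs n" using n_bounds unfolding pairs_eq by auto
  then have A: "q (A_word 1 2) \<in> P"
    using gen_in_P[of "{1, 2}"] by (simp add: pure_gen_def numeral_2_eq_2)
  have "A_word 1 2 \<in> braid_words n" using A_word_in[of 1 2 n] n_bounds by simp
  then have "alpha = q (A_word 1 2) \<otimes> q (delta_word n)"
    unfolding alpha_def alpha_word_def using delta_word_in by (rule q_append)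
  then have "P #> alpha = P #> q (A_word 1 2) #> q (delta_word n)"
    by (simp only: coset_mult_assoc[OF subgroup.subset[OF P_subgroup]] P_closed[OF A] q_closed delta_word_in)
  also have "\<dots> = P #> q (delta_word n)"
    by (simp only: coset_join2[OF P_closed[OF A] P_subgroup A])
  also have "\<dots> = P #> q ?c"
    using coset_word[OF delta_word_in] by (simp only: strand_delta_word)
  finally have *: "P #> alpha = P #> q ?c" .
  have pow: "P #> (alpha [^] k) = P #> q (concat (replicate k ?c))" for k
  proof (induction k)
    case 0
    show ?case by simp
  next
    case (Suc k)
    have in_words: "concat (replicate k ?c) \<in> braid_words n"
      using c by (auto simp: braid_words_def)
    have "P #> (alpha [^] Suc k) = P #> (alpha \<otimes> alpha [^] k)"
      by (simp only: nat_pow_Suc2 alpha_closed)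
    also have "\<dots> = (P #> q ?c) <#> (P #> q (concat (replicate k ?c)))"
      by (simp only: coset_mult alpha_closed nat_pow_closed * Suc.IH)
    also have "\<dots> = P #> q (?c @ concat (replicate k ?c))"
      by (simp only: q_append c in_words coset_mult q_closed)
    finally show ?case by simp
  qed
  have "P #> (alpha [^] n) = P"
    unfolding pow by (rule coxeter_pow_coset[OF n_bounds(3)])
  then show ?thesis
    by (rule coset_join1) (simp_all add: P_subgroup)
qed

text \<open>The factor n appears since Gamma is generated with n-th powers of the pure generators.
  The index is the pair (orbit, position), so that conjugation by \<open>alpha\<close> becomes
  \<open>rot\<close>.\<close>

definition E :: "(nat \<times> nat \<Rightarrow> int) \<Rightarrow> letter list set set" where
  "E m = prod_gen (\<lambda>x. int n * m (inv_into IX ix x))"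

lemma E_in_P [simp]: "E m \<in> P"
  by (simp add: E_def)

lemma inv_into_ix: "x \<in> IX \<Longrightarrow> inv_into IX ix (ix x) = x"
  using bij_ix by (simp add: bij_betw_def)

lemma shift_E: "x \<in> IX \<Longrightarrow> shift (E m) (ix x) = real n * real_of_int (m x)"
  by (simp add: E_def shift_prod_gen ix_in inv_into_ix)

lemma P_eqI:
  assumes "g \<in> P" "g' \<in> P" "\<And>x. x \<in> IX \<Longrightarrow> shift g (ix x) = shift g' (ix x)"
  shows "g = g'"
  using assms(1,2)
proof (rule shift_inj_P)
  fix y assume "y \<in> pairs n"
  then obtain x where "x \<in> IX" "y = ix x"
    using bij_ix unfolding bij_betw_def by blast
  with assms(3) show "shift g y = shift g' y" by blast
qed

lemma E_add: "E (\<lambda>x. m x + m' x) = E m \<otimes> E m'"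
  by (simp add: E_def prod_gen_add[symmetric] algebra_simps)

lemma E_eq_iff: "E m = E m' \<longleftrightarrow> (\<forall>x\<in>IX. m x = m' x)"
proof
  assume "E m = E m'"
  then have "real n * real_of_int (m x) = real n * real_of_int (m' x)" if "x \<in> IX" for x
    using that by (metis shift_E)
  then show "\<forall>x\<in>IX. m x = m' x" using n_bounds by simp
next
  assume "\<forall>x\<in>IX. m x = m' x"
  then show "E m = E m'" by (intro P_eqI) (auto simp: shift_E)
qed

lemma alpha_conj_in_P: "g \<in> P \<Longrightarrow> alpha \<otimes> g \<otimes> inv alpha \<in> P"
  by (rule normal.inv_op_closed2[OF P_normal]) simp_all

lemma shift_alpha_conj: "g \<in> P \<Longrightarrow> shift (alpha \<otimes> g \<otimes> inv alpha) x = shift g (inv' cyc ` x)"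
  unfolding alpha_def by (simp add: shift_conj alpha_word_in word_perm_alpha)

lemma twist: "alpha \<otimes> E m = E (rot n m) \<otimes> alpha"
proof -
  have "alpha \<otimes> E m \<otimes> inv alpha = E (rot n m)"
  proof (rule P_eqI)
    fix x assume x: "x \<in> IX"
    then obtain k j where kj: "x = (k, j)" by (cases x)
    have "(k, (j + n - 1) mod n) \<in> IX" using x kj n_bounds by simp
    then show "shift (alpha \<otimes> E m \<otimes> inv alpha) (ix x) = shift (E (rot n m)) (ix x)"
      using x kj inv_cyc_ix[of k j] by (simp add: shift_alpha_conj shift_E rot_def)
  qed (simp_all add: alpha_conj_in_P)
  then have "E (rot n m) \<otimes> alpha = alpha \<otimes> E m \<otimes> inv alpha \<otimes> alpha" by simp
  also have "\<dots> = alpha \<otimes> E m" by (simp add: m_assoc P_closed)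
  finally show ?thesis by simp
qed

text \<open>The sum over the orbit of {1, 2}. It is invariant under the linear part of
  \<open>alpha\<close>, hence only sees the translation part.\<close>

definition orbit_sum :: "(nat set \<Rightarrow> real) \<Rightarrow> real" where
  "orbit_sum v = (\<Sum>j<n. v (ix (0, j)))"

text \<open>On this orbit \<open>A_word 1 2\<close> contributes 1 at position 0. The two
  contributions of \<open>delta_word n\<close>, namely -1/2 at {1, n} (position 1) and 1/2 at {n -
  1, n} (position 2), cancel.\<close>

lemma orbit_sum_act_alpha: "orbit_sum (quotient_act n alpha v) = orbit_sum v + 1"
proof -
  have a0: "act alpha_word (\<lambda>_. 0) (ix (0, j)) =
      (if j = 0 then 1 else 0) + (if j = 1 then - 1 / 2 else 0) + (if j = 2 then 1 / 2 else 0)" if "j < n" for j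
  proof -
    have "act alpha_word (\<lambda>_. 0) (ix (0, j)) = act (delta_word n) (\<lambda>_. 0) (ix (0, j)) + (if ix (0, j) = {1, 2} then 1 else 0)"
      by (simp add: alpha_word_def act_append act_A_word)
    moreover have "ix (0, j) = {1, 2} \<longleftrightarrow> j = 0"
      using that n_bounds h_pos by (auto simp: ix_eq doubleton_eq_iff)
    moreover have "(\<exists>i\<in>{Suc h..<n}. ix (0, j) = {i, n}) \<longleftrightarrow> j = 2"
    proof
      show "\<exists>i\<in>{Suc h..<n}. ix (0, j) = {i, n}" if "j = 2"
        using that h_pos n_bounds \<open>j < n\<close> by (intro bexI[of _ "n - 1"]) (auto simp: ix_eq)
    qed (use that h_pos n_bounds in \<open>auto simp: ix_eq doubleton_eq_iff split: if_splits\<close>)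
    moreover have "(\<exists>i\<in>{1..<Suc h}. ix (0, j) = {i, n}) \<longleftrightarrow> j = 1"
    proof
      show "\<exists>i\<in>{1..<Suc h}. ix (0, j) = {i, n}" if "j = 1"
        using that h_pos n_bounds \<open>j < n\<close> by (intro bexI[of _ 1]) (auto simp: ix_eq)
    qed (use that h_pos n_bounds in \<open>auto simp: ix_eq doubleton_eq_iff split: if_splits\<close>)
    ultimately show ?thesis by (simp add: act_delta)
  qed
  have "quotient_act n alpha v (ix (0, j)) = act alpha_word (\<lambda>_. 0) (ix (0, j)) + v (ix (0, (j + n - 1) mod n))"
    if "j < n" for j
    using that h_pos act_eq[of alpha_word v "ix (0, j)"] inv_cyc_ix[of 0 j]
    by (simp add: alpha_def quotient_act_class alpha_word_in word_perm_alpha)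
  then have "orbit_sum (quotient_act n alpha v) =
      (\<Sum>j<n. act alpha_word (\<lambda>_. 0) (ix (0, j))) + (\<Sum>j<n. v (ix (0, (j + n - 1) mod n)))"
    by (simp add: orbit_sum_def sum.distrib)
  moreover have "(\<Sum>j<n. act alpha_word (\<lambda>_. 0) (ix (0, j))) = 1"
    using n_bounds by (simp add: a0 sum.distrib)
  moreover have "(\<Sum>j<n. v (ix (0, (j + n - 1) mod n))) = orbit_sum v"
    unfolding orbit_sum_def by (rule sum_rotate[OF n_bounds(3)])
  ultimately show ?thesis by simp
qed

lemma orbit_sum_act_alpha_pow: "orbit_sum (quotient_act n (alpha [^] k) v) = orbit_sum v + real k"
proof (induction k)
  case (Suc k)
  have "quotient_act n (alpha [^] Suc k) v = quotient_act n alpha (quotient_act n (alpha [^] k) v)"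
    by (simp only: nat_pow_Suc2 alpha_closed act_mult nat_pow_closed)
  with Suc show ?case by (simp add: orbit_sum_act_alpha)
qed (simp add: quotient_act_one[of n, folded Q_eq])

text \<open>The n-th power commutes with \<open>alpha\<close>, so its translation vector is constant
  on the orbit. Its n entries have sum n, whence each is 1.\<close>

lemma shift_alpha_pow: "shift (alpha [^] n) (ix (0, 0)) = 1"
proof -
  have "alpha \<otimes> alpha [^] n \<otimes> inv alpha = alpha [^] n"
    by (rule conj_commute) (simp_all flip: nat_pow_Suc2)
  then have inv: "shift (alpha [^] n) (inv' cyc ` x) = shift (alpha [^] n) x" for x
    using shift_alpha_conj[OF alpha_pow_in_P] by simp
  have const: "shift (alpha [^] n) (ix (0, j)) = shift (alpha [^] n) (ix (0, 0))" if "j < n" for j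
    using that
  proof (induction j)
    case (Suc j)
    then have "inv' cyc ` ix (0, Suc j) = ix (0, j)"
      using inv_cyc_ix[of 0 "Suc j"] h_pos by simp
    with Suc inv[of "ix (0, Suc j)"] show ?case by simp
  qed simp
  have "orbit_sum (shift (alpha [^] n)) = (\<Sum>j<n. shift (alpha [^] n) (ix (0, 0)))"
    unfolding orbit_sum_def
  proof (rule sum.cong)
    fix j assume "j \<in> {..<n}"
    then have "j < n" by simp
    then show "shift (alpha [^] n) (ix (0, j)) = shift (alpha [^] n) (ix (0, 0))" by (rule const)
  qed simp
  then have "orbit_sum (shift (alpha [^] n)) = real n * shift (alpha [^] n) (ix (0, 0))"
    by simp
  moreover have "orbit_sum (shift (alpha [^] n)) = real n"
    using orbit_sum_act_alpha_pow[of n "\<lambda>_. 0"] by (simp add: shift_def orbit_sum_def)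
  ultimately show ?thesis using n_bounds by simp
qed

lemma alpha_pow_E:
  obtains s :: "nat \<times> nat \<Rightarrow> int" where "alpha [^] (n * n) = E s" "s (0, 0) = 1"
proof -
  obtain m where m: "alpha [^] n = prod_gen m"
    using alpha_pow_in_P unfolding P_eq by blast
  have ix_inv: "ix (inv_into IX ix x) = x" if "x \<in> pairs n" for x
    by (rule f_inv_into_f) (use that bij_ix in \<open>simp add: bij_betw_def\<close>)
  have "alpha [^] (n * n) = (alpha [^] n) [^] n"
    by (simp only: nat_pow_pow alpha_closed)
  also have "\<dots> = prod_gen (\<lambda>x. int n * m x)"
    by (simp only: m prod_gen_nat_pow)
  also have "\<dots> = E (\<lambda>x. m (ix x))"
    unfolding E_def by (rule prod_gen_cong) (simp add: ix_inv)
  finally have "alpha [^] (n * n) = E (\<lambda>x. m (ix x))" .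
  moreover have "m (ix (0, 0)) = 1"
    using shift_alpha_pow ix_in[of "(0, 0)"] h_pos n_bounds unfolding m shift_prod_gen by simp
  ultimately show ?thesis by (rule that[of "\<lambda>x. m (ix x)"])
qed

lemma rotation_extension:
  assumes "alpha [^] (n * n) = E s"
  shows "rotation_extension Q alpha E n s"
  using assms n_bounds by unfold_locales (auto simp: E_add twist P_closed)

section \<open>Gamma as a twisted lattice\<close>

definition \<Gamma> where "\<Gamma> = carrier (Gamma_group n)"

lemma \<Gamma>_eq: "\<Gamma> = generate Q (insert alpha ((\<lambda>x. gen x [^] n) ` pairs n))"
proof -
  have "{q (A_word a b) [^] n |a b. 1 \<le> a \<and> a < b \<and> b \<le> n} = (\<lambda>x. gen x [^] n) ` pairs n"
  proof (intro Set.equalityI subsetI)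
    fix g assume "g \<in> {q (A_word a b) [^] n |a b. 1 \<le> a \<and> a < b \<and> b \<le> n}"
    then obtain a b where "g = q (A_word a b) [^] n" "1 \<le> a" "a < b" "b \<le> n" by blast
    then show "g \<in> (\<lambda>x. gen x [^] n) ` pairs n"
      by (intro image_eqI[of _ _ "{a, b}"]) (auto simp: pure_gen_def pairs_eq)
  next
    fix g assume "g \<in> (\<lambda>x. gen x [^] n) ` pairs n"
    then obtain x where "g = gen x [^] n" "x \<in> pairs n" by blast
    moreover from this(2) obtain a b where "x = {a, b}" "1 \<le> a" "a < b" "b \<le> n"
      unfolding pairs_def by blast
    ultimately show "g \<in> {q (A_word a b) [^] n |a b. 1 \<le> a \<and> a < b \<and> b \<le> n}"
      by (intro CollectI exI[of _ a] exI[of _ b]) (simp add: pure_gen_def)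
  qed
  moreover have "q (A_word 1 2) \<otimes> q (delta_word n) = alpha"
    using A_word_in[of 1 2 n] n_bounds by (simp add: alpha_def alpha_word_def q_append delta_word_in)
  ultimately show ?thesis by (simp only: \<Gamma>_def Gamma_group_def Q_eq[symmetric]) simp
qed

lemma \<Gamma>_subgroup: "subgroup \<Gamma> Q"
  unfolding \<Gamma>_eq by (rule generate_is_subgroup) auto

lemma Gamma_group_eq: "Gamma_group n = Q\<lparr>carrier := \<Gamma>\<rparr>"
  by (simp add: \<Gamma>_def Gamma_group_def Q_eq)

lemma gen_pow_eq: "x \<in> pairs n \<Longrightarrow> gen x [^] k = prod_gen (\<lambda>y. if y = x then int k else 0)"
  using prod_gen_nat_pow[of "\<lambda>y. if y = x then 1 else 0" k] by (simp add: prod_gen_single if_distrib cong: if_cong)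

lemma E_in_\<Gamma>: "E m \<in> \<Gamma>"
proof -
  have single: "prod_gen (\<lambda>x. if x = y then int n * z else 0) \<in> \<Gamma>" if y: "y \<in> pairs n" for y z
  proof -
    have "gen y [^] n \<in> \<Gamma>" unfolding \<Gamma>_eq using y by (auto intro: generate.incl)
    then have pow: "(gen y [^] n) [^] (k::nat) \<in> \<Gamma>" for k
      by (induction k) (auto simp: subgroup.one_closed[OF \<Gamma>_subgroup] subgroup.m_closed[OF \<Gamma>_subgroup])
    have nat: "prod_gen (\<lambda>x. if x = y then int n * int k else 0) \<in> \<Gamma>" for k
    proof -
      have "(gen y [^] n) [^] k = gen y [^] (n * k)"
        using y by (simp only: nat_pow_pow gen_closed)
      also have "\<dots> = prod_gen (\<lambda>x. if x = y then int n * int k else 0)"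
        using y by (simp only: gen_pow_eq of_nat_mult)
      finally show ?thesis using pow[of k] by (simp only:)
    qed
    show ?thesis
    proof (cases z rule: int_cases2)
      case (nonneg k)
      then show ?thesis using nat[of k] by (simp only:)
    next
      case (nonpos k)
      have "(\<lambda>x. if x = y then int n * z else 0) = (\<lambda>x. - (if x = y then int n * int k else 0))"
        using nonpos by auto
      then show ?thesis
        using subgroup.m_inv_closed[OF \<Gamma>_subgroup nat[of k]] by (simp only: prod_gen_neg)
    qed
  qed
  have "prod_gen (\<lambda>x. if x \<in> Y then int n * m x else 0) \<in> \<Gamma>" if "finite Y" "Y \<subseteq> pairs n" for Y m
    using that
  proof (induction Y)
    case empty
    show ?case by (simp add: prod_gen_0 subgroup.one_closed[OF \<Gamma>_subgroup])
  next
    case (insert y Y)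
    have "(\<lambda>x. if x \<in> insert y Y then int n * m x else 0)
        = (\<lambda>x. (if x = y then int n * m y else 0) + (if x \<in> Y then int n * m x else 0))"
      using insert by auto
    then show ?case
      using insert single[of y "m y"] by (simp only: prod_gen_add) (simp add: subgroup.m_closed[OF \<Gamma>_subgroup])
  qed
  from this[OF finite_pairs subset_refl, of "\<lambda>x. m (inv_into IX ix x)"]
  have "prod_gen (\<lambda>x. if x \<in> pairs n then int n * m (inv_into IX ix x) else 0) \<in> \<Gamma>" .
  also have "prod_gen (\<lambda>x. if x \<in> pairs n then int n * m (inv_into IX ix x) else 0) = E m"
    unfolding E_def by (rule prod_gen_cong) simp
  finally show ?thesis .
qed

text \<open>The generators of Gamma are visibly in the subgroup \<open>products\<close>; conversely
  Gamma contains all \<open>E m\<close> and all powers of \<open>alpha\<close>.\<close>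

lemma Gamma_group_twisted_lattice:
  obtains s where "twisted_lattice (Gamma_group n) alpha E n s h"
proof -
  obtain s where s: "alpha [^] (n * n) = E s" "s (0, 0) = 1" by (rule alpha_pow_E)
  interpret rotation_extension Q alpha E n s
    using s(1) by (rule rotation_extension)
  have alpha_in: "alpha \<in> \<Gamma>" unfolding \<Gamma>_eq by (auto intro: generate.incl)
  then have pow_in: "alpha [^] (i::nat) \<in> \<Gamma>" for i
    by (induction i) (auto simp: subgroup.one_closed[OF \<Gamma>_subgroup] subgroup.m_closed[OF \<Gamma>_subgroup])
  have "\<Gamma> = products"
  proof (rule Set.equalityI)
    show "\<Gamma> \<subseteq> products"
      unfolding \<Gamma>_eq
    proof (rule generate_subgroup_incl[OF _ products_subgroup])
      have "alpha = E (\<lambda>_. 0) \<otimes> alpha [^] (1::nat)" by (simp add: E_0)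
      moreover have "gen x [^] n = E (\<lambda>y. if y = inv_into IX ix x then 1 else 0) \<otimes> alpha [^] (0::nat)"
        if "x \<in> pairs n" for x
      proof -
        have "inj_on (inv_into IX ix) (pairs n)"
          using bij_betw_inv_into[OF bij_ix] by (simp add: bij_betw_def)
        then have "E (\<lambda>y. if y = inv_into IX ix x then 1 else 0) = gen x [^] n"
          unfolding E_def gen_pow_eq[OF that] using that
          by (intro prod_gen_cong) (auto simp: inj_on_eq_iff)
        then show ?thesis using that by simp
      qed
      ultimately show "insert alpha ((\<lambda>x. gen x [^] n) ` pairs n) \<subseteq> products"
        unfolding products_def by blast
    qed
    show "products \<subseteq> \<Gamma>"
      using subgroup.m_closed[OF \<Gamma>_subgroup E_in_\<Gamma> pow_in] unfolding products_def by blast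
  qed
  moreover have "twisted_lattice (Q\<lparr>carrier := products\<rparr>) alpha E n s h"
    using E_eq_iff s(2) h_pos by (intro products_twisted_lattice) simp_all
  ultimately show ?thesis by (intro that) (simp add: Gamma_group_eq)
qed

end

section \<open>Euclidean isometries and holonomy of constant metrics\<close>

definition lin :: "('a::euclidean_space \<Rightarrow> 'a) \<Rightarrow> 'a \<Rightarrow> 'a" where
  "lin f v = f v - f 0"

definition isometries :: "('a::metric_space \<Rightarrow> 'a) set" where
  "isometries = {f. surj f \<and> (\<forall>x y. dist (f x) (f y) = dist x y)}"

lemma isometry_group_simps [simp]:
  "carrier isometry_group = isometries" "f \<otimes>\<^bsub>isometry_group\<^esub> g = f \<circ> g" "\<one>\<^bsub>isometry_group\<^esub> = id"
  by (simp_all add: isometry_group_def isometries_def)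

lemma isometries_dist: "f \<in> isometries \<Longrightarrow> dist (f x) (f y) = dist x y"
  by (simp add: isometries_def)

lemma isometries_comp:
  assumes "f \<in> isometries" "g \<in> isometries"
  shows "f \<circ> g \<in> isometries"
proof -
  have "surj (f \<circ> g)"
    by (rule comp_surj) (use assms in \<open>simp_all add: isometries_def\<close>)
  then show ?thesis
    using assms by (simp add: isometries_def)
qed

lemma group_isometry_group: "group isometry_group"
proof (rule groupI)
  fix f :: "'a \<Rightarrow> 'a" assume "f \<in> carrier isometry_group"
  then have f: "surj f" "\<And>x y. dist (f x) (f y) = dist x y" by (simp_all add: isometries_def)
  have "inj f"
  proof (rule injI)
    fix x y assume "f x = f y"
    then show "x = y" using f(2)[of x y] by simp
  qed
  moreover have "inv' f \<in> isometries"
    unfolding isometries_def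
  proof (intro CollectI conjI allI)
    show "surj (inv' f)" using \<open>inj f\<close> by (rule inj_imp_surj_inv)
    fix x y show "dist (inv' f x) (inv' f y) = dist x y"
      using f(2)[of "inv' f x" "inv' f y"] by (simp add: surj_f_inv_f f(1))
  qed
  ultimately show "\<exists>g\<in>carrier isometry_group. g \<otimes>\<^bsub>isometry_group\<^esub> f = \<one>\<^bsub>isometry_group\<^esub>"
    by (intro bexI[of _ "inv' f"]) simp_all
next
  show "\<one>\<^bsub>isometry_group\<^esub> \<in> carrier isometry_group"
    by (simp add: isometries_def)
qed (simp_all add: o_assoc isometries_comp)

lemma lin_orthogonal: "f \<in> isometries \<Longrightarrow> orthogonal_transformation (lin f)"
  unfolding orthogonal_transformation_isometry
  by (simp add: lin_def isometries_dist dist_norm[of "f _ - f 0"] flip: dist_norm)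

lemma lin_linear: "f \<in> isometries \<Longrightarrow> linear (lin f)"
  using lin_orthogonal by (rule orthogonal_transformation_linear)

lemma isometry_eq: "f x = lin f x + f 0"
  by (simp add: lin_def)

lemma lin_comp:
  assumes "f \<in> isometries"
  shows "lin (f \<circ> g) = lin f \<circ> lin g"
proof
  fix v
  have "lin f (lin g v) = lin f (g v) - lin f (g 0)"
    unfolding lin_def[of g] using lin_linear[OF assms] by (rule linear_diff)
  then show "lin (f \<circ> g) v = (lin f \<circ> lin g) v"
    by (simp add: lin_def)
qed

lemma has_derivative_isometry:
  assumes "f \<in> isometries"
  shows "(f has_derivative lin f) (at x)"
proof -
  have "((\<lambda>x. lin f x + f 0) has_derivative lin f) (at x)"
    using linear_conv_bounded_linear lin_linear[OF assms]
    by (auto intro!: derivative_eq_intros bounded_linear_imp_has_derivative)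
  then show ?thesis by (simp flip: isometry_eq)
qed

lemma deriv_along_isometry: "f \<in> isometries \<Longrightarrow> deriv_along f x v = lin f v"
  using frechet_derivative_at[OF has_derivative_isometry] by metis

text \<open>Koszul's formula has right-hand side 0 for constant coefficients, and non-degeneracy
  makes 0 the unique solution that \<open>THE\<close> requires.\<close>

lemma christoffel_const:
  assumes "\<And>w. b 0 w = 0" "\<And>z. (\<And>w. b z w = 0) \<Longrightarrow> z = 0"
  shows "christoffel (\<lambda>_. b) x u v = 0"
  unfolding christoffel_def by (rule the_equality) (use assms in auto)

text \<open>With vanishing Christoffel symbols the parallel fields are constant, so transport is
  trivial and the holonomy elements are the inverses of the linear parts of
  \<open>L\<close>.\<close>

lemma holonomy_const:
  assumes "\<And>w. b 0 w = 0" "\<And>z. (\<And>w. b z w = 0) \<Longrightarrow> z = 0" and L: "L \<subseteq> isometries"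
  shows "holonomy L (\<lambda>_. b) x = {h. \<exists>f\<in>L. \<forall>v. lin f (h v) = v}"
proof -
  have chr: "christoffel (\<lambda>_. b) x u v = 0" for x u v
    by (rule christoffel_const) (use assms in auto)
  have const: "V 1 = V 0" if "parallel_along (\<lambda>_. b) c V" for c V
  proof -
    from that obtain S where S: "finite S" "continuous_on {0..1} V"
        "\<And>t. t \<in> {0..1} - S \<Longrightarrow> (V has_vector_derivative 0) (at t)"
      unfolding parallel_along_def chr by auto
    show ?thesis
    proof (rule has_derivative_zero_unique_strong_interval[OF S(1,2)])
      fix t assume "t \<in> {0..1} - S"
      then show "(V has_derivative (\<lambda>h. 0)) (at t within {0..1})"
        using S(3)[of t] by (simp add: has_vector_derivative_def has_derivative_at_withinI)
    qed simp_all
  qed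
  have par: "parallel_along (\<lambda>_. b) c (\<lambda>_. v)" for c v
    unfolding parallel_along_def chr by (auto intro!: exI[of _ "{}"])
  show ?thesis
  proof (intro Set.equalityI subsetI)
    fix h assume "h \<in> holonomy L (\<lambda>_. b) x"
    then obtain f where f: "f \<in> L" and
      V: "\<And>v. \<exists>c V. parallel_along (\<lambda>_. b) c V \<and> V 0 = v \<and> V 1 = deriv_along f x (h v)"
      unfolding holonomy_def by blast
    have "lin f (h v) = v" for v
    proof -
      obtain c V where "parallel_along (\<lambda>_. b) c V" "V 0 = v" "V 1 = deriv_along f x (h v)"
        using V[of v] by blast
      moreover have "deriv_along f x (h v) = lin f (h v)"
        using f L by (intro deriv_along_isometry) blast
      ultimately show ?thesis using const by metis
    qed
    with f show "h \<in> {h. \<exists>f\<in>L. \<forall>v. lin f (h v) = v}" by blast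
  next
    fix h assume "h \<in> {h. \<exists>f\<in>L. \<forall>v. lin f (h v) = v}"
    then obtain f where f: "f \<in> L" "\<And>v. lin f (h v) = v" by blast
    \<comment> \<open>Transport does not depend on the path, so the straight segment from x to
      \<open>f x\<close> serves as the lift of a loop.\<close>
    let ?c = "\<lambda>t. x + t *\<^sub>R (f x - x)"
    have "?c piecewise_C1_differentiable_on {0..1}"
      by (intro C1_differentiable_imp_piecewise C1_differentiable_on_add C1_differentiable_on_scaleR
            C1_differentiable_on_const C1_differentiable_on_ident)
    moreover have "\<exists>V. parallel_along (\<lambda>_. b) ?c V \<and> V 0 = v \<and> V 1 = deriv_along f x (h v)" for v
      using f L by (intro exI[of _ "\<lambda>_. v"]) (auto simp: par deriv_along_isometry subset_iff)
    ultimately show "h \<in> holonomy L (\<lambda>_. b) x"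
      unfolding holonomy_def using f(1) by (intro CollectI bexI[of _ f] exI[of _ ?c]) auto
  qed
qed

section \<open>Groups of isometries with a rotating lattice\<close>

lemma linear_bounded_displacement:
  fixes A :: "'b::real_normed_vector \<Rightarrow> 'c::real_normed_vector"
  assumes "linear A" "\<And>x. norm (A x) \<le> B"
  shows "A x = 0"
proof (rule ccontr)
  assume "A x \<noteq> 0"
  then have pos: "norm (A x) > 0" by simp
  obtain k :: nat where "real k * norm (A x) > B"
    using reals_Archimedean3[OF pos] by blast
  moreover have "norm (A (real k *\<^sub>R x)) \<le> B" by (rule assms)
  ultimately show False
    by (simp add: linear_scale[OF assms(1)])
qed

text \<open>The image of a twisted lattice in a group of isometries. All geometry, including that
  the \<open>E m\<close> are translations, has to come from discreteness and cocompactness.\<close>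

locale flat_lattice =
  fixes L :: "('a::euclidean_space \<Rightarrow> 'a) set" and \<alpha> :: "'a \<Rightarrow> 'a"
    and E :: "(nat \<times> nat \<Rightarrow> int) \<Rightarrow> 'a \<Rightarrow> 'a" and N n :: nat and s :: "nat \<times> nat \<Rightarrow> int"
  assumes L_isometries: "L \<subseteq> isometries"
    and L_discrete: "discrete_isometries L" and L_cocompact: "cocompact L"
    and \<alpha>_in_L: "\<alpha> \<in> L" and E_in_L: "E m \<in> L"
    and E_add: "E (\<lambda>x. m x + m' x) = E m \<circ> E m'"
    and E_eq_iff: "E m = E m' \<longleftrightarrow> (\<forall>x\<in>{..<N} \<times> {..<n}. m x = m' x)"
    and twist: "\<alpha> \<circ> E m = E (rot n m) \<circ> \<alpha>"
    and decomp: "f \<in> L \<Longrightarrow> \<exists>m i. f = E m \<circ> (\<alpha> ^^ i)"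
    and power: "\<alpha> ^^ (n * n) = E s"
    and pow_in_L: "\<alpha> ^^ i \<in> L"
    and n_pos: "n > 0" and N_pos: "N > 0"
begin

abbreviation I :: "(nat \<times> nat) set" where
  "I \<equiv> {..<N} \<times> {..<n}"

lemma in_L: "f \<in> L \<Longrightarrow> f \<in> isometries"
  using L_isometries by blast

lemma E_0: "E (\<lambda>_. 0) = id"
proof -
  have "E (\<lambda>_. 0) (E (\<lambda>_. 0) x) = E (\<lambda>_. 0) x" for x
    using fun_cong[OF E_add[of "\<lambda>_. 0" "\<lambda>_. 0"], of x] by simp
  then have "dist (E (\<lambda>_. 0) x) x = 0" for x
    using isometries_dist[OF in_L[OF E_in_L], of "\<lambda>_. 0" "E (\<lambda>_. 0) x" x] by simp
  then show ?thesis by (simp add: fun_eq_iff)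
qed

lemma E_pow: "E m ^^ k = E (\<lambda>x. int k * m x)"
proof (induction k)
  case (Suc k)
  have "E (\<lambda>x. int (Suc k) * m x) = E (\<lambda>x. m x + int k * m x)"
    by (simp add: algebra_simps)
  with Suc show ?case by (simp add: E_add)
qed (simp add: E_0)

text \<open>The lattice alone is cocompact: by \<open>power\<close> the exponent of
  \<open>\<alpha>\<close> can be reduced modulo n * n, so finitely many images of the compact set K
  suffice.\<close>

lemma E_covers_from_compact:
  obtains B where "\<forall>y. \<exists>m k. norm k \<le> B \<and> y = E m k"
proof -
  obtain K where K: "compact K" "(\<Union>f\<in>L. f ` K) = UNIV"
    using L_cocompact unfolding cocompact_def by blast
  have "bounded ((\<alpha> ^^ i) ` K)" for i
  proof -
    have "continuous_on K (\<alpha> ^^ i)"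
      using has_derivative_continuous[OF has_derivative_isometry[OF in_L[OF pow_in_L[of i]]]]
      by (simp add: continuous_at_imp_continuous_on)
    with K(1) show ?thesis by (intro compact_imp_bounded compact_continuous_image)
  qed
  then have "bounded (\<Union>i<n * n. (\<alpha> ^^ i) ` K)" by (intro bounded_UN) auto
  then obtain B where B: "\<And>i k. \<lbrakk>i < n * n; k \<in> K\<rbrakk> \<Longrightarrow> norm ((\<alpha> ^^ i) k) \<le> B"
    unfolding bounded_iff by blast
  have "\<exists>m k. norm k \<le> B \<and> y = E m k" for y
  proof -
    obtain f k where fk: "f \<in> L" "k \<in> K" "y = f k" using K(2) by (metis UN_E UNIV_I imageE)
    then obtain m i where "f = E m \<circ> (\<alpha> ^^ i)" using decomp by blast
    moreover have "\<alpha> ^^ i = E (\<lambda>x. int (i div (n * n)) * s x) \<circ> (\<alpha> ^^ (i mod (n * n)))"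
    proof -
      have "\<alpha> ^^ i = \<alpha> ^^ ((n * n) * (i div (n * n)) + i mod (n * n))" by simp
      also have "\<dots> = (\<alpha> ^^ (n * n)) ^^ (i div (n * n)) \<circ> (\<alpha> ^^ (i mod (n * n)))"
        by (simp only: funpow_add funpow_mult)
      finally show ?thesis by (simp only: power E_pow)
    qed
    ultimately have "y = E (\<lambda>x. m x + int (i div (n * n)) * s x) ((\<alpha> ^^ (i mod (n * n))) k)"
      using fk by (simp add: E_add)
    moreover have "norm ((\<alpha> ^^ (i mod (n * n))) k) \<le> B"
      using fk n_pos by (intro B) simp_all
    ultimately show ?thesis by blast
  qed
  then show ?thesis using that by blast
qed

section \<open>The translation vectors form a lattice of full rank\<close>

definition \<theta> :: "(nat \<times> nat \<Rightarrow> int) \<Rightarrow> 'a" where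
  "\<theta> m = E m 0"

text \<open>Displacement by \<open>E m\<close> is invariant under the abelian cocompact group of all \<open>E m'\<close>, hence
  bounded, and an isometry of bounded displacement is a translation.\<close>

lemma E_translation: "E m x = x + \<theta> m"
proof -
  obtain B where B: "\<forall>y. \<exists>m k. norm k \<le> B \<and> y = E m k"
    by (rule E_covers_from_compact)
  have dist_E: "dist (E m x) (E m y) = dist x y" for m x y
    by (rule isometries_dist[OF in_L[OF E_in_L]])
  have "dist (E m y) y \<le> 2 * B + norm (E m 0)" for y
  proof -
    obtain m' k where k: "norm k \<le> B" "y = E m' k" using B by blast
    have "E m \<circ> E m' = E m' \<circ> E m" by (simp add: add.commute flip: E_add)
    then have "dist (E m y) y = dist (E m k) k"
      using k(2) dist_E[of m' "E m k" k] by (simp add: fun_eq_iff)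
    also have "\<dots> \<le> dist (E m k) (E m 0) + dist (E m 0) 0 + dist 0 k"
      using dist_triangle[of "E m k" k "E m 0"] dist_triangle[of "E m 0" k 0] by simp
    also have "\<dots> \<le> 2 * B + norm (E m 0)"
      using k(1) by (simp add: dist_E)
    finally show ?thesis .
  qed
  then have bound: "norm (E m y - y) \<le> 2 * B + norm (E m 0)" for y
    by (simp add: dist_norm)
  have "norm (lin (E m) y - y) \<le> 2 * B + norm (E m 0) + norm (E m 0)" for y
  proof -
    have "lin (E m) y - y = (E m y - y) - E m 0" by (simp add: lin_def)
    then have "norm (lin (E m) y - y) \<le> norm (E m y - y) + norm (E m 0)"
      by (simp only: norm_triangle_ineq4)
    with bound[of y] show ?thesis by linarith
  qed
  moreover have "linear (\<lambda>y. lin (E m) y - y)"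
    by (intro linear_compose_sub lin_linear in_L E_in_L linear_id[unfolded id_def])
  ultimately have "lin (E m) x - x = 0"
    by (rule linear_bounded_displacement[rotated])
  then show ?thesis by (simp add: lin_def \<theta>_def algebra_simps)
qed

lemma \<theta>_add: "\<theta> (\<lambda>x. m x + m' x) = \<theta> m + \<theta> m'"
  by (simp add: \<theta>_def[of "\<lambda>x. m x + m' x"] E_add E_translation)

lemma \<theta>_0: "\<theta> (\<lambda>_. 0) = 0"
  by (simp add: \<theta>_def E_0)

lemma \<theta>_cong: "(\<And>x. x \<in> I \<Longrightarrow> m x = m' x) \<Longrightarrow> \<theta> m = \<theta> m'"
  unfolding \<theta>_def using E_eq_iff by metis

definition t :: "nat \<times> nat \<Rightarrow> 'a" where
  "t x = \<theta> (\<lambda>y. if y = x then 1 else 0)"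

lemma \<theta>_single: "\<theta> (\<lambda>y. if y = x then z else 0) = real_of_int z *\<^sub>R t x"
proof -
  have nat: "\<theta> (\<lambda>y. if y = x then int k else 0) = real k *\<^sub>R t x" for k
  proof (induction k)
    case (Suc k)
    have "(\<lambda>y. if y = x then int (Suc k) else 0) = (\<lambda>y. (if y = x then 1 else 0) + (if y = x then int k else 0))"
      by auto
    then show ?case using Suc by (simp only: \<theta>_add) (simp add: t_def algebra_simps)
  qed (simp add: \<theta>_0 cong: if_cong)
  show ?thesis
  proof (cases z rule: int_cases2)
    case (nonneg k)
    with nat[of k] show ?thesis by (simp only:) simp
  next
    case (nonpos k)
    have "(\<lambda>y. (if y = x then z else 0) + (if y = x then int k else 0)) = (\<lambda>_. 0)"
      using nonpos by (auto simp: fun_eq_iff)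
    then have "\<theta> (\<lambda>y. if y = x then z else 0) + real k *\<^sub>R t x = 0"
      using \<theta>_add[of "\<lambda>y. if y = x then z else 0" "\<lambda>y. if y = x then int k else 0"]
      by (simp only: nat \<theta>_0)
    then have "\<theta> (\<lambda>y. if y = x then z else 0) = - (real k *\<^sub>R t x)"
      by (simp only: eq_neg_iff_add_eq_0)
    also have "\<dots> = real_of_int z *\<^sub>R t x"
      using nonpos by simp
    finally show ?thesis .
  qed
qed

lemma \<theta>_eq_sum: "\<theta> m = (\<Sum>x\<in>I. real_of_int (m x) *\<^sub>R t x)"
proof -
  have "\<theta> (\<lambda>y. if y \<in> Y then m y else 0) = (\<Sum>x\<in>Y. real_of_int (m x) *\<^sub>R t x)" if "finite Y" for Y
    using that
  proof (induction Y)
    case (insert x Y)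
    have "(\<lambda>y. if y \<in> insert x Y then m y else 0) = (\<lambda>y. (if y = x then m x else 0) + (if y \<in> Y then m y else 0))"
      using insert by auto
    then show ?case using insert by (simp only: \<theta>_add \<theta>_single) simp
  qed (simp add: \<theta>_0)
  from this[of I] show ?thesis
    by (subst \<theta>_cong[of m "\<lambda>y. if y \<in> I then m y else 0"]) auto
qed

text \<open>A translation moves all points equally far, so the condition on the unit ball is just a
  bound on its vector.\<close>

lemma \<theta>_discrete:
  obtains e where "e > 0" "\<forall>m. norm (\<theta> m) < e \<longrightarrow> (\<forall>x\<in>I. m x = 0)"
proof -
  obtain e where e: "e > 0" "\<forall>f\<in>L. (\<forall>x\<in>cball 0 1. dist (f x) x < e) \<longrightarrow> f = id"
    using L_discrete unfolding discrete_isometries_def by (elim exE conjE) (rule that)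
  have "\<forall>x\<in>I. m x = 0" if "norm (\<theta> m) < e" for m
  proof -
    have "\<forall>x\<in>cball 0 1. dist (E m x) x < e"
      using that by (simp add: E_translation dist_norm)
    with e(2)[rule_format, OF E_in_L[of m]] have "E m = id" by simp
    then have "E m = E (\<lambda>_. 0)" by (simp only: E_0)
    then show ?thesis unfolding E_eq_iff .
  qed
  then have "\<forall>m. norm (\<theta> m) < e \<longrightarrow> (\<forall>x\<in>I. m x = 0)" by blast
  with e(1) show ?thesis by (rule that)
qed

text \<open>A real relation is scaled to have coefficient 1 at \<open>x0\<close>. Simultaneous
  approximation of the coefficients by integers over a common q > 0 gives a lattice vector shorter
  than the discreteness bound, so its integer coefficients vanish; at \<open>x0\<close>, however,
  the coefficient is close to q.\<close>

lemma sum_t_eq_0: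
  assumes "(\<Sum>x\<in>I. c x *\<^sub>R t x) = 0" "x0 \<in> I"
  shows "c x0 = 0"
proof (rule ccontr)
  assume "c x0 \<noteq> 0"
  define d where "d x = c x / c x0" for x
  have d: "(\<Sum>x\<in>I. d x *\<^sub>R t x) = 0"
  proof -
    have "(\<Sum>x\<in>I. d x *\<^sub>R t x) = (1 / c x0) *\<^sub>R (\<Sum>x\<in>I. c x *\<^sub>R t x)"
      by (simp add: d_def scaleR_sum_right)
    with assms show ?thesis by simp
  qed
  obtain e where e: "e > 0" "\<forall>m. norm (\<theta> m) < e \<longrightarrow> (\<forall>x\<in>I. m x = 0)"
    by (rule \<theta>_discrete)
  define T where "T = (\<Sum>x\<in>I. norm (t x))"
  have "T \<ge> 0" unfolding T_def by (rule sum_nonneg) simp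
  \<comment> \<open>Each coefficient is off by less than 1 / M, so the error vector has norm at most
    T / M, which must be below e. The increment by 1 ensures that M is positive.\<close>
  obtain M0 :: nat where M0: "real M0 > T / e" using reals_Archimedean2 by blast
  define M where "M = M0 + 1"
  have M: "M > 0" "T / real M < e" "1 / real M \<le> 1"
  proof -
    have "T < e * real M0" using M0 e(1) by (simp add: field_simps)
    also have "\<dots> \<le> e * real M" using e(1) by (simp add: M_def)
    finally show "T / real M < e" by (simp add: M_def field_simps)
  qed (simp_all add: M_def)
  obtain q p where q: "0 < q" and p: "\<And>i. i < N * n \<Longrightarrow>
      \<bar>of_int q * d (i div n, i mod n) - of_int (p i)\<bar> < 1 / real M"
    using Dirichlet_approx_simult[OF M(1), of "N * n" "\<lambda>i. d (i div n, i mod n)"] by metis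
  define m where "m x = p (fst x * n + snd x)" for x
  have close: "\<bar>of_int q * d x - of_int (m x)\<bar> < 1 / real M" if x: "x \<in> I" for x
  proof -
    obtain k j where kj: "x = (k, j)" "k < N" "j < n" using x by blast
    have "k * n + j < Suc k * n" using kj by simp
    also have "Suc k * n \<le> N * n" using kj by (intro mult_le_mono1) simp
    finally show ?thesis using p[of "k * n + j"] kj by (simp add: m_def)
  qed
  have "\<theta> m = (\<Sum>x\<in>I. (of_int (m x) - of_int q * d x) *\<^sub>R t x) + of_int q *\<^sub>R (\<Sum>x\<in>I. d x *\<^sub>R t x)"
    by (simp add: \<theta>_eq_sum scaleR_sum_right flip: sum.distrib) (simp add: algebra_simps)
  then have "\<theta> m = (\<Sum>x\<in>I. (of_int (m x) - of_int q * d x) *\<^sub>R t x)" using d by simp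
  then have "norm (\<theta> m) \<le> (\<Sum>x\<in>I. norm ((of_int (m x) - of_int q * d x) *\<^sub>R t x))"
    by (simp only: norm_sum)
  also have "\<dots> \<le> (\<Sum>x\<in>I. 1 / real M * norm (t x))"
  proof (rule sum_mono)
    fix x assume "x \<in> I"
    then have "\<bar>of_int (m x) - of_int q * d x\<bar> \<le> 1 / real M" using close[of x] by (simp add: abs_minus_commute)
    then show "norm ((of_int (m x) - of_int q * d x) *\<^sub>R t x) \<le> 1 / real M * norm (t x)"
      unfolding norm_scaleR by (intro mult_right_mono) simp_all
  qed
  also have "\<dots> = T / real M"
    by (simp add: T_def sum_divide_distrib)
  finally have "norm (\<theta> m) < e" using M(2) by linarith
  then have "m x0 = 0" using e(2) assms(2) by blast
  moreover have "d x0 = 1" using \<open>c x0 \<noteq> 0\<close> by (simp add: d_def)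
  \<comment> \<open>This contradicts q being a positive integer, since 1 / M is at most 1.\<close>
  ultimately have "\<bar>real_of_int q\<bar> < 1 / real M" using close[OF assms(2)] by simp
  with M(3) q show False by linarith
qed

lemma inj_t: "inj_on t I"
proof (rule inj_onI, rule ccontr)
  fix x y assume xy: "x \<in> I" "y \<in> I" "t x = t y" "x \<noteq> y"
  have "(\<Sum>z\<in>I. ((if z = x then 1 else 0) - (if z = y then 1 else 0 :: real)) *\<^sub>R t z) = t x - t y"
    using xy by (simp add: scaleR_left_diff_distrib sum_subtractf if_distrib[of "\<lambda>a. a *\<^sub>R _"] cong: if_cong)
  with sum_t_eq_0[of "\<lambda>z. (if z = x then 1 else 0) - (if z = y then 1 else 0)" x] xy
  show False by simp
qed

lemma finite_I: "finite I"
  by simp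

text \<open>If a were orthogonal to the span, the functional given by a would ignore lattice
  translations and so be bounded on the whole space, hence zero.\<close>

lemma span_t: "span (t ` I) = UNIV"
proof (rule ccontr)
  assume "span (t ` I) \<noteq> UNIV"
  then obtain a where a: "a \<noteq> 0" "\<And>x. x \<in> span (t ` I) \<Longrightarrow> a \<bullet> x = 0"
    using span_not_UNIV_orthogonal by blast
  obtain B where B: "\<forall>y. \<exists>m k. norm k \<le> B \<and> y = E m k"
    by (rule E_covers_from_compact)
  have "\<bar>a \<bullet> y\<bar> \<le> norm a * B" for y
  proof -
    obtain m k where k: "norm k \<le> B" "y = k + \<theta> m" using B E_translation by metis
    have "\<theta> m \<in> span (t ` I)"
      unfolding \<theta>_eq_sum by (intro span_sum span_scale span_base) blast
    then have "a \<bullet> y = a \<bullet> k" using a(2) k(2) by (simp add: inner_add_right)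
    then have "\<bar>a \<bullet> y\<bar> \<le> norm a * norm k" using Cauchy_Schwarz_ineq2[of a k] by simp
    also have "\<dots> \<le> norm a * B" using k(1) by (intro mult_left_mono) simp_all
    finally show ?thesis .
  qed
  moreover have "linear (\<lambda>y. a \<bullet> y)"
    by (rule bounded_linear.linear[OF bounded_linear_inner_right])
  ultimately have "a \<bullet> a = 0"
    by (intro linear_bounded_displacement[of "\<lambda>y. a \<bullet> y"]) simp_all
  with a(1) show False by simp
qed

lemma dim_eq: "DIM('a) = N * n"
proof -
  have "independent (t ` I)"
  proof (rule independent_if_scalars_zero)
    fix f x assume sum: "(\<Sum>x\<in>t ` I. f x *\<^sub>R x) = 0" and "x \<in> t ` I"
    then obtain y where y: "y \<in> I" "x = t y" by blast
    have "(\<Sum>y\<in>I. f (t y) *\<^sub>R t y) = 0"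
      using sum by (simp add: sum.reindex[OF inj_t])
    then show "f x = 0" using sum_t_eq_0[of "\<lambda>y. f (t y)" y] y by simp
  qed simp
  then have "dim (UNIV :: 'a set) = card (t ` I)"
    using span_t by (intro dim_eq_card) simp_all
  then show ?thesis by (simp add: card_image[OF inj_t])
qed

text \<open>Coordinates in the basis \<open>t\<close>. Outside \<open>I\<close> the chosen function
  is arbitrary, which is why the facts below are restricted to indices in \<open>I\<close>.\<close>

definition co :: "'a \<Rightarrow> nat \<times> nat \<Rightarrow> real" where
  "co v = (SOME c. v = (\<Sum>x\<in>I. c x *\<^sub>R t x))"

lemma sum_co: "(\<Sum>x\<in>I. co v x *\<^sub>R t x) = v"
proof -
  have "v \<in> span (t ` I)" by (simp add: span_t)
  then obtain u where "v = (\<Sum>y\<in>t ` I. u y *\<^sub>R y)"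
    by (auto simp: span_finite[OF finite_imageI[OF finite_I]])
  then have "v = (\<Sum>x\<in>I. u (t x) *\<^sub>R t x)"
    by (simp add: sum.reindex[OF inj_t])
  then have "\<exists>c. v = (\<Sum>x\<in>I. c x *\<^sub>R t x)" by (rule exI[of _ "\<lambda>x. u (t x)"])
  then have "v = (\<Sum>x\<in>I. co v x *\<^sub>R t x)"
    unfolding co_def by (rule someI_ex)
  then show ?thesis by (rule HOL.sym)
qed

lemma co_sum:
  assumes "x \<in> I"
  shows "co (\<Sum>x\<in>I. c x *\<^sub>R t x) x = c x"
proof -
  let ?v = "\<Sum>x\<in>I. c x *\<^sub>R t x"
  have "(\<Sum>x\<in>I. (co ?v x - c x) *\<^sub>R t x) = (\<Sum>x\<in>I. co ?v x *\<^sub>R t x) - ?v"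
    by (simp only: scaleR_left_diff_distrib sum_subtractf)
  then have "(\<Sum>x\<in>I. (co ?v x - c x) *\<^sub>R t x) = 0" by (simp only: sum_co diff_self)
  from sum_t_eq_0[OF this assms] show ?thesis by simp
qed

lemma co_eqI: "(\<And>x. x \<in> I \<Longrightarrow> co v x = co w x) \<Longrightarrow> v = w"
  using sum_co[of v] sum_co[of w] by (metis (no_types, lifting) sum.cong)

lemma co_add: "x \<in> I \<Longrightarrow> co (v + w) x = co v x + co w x"
  using co_sum[of x "\<lambda>x. co v x + co w x"]
  by (simp only: scaleR_left_distrib sum.distrib sum_co)

lemma co_scale: "x \<in> I \<Longrightarrow> co (r *\<^sub>R v) x = r * co v x"
  using co_sum[of x "\<lambda>x. r * co v x"]
  by (simp only: scaleR_scaleR[symmetric] scaleR_sum_right[symmetric] sum_co)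

lemma co_t: "\<lbrakk>x \<in> I; y \<in> I\<rbrakk> \<Longrightarrow> co (t y) x = (if x = y then 1 else 0)"
proof -
  assume xy: "x \<in> I" "y \<in> I"
  have "(\<Sum>z\<in>I. (if z = y then 1 else 0 :: real) *\<^sub>R t z) = t y"
    using xy by (simp add: if_distrib[of "\<lambda>a. a *\<^sub>R _"] cong: if_cong)
  then show ?thesis using co_sum[OF xy(1), of "\<lambda>z. if z = y then 1 else 0"] by simp
qed

section \<open>The linear part of \<open>\<alpha>\<close> and the holonomy group\<close>

definition R :: "'a \<Rightarrow> 'a" where
  "R = lin \<alpha>"

lemma linear_R: "linear R"
  unfolding R_def by (intro lin_linear in_L \<alpha>_in_L)

text \<open>The relation \<open>twist\<close>, evaluated at the origin, transfers the rotation of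
  indices to the linear part.\<close>

lemma R_\<theta>: "R (\<theta> m) = \<theta> (rot n m)"
proof -
  have "\<alpha> (\<theta> m) = \<alpha> 0 + \<theta> (rot n m)"
    using fun_cong[OF twist[of m], of 0] by (simp add: E_translation)
  then show ?thesis by (simp add: R_def lin_def)
qed

lemma R_t:
  assumes "k < N" "j < n"
  shows "R (t (k, j)) = t (k, (j + 1) mod n)"
proof -
  have eq: "(b + n - 1) mod n = j \<longleftrightarrow> b = (j + 1) mod n" if b: "b < n" for b
  proof -
    have "(b + n - 1) mod n = (if b = 0 then n - 1 else b - 1)"
      using b by (cases b) simp_all
    moreover have "(j + 1) mod n = (if j = n - 1 then 0 else j + 1)"
      using assms(2) n_pos by auto
    ultimately show ?thesis using assms(2) b n_pos by auto
  qed
  have "R (t (k, j)) = \<theta> (rot n (\<lambda>y. if y = (k, j) then 1 else 0))"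
    unfolding t_def by (rule R_\<theta>)
  also have "\<dots> = t (k, (j + 1) mod n)"
    unfolding t_def
  proof (rule \<theta>_cong)
    fix x assume "x \<in> I"
    then obtain a b where x: "x = (a, b)" "b < n" by auto
    with eq[of b] show "rot n (\<lambda>y. if y = (k, j) then 1 else 0) x = (if x = (k, (j + 1) mod n) then 1 else 0)"
      by (simp add: rot_def)
  qed
  finally show ?thesis .
qed

lemma linear_R_pow: "linear (R ^^ i)"
proof (induction i)
  case (Suc i)
  then show ?case unfolding funpow.simps by (intro linear_compose linear_R)
qed (simp add: linear_iff)

lemma R_pow_t: "\<lbrakk>k < N; j < n\<rbrakk> \<Longrightarrow> (R ^^ i) (t (k, j)) = t (k, (j + i) mod n)"
proof (induction i)
  case (Suc i)
  then have "(R ^^ Suc i) (t (k, j)) = t (k, ((j + i) mod n + 1) mod n)"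
    using n_pos by (simp add: R_t)
  then show ?case by (simp add: mod_Suc_eq)
qed simp

lemma R_pow_id_iff: "R ^^ i = id \<longleftrightarrow> n dvd i"
proof
  assume "R ^^ i = id"
  then have "t (0, i mod n) = t (0, 0)"
    using R_pow_t[of 0 0 i] N_pos n_pos by simp
  then have "i mod n = 0"
    using inj_t N_pos n_pos by (auto simp: inj_on_def)
  then show "n dvd i" by (rule mod_0_imp_dvd)
next
  assume "n dvd i"
  have "(R ^^ i) v = v" for v
  proof -
    have "(R ^^ i) v = (R ^^ i) (\<Sum>x\<in>I. co v x *\<^sub>R t x)" by (simp only: sum_co)
    also have "\<dots> = (\<Sum>x\<in>I. co v x *\<^sub>R (R ^^ i) (t x))"
      by (simp only: linear_sum[OF linear_R_pow] linear_scale[OF linear_R_pow])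
    also have "\<dots> = (\<Sum>x\<in>I. co v x *\<^sub>R t x)"
    proof (rule sum.cong)
      fix x assume "x \<in> I"
      then obtain k j where "x = (k, j)" "k < N" "j < n" by blast
      with \<open>n dvd i\<close> show "co v x *\<^sub>R (R ^^ i) (t x) = co v x *\<^sub>R t x"
        by (auto simp: R_pow_t elim!: dvdE)
    qed simp
    finally show ?thesis by (simp only: sum_co)
  qed
  then show "R ^^ i = id" by (simp add: fun_eq_iff)
qed

lemma R_pow_eq_iff: "R ^^ i = R ^^ j \<longleftrightarrow> i mod n = j mod n"
proof -
  have "i mod n = j mod n" if "R ^^ i = R ^^ j" for i j
  proof -
    have "t (0, i mod n) = t (0, j mod n)"
      using R_pow_t[of 0 0 i] R_pow_t[of 0 0 j] N_pos n_pos that by simp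
    then show ?thesis using inj_t N_pos n_pos by (auto simp: inj_on_def)
  qed
  moreover have "R ^^ i = R ^^ (i mod n)" for i
  proof -
    have "R ^^ i = R ^^ (n * (i div n)) \<circ> R ^^ (i mod n)"
      by (simp flip: funpow_add)
    then show ?thesis using R_pow_id_iff[of "n * (i div n)"] by simp
  qed
  ultimately show ?thesis by metis
qed

lemma lin_E_pow: "lin (E m \<circ> (\<alpha> ^^ i)) = R ^^ i"
proof -
  have "lin (\<alpha> ^^ i) = R ^^ i"
  proof (induction i)
    case 0
    show ?case by (simp add: lin_def fun_eq_iff)
  next
    case (Suc i)
    then show ?case by (simp only: funpow.simps lin_comp[OF in_L[OF \<alpha>_in_L]] R_def)
  qed
  moreover have "lin (E m) = id"
    by (simp add: fun_eq_iff lin_def E_translation)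
  ultimately show ?thesis by (simp add: lin_comp[OF in_L[OF E_in_L]])
qed

lemma lin_L:
  assumes "f \<in> L"
  obtains i where "lin f = R ^^ i"
  using decomp[OF assms] lin_E_pow that by blast

lemma R_pow_inverse: obtains j where "R ^^ i \<circ> R ^^ j = id" "R ^^ j \<circ> R ^^ i = id"
proof -
  \<comment> \<open>The inverse is again a natural power, because the exponents add up to a multiple
    of n.\<close>
  have "i + (n * i - i) = n * i" using n_pos by simp
  then have "R ^^ i \<circ> R ^^ (n * i - i) = id" "R ^^ (n * i - i) \<circ> R ^^ i = id"
    using R_pow_id_iff[of "n * i"] by (simp_all add: add.commute flip: funpow_add)
  then show ?thesis by (rule that)
qed

text \<open>The linear parts of \<open>L\<close> are exactly the powers of \<open>R\<close>, and
  these are closed under inverses. The form \<open>b\<close> enters only through its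
  non-degeneracy.\<close>

lemma holonomy_eq:
  assumes "\<And>w. b 0 w = 0" "\<And>z. (\<And>w. b z w = 0) \<Longrightarrow> z = 0"
  shows "holonomy L (\<lambda>_. b) x = range (\<lambda>i. R ^^ i)"
proof -
  have hol: "holonomy L (\<lambda>_. b) x = {h. \<exists>f\<in>L. \<forall>v. lin f (h v) = v}"
    using assms L_isometries by (rule holonomy_const)
  show ?thesis unfolding hol
  proof (intro Set.equalityI subsetI)
    fix h assume "h \<in> {h. \<exists>f\<in>L. \<forall>v. lin f (h v) = v}"
    then obtain f where f: "f \<in> L" "\<And>v. lin f (h v) = v" by blast
    obtain i where i: "lin f = R ^^ i" using lin_L[OF f(1)] by blast
    obtain j where j: "R ^^ j \<circ> R ^^ i = id" using R_pow_inverse by blast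
    have "h v = (R ^^ j) v" for v
      using fun_cong[OF j, of "h v"] f(2)[of v] i by simp
    then show "h \<in> range (\<lambda>i. R ^^ i)" by blast
  next
    fix h assume "h \<in> range (\<lambda>i. R ^^ i)"
    then obtain i where i: "h = R ^^ i" by blast
    obtain j where j: "R ^^ j \<circ> R ^^ i = id" using R_pow_inverse by blast
    have "lin (E (\<lambda>_. 0) \<circ> (\<alpha> ^^ j)) (h v) = v" for v
      unfolding lin_E_pow i using fun_cong[OF j, of v] by simp
    moreover have "E (\<lambda>_. 0) \<circ> (\<alpha> ^^ j) \<in> L" by (simp add: E_0 pow_in_L)
    ultimately show "h \<in> {h. \<exists>f\<in>L. \<forall>v. lin f (h v) = v}" by blast
  qed
qed

lemma standard_metric_eq: "standard_metric = (\<lambda>_. (\<bullet>))"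
  by (simp add: fun_eq_iff standard_metric_def)

lemma holonomy_group_iso: "holonomy_group L standard_metric x \<cong> integer_mod_group n"
proof -
  have "holonomy L standard_metric x = range (\<lambda>i. R ^^ i)"
    unfolding standard_metric_eq
  proof (rule holonomy_eq)
    fix z :: 'a assume "\<And>w. z \<bullet> w = 0"
    then show "z = 0" by (metis inner_eq_zero_iff)
  qed simp
  then have H: "carrier (holonomy_group L standard_metric x) = range (\<lambda>i. R ^^ i)"
    "mult (holonomy_group L standard_metric x) = (\<circ>)"
    by (simp_all add: holonomy_group_def)
  let ?h = "\<lambda>z :: int. R ^^ nat z"
  have "?h \<in> Group.iso (integer_mod_group n) (holonomy_group L standard_metric x)"
    unfolding Group.iso_def
  proof (intro CollectI conjI homI)
    fix z w assume "z \<in> carrier (integer_mod_group n)" "w \<in> carrier (integer_mod_group n)"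
    then have zw: "0 \<le> z" "0 \<le> w" using n_pos by (simp_all add: carrier_integer_mod_group)
    have "R ^^ nat ((z + w) mod int n) = R ^^ (nat z + nat w)"
      using zw by (subst R_pow_eq_iff) (simp add: nat_mod_distrib nat_add_distrib)
    then show "?h (z \<otimes>\<^bsub>integer_mod_group n\<^esub> w) = ?h z \<otimes>\<^bsub>holonomy_group L standard_metric x\<^esub> ?h w"
      by (simp add: H funpow_add)
  next
    show "bij_betw ?h (carrier (integer_mod_group n)) (carrier (holonomy_group L standard_metric x))"
      unfolding bij_betw_def
    proof
      show "inj_on ?h (carrier (integer_mod_group n))"
        using n_pos by (auto simp: inj_on_def carrier_integer_mod_group R_pow_eq_iff nat_less_iff)
      have "R ^^ i \<in> ?h ` carrier (integer_mod_group n)" for i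
      proof (rule image_eqI)
        show "R ^^ i = R ^^ nat (int (i mod n))" by (simp add: R_pow_eq_iff)
        show "int (i mod n) \<in> carrier (integer_mod_group n)"
          using n_pos by (simp add: carrier_integer_mod_group)
      qed
      then show "?h ` carrier (integer_mod_group n) = carrier (holonomy_group L standard_metric x)"
        unfolding H by blast
    qed
  qed (simp add: H)
  then have "integer_mod_group n \<cong> holonomy_group L standard_metric x"
    by (auto simp: is_iso_def)
  then show ?thesis by (rule group.iso_sym[OF group_integer_mod_group])
qed

end

section \<open>Constant tensor fields\<close>

lemma smooth_on_const: "smooth_on U (\<lambda>_. c)"
proof -
  \<comment> \<open>The class of constant functions is closed under directional derivatives, as the
    coinduction demands.\<close>
  have "\<exists>c. f = (\<lambda>_. c) \<Longrightarrow> smooth_on U f" for f :: "'a \<Rightarrow> 'b"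
  proof (coinduction arbitrary: f rule: smooth_on.coinduct)
    case smooth_on
    then obtain c where "f = (\<lambda>_. c)" by blast
    then show ?case by (intro exI[of _ f]) auto
  qed
  then show ?thesis by blast
qed

lemma smooth_on_ident: "smooth_on U (\<lambda>x. x)"
proof (rule smooth_on.intros)
  have "deriv_along (\<lambda>x. x) x v = v" for x v :: 'a
    using frechet_derivative_at[OF has_derivative_ident] by metis
  then show "\<forall>v. smooth_on U (\<lambda>x. deriv_along (\<lambda>x. x) x v)"
    by (simp add: smooth_on_const)
qed simp

lemma smooth_form2_const:
  assumes "bilinear b" "L \<subseteq> isometries" "\<And>f v w. f \<in> L \<Longrightarrow> b (lin f v) (lin f w) = b v w"
  shows "smooth_form2 L (\<lambda>_. b)"
  unfolding smooth_form2_def using assms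
  by (auto simp: smooth_on_const deriv_along_isometry subset_iff)

lemma complex_structure_const:
  assumes "linear_complex_structure J" "L \<subseteq> isometries" "\<And>f v. f \<in> L \<Longrightarrow> J (lin f v) = lin f (J v)"
  shows "complex_structure L (\<lambda>_. J)"
  unfolding complex_structure_def
proof (intro conjI allI ballI)
  have id: "deriv_along (\<lambda>x. x) x v = v" for x v :: 'a
    using frechet_derivative_at[OF has_derivative_ident] by metis
  fix x
  \<comment> \<open>A constant \<open>J\<close> is its own model: the identity is a global
    holomorphic chart.\<close>
  show "\<exists>U (\<phi> :: 'a \<Rightarrow> 'a) \<psi> J0. open U \<and> x \<in> U \<and> open (\<phi> ` U) \<and> (\<forall>y\<in>U. \<psi> (\<phi> y) = y) \<and>
      smooth_on U \<phi> \<and> smooth_on (\<phi> ` U) \<psi> \<and> linear_complex_structure J0 \<and>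
      (\<forall>y\<in>U. \<forall>v. deriv_along \<phi> y (J v) = J0 (deriv_along \<phi> y v))"
    by (rule exI[of _ UNIV], rule exI[of _ "\<lambda>x. x"], rule exI[of _ "\<lambda>x. x"], rule exI[of _ J])
      (simp add: smooth_on_ident assms(1) id)
  fix f v assume "f \<in> L"
  with assms(2,3) show "J (deriv_along f x v) = deriv_along f x (J v)"
    by (simp add: deriv_along_isometry subset_iff)
qed (simp_all add: assms(1) smooth_on_const)

lemma flat_metric_const:
  assumes "\<And>w. b 0 w = 0" "\<And>z. (\<And>w. b z w = 0) \<Longrightarrow> z = 0"
  shows "flat_metric (\<lambda>_. b)"
proof -
  have "christoffel (\<lambda>_. b) x u v = 0" for x u v
    by (rule christoffel_const) (use assms in auto)
  then show ?thesis by (simp add: flat_metric_def riemann_curvature_def)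
qed

section \<open>Permutation matrices\<close>

definition perm_mat :: "nat \<Rightarrow> (nat \<Rightarrow> nat) \<Rightarrow> complex mat" where
  "perm_mat m \<tau> = mat m m (\<lambda>(a, b). if a = \<tau> b then 1 else 0)"

lemma perm_mat_carrier [simp]: "perm_mat m \<tau> \<in> carrier_mat m m"
  by (simp add: perm_mat_def)

lemma perm_mat_mult:
  assumes "\<And>b. b < m \<Longrightarrow> \<tau>' b < m"
  shows "perm_mat m \<tau> * perm_mat m \<tau>' = perm_mat m (\<tau> \<circ> \<tau>')"
proof (rule eq_matI)
  fix a b assume "a < dim_row (perm_mat m (\<tau> \<circ> \<tau>'))" "b < dim_col (perm_mat m (\<tau> \<circ> \<tau>'))"
  then have ab: "a < m" "b < m" by (simp_all add: perm_mat_def)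
  have "(perm_mat m \<tau> * perm_mat m \<tau>') $$ (a, b)
      = (\<Sum>k\<in>{0..<m}. (if a = \<tau> k then 1 else 0) * (if k = \<tau>' b then 1 else 0))"
    using ab by (simp add: perm_mat_def scalar_prod_def)
  also have "\<dots> = (\<Sum>k\<in>{0..<m}. if k = \<tau>' b then (if a = \<tau> k then 1 else 0) else 0)"
    by (rule sum.cong) auto
  also have "\<dots> = perm_mat m (\<tau> \<circ> \<tau>') $$ (a, b)"
    using ab assms[of b] by (simp add: perm_mat_def)
  finally show "(perm_mat m \<tau> * perm_mat m \<tau>') $$ (a, b) = perm_mat m (\<tau> \<circ> \<tau>') $$ (a, b)" .
qed (simp_all add: perm_mat_def)

lemma perm_mat_adjoint: "mat_adjoint (perm_mat m \<tau>) = transpose_mat (perm_mat m \<tau>)"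
  by (rule eq_matI) (auto simp: mat_adjoint_def mat_of_rows_def perm_mat_def)

lemma perm_mat_transpose:
  assumes "bij_betw \<tau> {..<m} {..<m}"
  shows "perm_mat m \<tau> * transpose_mat (perm_mat m \<tau>) = 1\<^sub>m m"
proof (rule eq_matI)
  fix a c assume "a < dim_row (1\<^sub>m m :: complex mat)" "c < dim_col (1\<^sub>m m :: complex mat)"
  then have ac: "a < m" "c < m" by simp_all
  obtain k where k: "k < m" "a = \<tau> k" using assms ac by (auto simp: bij_betw_def)
  have inj: "a = \<tau> l \<longleftrightarrow> l = k" if "l < m" for l
    using assms that k by (auto simp: bij_betw_def inj_on_def)
  have "(perm_mat m \<tau> * transpose_mat (perm_mat m \<tau>)) $$ (a, c)
      = (\<Sum>l\<in>{0..<m}. (if a = \<tau> l then 1 else 0) * (if c = \<tau> l then 1 else 0))"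
    using ac by (simp add: perm_mat_def scalar_prod_def)
  also have "\<dots> = (\<Sum>l\<in>{0..<m}. if l = k then (if c = \<tau> l then 1 else 0) else 0)"
    using inj by (intro sum.cong) auto
  also have "\<dots> = 1\<^sub>m m $$ (a, c)"
    using ac k by simp
  finally show "(perm_mat m \<tau> * transpose_mat (perm_mat m \<tau>)) $$ (a, c) = 1\<^sub>m m $$ (a, c)" .
qed (simp_all add: perm_mat_def)

text \<open>A permutation matrix times its transpose is the identity, and both factors have the same
  determinant. So the square of the determinant is 1 whatever the sign of the permutation.\<close>

lemma perm_mat_square_special_unitary:
  assumes "bij_betw \<tau> {..<m} {..<m}"
  shows "perm_mat m (\<tau> \<circ> \<tau>) \<in> special_unitary m"
proof -
  have in_m: "\<tau> b < m" if "b < m" for b using assms that by (auto simp: bij_betw_def)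
  have "Determinant.det (perm_mat m \<tau> * perm_mat m \<tau>) = Determinant.det (perm_mat m \<tau> * transpose_mat (perm_mat m \<tau>))"
    by (simp add: Determinant.det_mult[of _ m] Determinant.det_transpose[of _ m])
  also have "\<dots> = 1" by (simp add: perm_mat_transpose[OF assms])
  finally have "Determinant.det (perm_mat m (\<tau> \<circ> \<tau>)) = 1"
    by (simp add: perm_mat_mult in_m)
  then show ?thesis
    using perm_mat_transpose[OF bij_betw_trans[OF assms assms]]
    by (simp add: special_unitary_def perm_mat_adjoint)
qed

lemma perm_mat_mult_vec:
  assumes "bij_betw \<tau> {..<m} {..<m}" "b < m" "z \<in> carrier_vec m"
  shows "vec_index (perm_mat m \<tau> *\<^sub>v z) (\<tau> b) = vec_index z b"
proof -
  have tb: "\<tau> b < m" using assms by (auto simp: bij_betw_def)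
  have inj: "\<tau> b = \<tau> l \<longleftrightarrow> l = b" if "l < m" for l
    using assms that by (auto simp: bij_betw_def inj_on_def)
  have "vec_index (perm_mat m \<tau> *\<^sub>v z) (\<tau> b) = (\<Sum>l\<in>{0..<m}. (if \<tau> b = \<tau> l then 1 else 0) * vec_index z l)"
    using tb assms(3) by (simp add: perm_mat_def scalar_prod_def)
  also have "\<dots> = (\<Sum>l\<in>{0..<m}. if l = b then vec_index z l else 0)"
    using inj by (intro sum.cong) auto
  finally show ?thesis using assms(2) by simp
qed

lemma frame_map_perm_mat:
  assumes "bij_betw \<tau> {..<m} {..<m}" "z \<in> carrier_vec m" "linear h"
    and "\<And>b. b < m \<Longrightarrow> h (e b) = e (\<tau> b)" "\<And>b. b < m \<Longrightarrow> h (j (e b)) = j (e (\<tau> b))"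
  shows "h (frame_map m j e z) = frame_map m j e (perm_mat m \<tau> *\<^sub>v z)"
proof -
  let ?z = "vec_index (perm_mat m \<tau> *\<^sub>v z)"
  have "frame_map m j e (perm_mat m \<tau> *\<^sub>v z) = (\<Sum>b<m. Re (?z (\<tau> b)) *\<^sub>R e (\<tau> b) + Im (?z (\<tau> b)) *\<^sub>R j (e (\<tau> b)))"
    unfolding frame_map_def by (rule sum.reindex_bij_betw[OF assms(1), symmetric])
  also have "\<dots> = (\<Sum>b<m. h (Re (vec_index z b) *\<^sub>R e b + Im (vec_index z b) *\<^sub>R j (e b)))"
    by (rule sum.cong) (simp_all add: perm_mat_mult_vec[OF assms(1) _ assms(2)] assms(4,5)
        linear_add[OF assms(3)] linear_scale[OF assms(3)])
  also have "\<dots> = h (frame_map m j e z)"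
    unfolding frame_map_def by (rule linear_sum[OF assms(3), symmetric])
  finally show ?thesis by (rule HOL.sym)
qed

lemma sum_lessThan_add:
  fixes f :: "nat \<Rightarrow> real"
  shows "(\<Sum>k<u + m. f k) = (\<Sum>k<u. f k) + (\<Sum>k<m. f (u + k))"
  by (induction m) simp_all

section \<open>The Calabi--Yau structure\<close>

context flat_lattice
begin

lemma linear_eq_on_t:
  assumes "linear f" "linear f'" "\<And>x. x \<in> I \<Longrightarrow> f (t x) = f' (t x)"
  shows "f v = f' v"
proof -
  have "f (\<Sum>x\<in>I. co v x *\<^sub>R t x) = (\<Sum>x\<in>I. co v x *\<^sub>R f (t x))"
    by (simp only: linear_sum[OF assms(1)] linear_scale[OF assms(1)])
  also have "\<dots> = (\<Sum>x\<in>I. co v x *\<^sub>R f' (t x))"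
    by (rule sum.cong) (simp_all only: assms(3))
  also have "\<dots> = f' (\<Sum>x\<in>I. co v x *\<^sub>R t x)"
    by (simp only: linear_sum[OF assms(2)] linear_scale[OF assms(2)])
  finally show ?thesis by (simp only: sum_co)
qed

definition g :: "'a \<Rightarrow> 'a \<Rightarrow> real" where
  "g v w = (\<Sum>x\<in>I. co v x * co w x)"

lemma g_sym: "g v w = g w v"
  by (simp add: g_def mult.commute)

lemma linear_g: "linear (g v)"
proof (rule linearI)
  fix w w' and r :: real
  have "g v (w + w') = (\<Sum>x\<in>I. co v x * co w x + co v x * co w' x)"
    unfolding g_def by (rule sum.cong) (simp_all only: co_add distrib_left)
  then show "g v (w + w') = g v w + g v w'" by (simp only: g_def sum.distrib)
  have "g v (r *\<^sub>R w) = (\<Sum>x\<in>I. r * (co v x * co w x))"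
    unfolding g_def by (rule sum.cong) (simp_all only: co_scale mult.left_commute)
  then show "g v (r *\<^sub>R w) = r *\<^sub>R g v w" by (simp only: g_def sum_distrib_left real_scaleR_def)
qed

lemma linear_g_left: "linear (\<lambda>v. g v w)"
  using linear_g[of w] by (simp only: g_sym[of _ w])

lemma bilinear_g: "bilinear g"
  unfolding bilinear_def using linear_g linear_g_left by blast

lemma g_pos: "v \<noteq> 0 \<Longrightarrow> g v v > 0"
proof -
  assume "v \<noteq> 0"
  have "0 \<le> g v v" unfolding g_def by (rule sum_nonneg) simp
  moreover have "g v v \<noteq> 0"
  proof
    assume "g v v = 0"
    then have "\<forall>x\<in>I. co v x * co v x = 0"
      unfolding g_def by (subst (asm) sum_nonneg_eq_0_iff) simp_all
    then have zero: "co v x = 0" if "x \<in> I" for x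
      using that by (metis mult_eq_0_iff)
    have "(\<Sum>x\<in>I. co v x *\<^sub>R t x) = (\<Sum>x\<in>I. 0)"
      by (rule sum.cong) (simp_all only: zero scaleR_zero_left)
    with \<open>v \<noteq> 0\<close> show False by (simp add: sum_co)
  qed
  ultimately show "g v v > 0" by simp
qed

lemma g_0: "g 0 w = 0"
  using linear_0[OF linear_g_left] .

lemma g_nondegenerate: "(\<And>w. g z w = 0) \<Longrightarrow> z = 0"
  using g_pos[of z] by fastforce

lemma g_t: "\<lbrakk>x \<in> I; y \<in> I\<rbrakk> \<Longrightarrow> g (t x) (t y) = (if x = y then 1 else 0)"
proof -
  assume xy: "x \<in> I" "y \<in> I"
  have "g (t x) (t y) = (\<Sum>z\<in>I. if z = x then (if x = y then 1 else 0) else 0)"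
    unfolding g_def by (rule sum.cong) (use xy co_t in auto)
  also have "\<dots> = (if x = y then 1 else 0)" using xy(1) by (simp only: sum.delta[OF finite_I] if_True)
  finally show ?thesis .
qed

lemma inj_R_pow: "(R ^^ i) v = (R ^^ i) w \<Longrightarrow> v = w"
proof -
  assume *: "(R ^^ i) v = (R ^^ i) w"
  obtain j where j: "R ^^ j \<circ> R ^^ i = id" using R_pow_inverse by blast
  have "v = (R ^^ j) ((R ^^ i) v)" using fun_cong[OF j, of v] by simp
  also have "\<dots> = w" unfolding * using fun_cong[OF j, of w] by simp
  finally show ?thesis .
qed

text \<open>Powers of \<open>R\<close> permute the orthonormal basis \<open>t\<close>. Linear
  extension, first in one argument and then in the other, gives all vectors.\<close>

lemma g_R_pow: "g ((R ^^ i) v) ((R ^^ i) w) = g v w"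
proof -
  have "g ((R ^^ i) (t x)) ((R ^^ i) (t y)) = g (t x) (t y)" if xy: "x \<in> I" "y \<in> I" for x y
  proof -
    obtain k j k' j' where kj: "x = (k, j)" "k < N" "j < n" "y = (k', j')" "k' < N" "j' < n"
      using xy by blast
    let ?x = "(k, (j + i) mod n)" and ?y = "(k', (j' + i) mod n)"
    have in_I: "?x \<in> I" "?y \<in> I" using kj n_pos by simp_all
    have R: "(R ^^ i) (t x) = t ?x" "(R ^^ i) (t y) = t ?y"
      using kj by (simp_all add: R_pow_t)
    have "?x = ?y \<longleftrightarrow> x = y"
    proof
      assume "?x = ?y"
      then have "(R ^^ i) (t x) = (R ^^ i) (t y)" by (simp only: R)
      then have "t x = t y" by (rule inj_R_pow)
      then show "x = y" using xy by (rule inj_onD[OF inj_t])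
    qed (simp add: kj)
    then show ?thesis by (simp only: R g_t[OF in_I] g_t[OF xy])
  qed
  note base = this
  have lin: "linear (\<lambda>v. g ((R ^^ i) v) w)" "linear (\<lambda>v. g w ((R ^^ i) v))" for w
    using linear_compose[OF linear_R_pow linear_g_left] linear_compose[OF linear_R_pow linear_g]
    by (simp_all only: o_def)
  have "g ((R ^^ i) v) ((R ^^ i) (t y)) = g v (t y)" if "y \<in> I" for v y
    by (rule linear_eq_on_t[OF lin(1) linear_g_left]) (rule base[OF _ that])
  then show ?thesis
    by (rule linear_eq_on_t[OF lin(2) linear_g])
qed

end

locale even_flat_lattice = flat_lattice +
  fixes u :: nat
  assumes N_eq: "N = u + u" and n_odd: "odd n"
begin

text \<open>Orbit k is exchanged with orbit k + u and the position is kept; therefore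
  \<open>J\<close> commutes with the rotation \<open>R\<close>. The subtraction of u is used only
  where it does not truncate.\<close>

definition J :: "'a \<Rightarrow> 'a" where
  "J v = (\<Sum>x\<in>I. (if fst x < u then - co v (fst x + u, snd x) else co v (fst x - u, snd x)) *\<^sub>R t x)"

lemma less_N: "k < u \<Longrightarrow> k < N" "k < u \<Longrightarrow> k + u < N"
  by (simp_all add: N_eq)

lemma co_J:
  "\<lbrakk>k < u; j < n\<rbrakk> \<Longrightarrow> co (J v) (k, j) = - co v (k + u, j)"
  "\<lbrakk>k < u; j < n\<rbrakk> \<Longrightarrow> co (J v) (k + u, j) = co v (k, j)"
  unfolding J_def by (simp_all add: co_sum less_N)

lemma I_cases:
  assumes "x \<in> I"
  obtains k j where "k < u" "j < n" "x = (k, j)" | k j where "k < u" "j < n" "x = (k + u, j)"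
proof -
  obtain k j where x: "x = (k, j)" "k < u + u" "j < n" using assms unfolding N_eq by blast
  show ?thesis
  proof (cases "k < u")
    case True
    then show ?thesis using x that(1) by blast
  next
    case False
    then have "k - u < u" "x = (k - u + u, j)" using x by auto
    then show ?thesis using x that(2) by blast
  qed
qed

lemma in_I: "\<lbrakk>k < u; j < n\<rbrakk> \<Longrightarrow> (k, j) \<in> I" "\<lbrakk>k < u; j < n\<rbrakk> \<Longrightarrow> (k + u, j) \<in> I"
  by (simp_all add: less_N)

lemma linear_J: "linear J"
proof (rule linearI)
  fix v w and r :: real
  show "J (v + w) = J v + J w"
  proof (rule co_eqI)
    fix x assume "x \<in> I"
    then show "co (J (v + w)) x = co (J v + J w) x"
      by (cases rule: I_cases) (simp_all only: co_J co_add in_I minus_add_distrib)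
  qed
  show "J (r *\<^sub>R v) = r *\<^sub>R J v"
  proof (rule co_eqI)
    fix x assume "x \<in> I"
    then show "co (J (r *\<^sub>R v)) x = co (r *\<^sub>R J v) x"
      by (cases rule: I_cases) (simp_all only: co_J co_scale in_I mult_minus_right)
  qed
qed

lemma J_J: "J (J v) = - v"
proof (rule co_eqI)
  fix x assume x: "x \<in> I"
  have "co (- v) x = - co v x" using co_scale[OF x, of "- 1" v] by simp
  then show "co (J (J v)) x = co (- v) x"
    by (cases rule: I_cases[OF x]) (simp_all only: co_J)
qed

lemma J_t:
  "\<lbrakk>k < u; j < n\<rbrakk> \<Longrightarrow> J (t (k, j)) = t (k + u, j)"
  "\<lbrakk>k < u; j < n\<rbrakk> \<Longrightarrow> J (t (k + u, j)) = - t (k, j)"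
proof -
  show *: "J (t (k, j)) = t (k + u, j)" if kj: "k < u" "j < n" for k j
  proof (rule co_eqI)
    fix x assume "x \<in> I"
    then show "co (J (t (k, j))) x = co (t (k + u, j)) x"
      by (cases rule: I_cases) (use kj in \<open>auto simp: co_J co_t less_N\<close>)
  qed
  show "J (t (k + u, j)) = - t (k, j)" if "k < u" "j < n"
    using *[OF that] J_J[of "t (k, j)"] by simp
qed

lemma J_R_pow: "J ((R ^^ i) v) = (R ^^ i) (J v)"
proof (rule linear_eq_on_t[where f = "\<lambda>v. J ((R ^^ i) v)" and f' = "\<lambda>v. (R ^^ i) (J v)"])
  show "linear (\<lambda>v. J ((R ^^ i) v))"
    using linear_compose[OF linear_R_pow linear_J] by (simp only: o_def)
  show "linear (\<lambda>v. (R ^^ i) (J v))"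
    using linear_compose[OF linear_J linear_R_pow] by (simp only: o_def)
  fix x assume "x \<in> I"
  then show "J ((R ^^ i) (t x)) = (R ^^ i) (J (t x))"
    by (cases rule: I_cases)
      (use n_pos in \<open>simp_all add: R_pow_t J_t less_N linear_neg[OF linear_R_pow]\<close>)
qed

text \<open>The contributions of the orbits k and k + u are negatives of each other.\<close>

lemma g_J_self: "g v (J v) = 0"
proof -
  define F where "F k = (\<Sum>j<n. co v (k, j) * co (J v) (k, j))" for k
  have "F (u + k) = - F k" if "k < u" for k
  proof -
    have "F (k + u) = (\<Sum>j<n. - (co v (k, j) * co (J v) (k, j)))"
      unfolding F_def by (rule sum.cong) (use that in \<open>simp_all add: co_J\<close>)
    then show ?thesis by (simp only: F_def sum_negf add.commute[of u k])
  qed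
  then have "(\<Sum>k<u. F (u + k)) = (\<Sum>k<u. - F k)"
    by (intro sum.cong HOL.refl) simp
  then have "(\<Sum>k<u + u. F k) = 0"
    by (simp add: sum_lessThan_add sum_negf)
  moreover have "g v (J v) = (\<Sum>k<N. F k)"
    unfolding g_def F_def by (simp add: sum.cartesian_product split_beta)
  ultimately show ?thesis by (simp only: N_eq)
qed

text \<open>The sign is dictated by the compatibility \<open>g v w = \<omega> v (J w)\<close>, as
  \<open>J\<close> squares to minus the identity.\<close>

definition \<omega> :: "'a \<Rightarrow> 'a \<Rightarrow> real" where
  "\<omega> v w = - g v (J w)"

lemma bilinear_\<omega>: "bilinear \<omega>"
  unfolding bilinear_def \<omega>_def
proof (intro conjI allI)
  show "linear (\<lambda>w. - g v (J w))" for v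
    using linear_compose[OF linear_J linear_g] by (intro linear_compose_neg) (simp only: o_def)
  show "linear (\<lambda>v. - g v (J w))" for w
    by (intro linear_compose_neg linear_g_left)
qed

lemma g_\<omega>: "g v w = \<omega> v (J w)"
  by (simp add: \<omega>_def J_J linear_neg[OF linear_g])

lemma kaehler: "kaehler_structure L (\<lambda>_. g) (\<lambda>_. J) (\<lambda>_. \<omega>)"
proof -
  have g_lin: "g (lin f v) (lin f w) = g v w" if "f \<in> L" for f v w
    using lin_L[OF that] g_R_pow by metis
  have J_lin: "J (lin f v) = lin f (J v)" if "f \<in> L" for f v
    using lin_L[OF that] J_R_pow by metis
  have "riemannian_metric L (\<lambda>_. g)"
    unfolding riemannian_metric_def
    using smooth_form2_const[OF bilinear_g L_isometries g_lin] g_sym g_pos by blast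
  moreover have "complex_structure L (\<lambda>_. J)"
    by (rule complex_structure_const[OF _ L_isometries J_lin])
      (simp_all add: linear_complex_structure_def linear_J J_J)
  moreover have "symplectic_form L (\<lambda>_. \<omega>)"
    unfolding symplectic_form_def
  proof (intro conjI allI impI)
    show "smooth_form2 L (\<lambda>_. \<omega>)"
      by (rule smooth_form2_const[OF bilinear_\<omega> L_isometries]) (simp add: \<omega>_def J_lin g_lin)
    show "\<omega> v v = 0" for v by (simp add: \<omega>_def g_J_self)
    show "\<exists>w. \<omega> v w \<noteq> 0" if "v \<noteq> 0" for v
      using g_pos[OF that] g_\<omega>[of v v] by (intro exI[of _ "J v"]) simp
  qed simp
  ultimately show ?thesis
    unfolding kaehler_structure_def using g_\<omega> by blast
qed

text \<open>Only the first u orbits are enumerated, in blocks of n consecutive numbers; the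
  remaining basis vectors are their images under \<open>J\<close>. This is a basis over the complex
  numbers.\<close>

definition e :: "nat \<Rightarrow> 'a" where
  "e b = t (b div n, b mod n)"

lemma div_less: "b < u * n \<Longrightarrow> b div n < u"
  by (simp add: less_mult_imp_div_less)

lemma e_index: "b < u * n \<Longrightarrow> (b div n, b mod n) \<in> I"
  using n_pos div_less[of b] by (simp add: less_N)

lemma inj_e: "inj_on e {..<u * n}"
proof (rule inj_onI)
  fix b c assume "b \<in> {..<u * n}" "c \<in> {..<u * n}" "e b = e c"
  then have "(b div n, b mod n) = (c div n, c mod n)"
    using inj_onD[OF inj_t] e_index unfolding e_def by blast
  then show "b = c" by (metis div_mult_mod_eq prod.inject)
qed

lemma unitary_frame: "unitary_frame (u * n) g J e"
proof -
  have "g (e a) (e b) = (if a = b then 1 else 0) \<and> g (e a) (J (e b)) = 0" if "a < u * n" "b < u * n" for a b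
  proof
    show "g (e a) (e b) = (if a = b then 1 else 0)"
    proof -
      have "(a div n, a mod n) = (b div n, b mod n) \<longleftrightarrow> a = b"
        by (metis div_mult_mod_eq prod.inject)
      then show ?thesis
        by (simp only: e_def g_t[OF e_index[OF that(1)] e_index[OF that(2)]])
    qed
    have "(a div n, a mod n) \<noteq> (b div n + u, b mod n)"
      using div_less[OF that(1)] by simp
    moreover have "(b div n + u, b mod n) \<in> I"
      using div_less[OF that(2)] n_pos by (simp add: less_N)
    ultimately show "g (e a) (J (e b)) = 0"
      using that div_less[OF that(2)] n_pos e_index[OF that(1)] by (simp only: e_def J_t mod_less_divisor g_t if_False)
  qed
  moreover have "DIM('a) = 2 * (u * n)"
    by (simp add: dim_eq N_eq algebra_simps)
  ultimately show ?thesis by (simp add: unitary_frame_def)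
qed

text \<open>Rotation by i positions inside each block of n numbers: the permutation of the frame
  \<open>e\<close> induced by the i-th power of \<open>R\<close>.\<close>

definition \<sigma> :: "nat \<Rightarrow> nat \<Rightarrow> nat" where
  "\<sigma> i b = b div n * n + (b mod n + i) mod n"

lemma \<sigma>_div_mod: "\<sigma> i b div n = b div n" "\<sigma> i b mod n = (b mod n + i) mod n"
  using n_pos by (simp_all add: \<sigma>_def)

lemma R_pow_e: "b < u * n \<Longrightarrow> (R ^^ i) (e b) = e (\<sigma> i b)"
  using div_less[of b] n_pos by (simp add: e_def R_pow_t less_N \<sigma>_div_mod)

lemma bij_\<sigma>: "bij_betw (\<sigma> i) {..<u * n} {..<u * n}"
proof -
  have into: "\<sigma> i b < u * n" if "b < u * n" for b
  proof -
    have "\<sigma> i b < Suc (b div n) * n" using n_pos by (simp add: \<sigma>_def)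
    also have "\<dots> \<le> u * n" using div_less[OF that] by (intro mult_le_mono1) simp
    finally show ?thesis .
  qed
  moreover have "inj_on (\<sigma> i) {..<u * n}"
  proof (rule inj_onI)
    fix b c assume *: "b \<in> {..<u * n}" "c \<in> {..<u * n}" "\<sigma> i b = \<sigma> i c"
    then have "(R ^^ i) (e b) = (R ^^ i) (e c)" by (simp add: R_pow_e)
    then have "e b = e c" by (rule inj_R_pow)
    with * show "b = c" using inj_onD[OF inj_e] by blast
  qed
  moreover have "\<sigma> i ` {..<u * n} \<subseteq> {..<u * n}" using into by blast
  ultimately show ?thesis by (simp add: bij_betw_def endo_inj_surj)
qed

text \<open>Since the order of \<open>R\<close> is odd, every power of \<open>R\<close> is a square, so the permutation matrix
  describing it has determinant one.\<close>

lemma R_pow_square: obtains l where "R ^^ i = R ^^ l \<circ> R ^^ l"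
proof -
  have "even i \<or> even (i + n)" using n_odd by simp
  then obtain l where "i = l + l \<or> i + n = l + l" by (metis evenE mult_2)
  then have "R ^^ i = R ^^ (l + l)"
    by (subst R_pow_eq_iff) (metis mod_add_self2)
  then show ?thesis by (intro that) (simp only: funpow_add)
qed

lemma holonomy_in_SU: "holonomy_in_SU (u * n) L (\<lambda>_. g) (\<lambda>_. J)"
  unfolding holonomy_in_SU_def
proof (intro allI exI[of _ e] conjI ballI unitary_frame)
  fix x h assume "h \<in> holonomy L (\<lambda>_. g) x"
  then obtain i where "h = R ^^ i"
    using holonomy_eq[of g x] g_0 g_nondegenerate by blast
  then obtain l where h: "h = R ^^ l \<circ> R ^^ l" using R_pow_square by metis
  have lt: "\<sigma> l b < u * n" if "b < u * n" for b
    using bij_\<sigma>[of l] that by (auto simp: bij_betw_def)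
  show "\<exists>M\<in>special_unitary (u * n). \<forall>z\<in>carrier_vec (u * n).
      h (frame_map (u * n) J e z) = frame_map (u * n) J e (M *\<^sub>v z)"
  proof (intro bexI[of _ "perm_mat (u * n) (\<sigma> l \<circ> \<sigma> l)"] ballI frame_map_perm_mat)
    show "bij_betw (\<sigma> l \<circ> \<sigma> l) {..<u * n} {..<u * n}"
      by (rule bij_betw_trans[OF bij_\<sigma> bij_\<sigma>])
    show "linear h" unfolding h by (intro linear_compose linear_R_pow)
    show "h (e b) = e ((\<sigma> l \<circ> \<sigma> l) b)" if "b < u * n" for b
      using that by (simp add: h R_pow_e lt)
    show "h (J (e b)) = J (e ((\<sigma> l \<circ> \<sigma> l) b))" if "b < u * n" for b
      using that by (simp add: h R_pow_e lt flip: J_R_pow)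
    show "perm_mat (u * n) (\<sigma> l \<circ> \<sigma> l) \<in> special_unitary (u * n)"
      by (rule perm_mat_square_special_unitary[OF bij_\<sigma>])
  qed
qed

lemma calabi_yau:
  "\<exists>g J \<omega>. flat_metric g \<and> calabi_yau_structure (u * n) L g J \<omega>"
proof -
  have "flat_metric (\<lambda>_. g)"
    by (rule flat_metric_const) (simp_all add: g_0 g_nondegenerate)
  then show ?thesis
    unfolding calabi_yau_structure_def using kaehler holonomy_in_SU by blast
qed

end

section \<open>Uniqueness of the rotated lattice extension\<close>

context twisted_lattice
begin

text \<open>The power of \<open>\<alpha>\<close> with exponent i * n * n is computed in two ways,
  which gives i * s = n * n * m on all indices. At (0, 0) the value of s is 1.\<close>

lemma pow_eq_E_dvd:
  assumes "\<alpha> [^] (i::nat) = E m"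
  shows "n * n dvd i"
proof -
  have "E (\<lambda>x. int i * s x) = (\<alpha> [^] i) [^] (n * n)"
    by (simp only: pow_mult_square[symmetric] nat_pow_pow \<alpha>_closed mult.commute)
  also have "\<dots> = E (\<lambda>x. int (n * n) * m x)"
    by (simp only: assms E_nat_pow)
  finally have "\<forall>x\<in>{..<N} \<times> {..<n}. int i * s x = int (n * n) * m x"
    by (simp only: E_eq_iff)
  moreover have "(0, 0) \<in> {..<N} \<times> {..<n}" using N_pos n_pos by simp
  ultimately have "int i * s (0, 0) = int (n * n) * m (0, 0)"
    by (rule bspec)
  then have "int (n * n) dvd int i" by (simp add: s_0)
  then show ?thesis by (simp only: int_dvd_int_iff)
qed

text \<open>All coincidences of normal forms come from the relation \<open>power\<close>. The
  criterion mentions only n, N and s, so it is the same for any two groups with these data.\<close>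

lemma product_eq_iff:
  assumes "i \<le> i'"
  shows "E m \<otimes> \<alpha> [^] i = E m' \<otimes> \<alpha> [^] i' \<longleftrightarrow>
    (\<exists>d. i' = i + n * n * d \<and> (\<forall>x\<in>{..<N} \<times> {..<n}. m x = m' x + int d * s x))"
proof -
  have "\<alpha> [^] i' = \<alpha> [^] (i' - i) \<otimes> \<alpha> [^] i"
    using assms by (simp add: nat_pow_mult)
  then have "E m \<otimes> \<alpha> [^] i = E m' \<otimes> \<alpha> [^] i' \<longleftrightarrow> E m \<otimes> \<alpha> [^] i = (E m' \<otimes> \<alpha> [^] (i' - i)) \<otimes> \<alpha> [^] i"
    by (simp add: m_assoc)
  also have "\<dots> \<longleftrightarrow> E m = E m' \<otimes> \<alpha> [^] (i' - i)"
    by (rule right_cancel) simp_all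
  also have "\<dots> \<longleftrightarrow> (\<exists>d. i' - i = n * n * d \<and> (\<forall>x\<in>{..<N} \<times> {..<n}. m x = m' x + int d * s x))"
  proof
    assume *: "E m = E m' \<otimes> \<alpha> [^] (i' - i)"
    then have "\<alpha> [^] (i' - i) = E (\<lambda>x. - m' x + m x)"
      by (simp only: E_add E_neg[symmetric] inv_cancel_left E_closed nat_pow_closed \<alpha>_closed)
    then have "n * n dvd i' - i" by (rule pow_eq_E_dvd)
    then obtain d where d: "i' - i = n * n * d" by (elim dvdE)
    have "E m = E (\<lambda>x. m' x + int d * s x)"
      using * by (simp only: d pow_mult_square E_add)
    with d show "\<exists>d. i' - i = n * n * d \<and> (\<forall>x\<in>{..<N} \<times> {..<n}. m x = m' x + int d * s x)"
      unfolding E_eq_iff by blast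
  next
    assume "\<exists>d. i' - i = n * n * d \<and> (\<forall>x\<in>{..<N} \<times> {..<n}. m x = m' x + int d * s x)"
    then obtain d where d: "i' - i = n * n * d" "\<forall>x\<in>{..<N} \<times> {..<n}. m x = m' x + int d * s x" by blast
    have "E m = E (\<lambda>x. m' x + int d * s x)" unfolding E_eq_iff by (rule d(2))
    then show "E m = E m' \<otimes> \<alpha> [^] (i' - i)" by (simp only: d(1) pow_mult_square E_add)
  qed
  also have "\<dots> \<longleftrightarrow> (\<exists>d. i' = i + n * n * d \<and> (\<forall>x\<in>{..<N} \<times> {..<n}. m x = m' x + int d * s x))"
    using assms by (intro ex_cong1 conj_cong) auto
  finally show ?thesis .
qed

text \<open>\<open>\<alpha>\<close> commutes with its own power \<open>E s\<close>, so s is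
  invariant under rotation. The model below depends on this.\<close>

lemma s_const: "\<lbrakk>k < N; j < n\<rbrakk> \<Longrightarrow> s (k, j) = s (k, 0)"
proof (induction j)
  case (Suc j)
  have "E (rot n s) \<otimes> \<alpha> = \<alpha> \<otimes> \<alpha> [^] (n * n)" by (simp only: twist[symmetric] power)
  also have "\<dots> = E s \<otimes> \<alpha>" by (simp only: nat_pow_Suc2[symmetric] \<alpha>_closed power[symmetric] nat_pow_Suc)
  finally have "E (rot n s) = E s" by (simp only: right_cancel \<alpha>_closed E_closed)
  then have "\<forall>x\<in>{..<N} \<times> {..<n}. rot n s x = s x" by (simp only: E_eq_iff)
  moreover have "(k, Suc j) \<in> {..<N} \<times> {..<n}" using Suc.prems by simp
  ultimately have "rot n s (k, Suc j) = s (k, Suc j)" by (rule bspec)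
  with Suc show ?case by (simp add: rot_def)
qed simp

end

text \<open>Normal forms are sent to normal forms. By \<open>product_eq_iff\<close> the map is well
  defined and injective, and by \<open>product_mult\<close> it is multiplicative.\<close>

lemma twisted_lattice_unique:
  fixes G :: "('g, 'c) monoid_scheme" and H :: "('h, 'd) monoid_scheme"
  assumes "twisted_lattice G \<alpha> E n s N" "twisted_lattice H \<beta> F n s N"
  shows "G \<cong> H"
proof -
  interpret G: twisted_lattice G \<alpha> E n s N by (rule assms)
  interpret H: twisted_lattice H \<beta> F n s N by (rule assms)
  define p where "p m i = E m \<otimes>\<^bsub>G\<^esub> \<alpha> [^]\<^bsub>G\<^esub> i" for m and i :: nat
  define p' where "p' m i = F m \<otimes>\<^bsub>H\<^esub> \<beta> [^]\<^bsub>H\<^esub> i" for m and i :: nat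
  have le: "p m i = p m' i' \<longleftrightarrow> p' m i = p' m' i'" if "i \<le> i'" for m i m' i'
    unfolding p_def p'_def G.product_eq_iff[OF that] H.product_eq_iff[OF that] ..
  have eq: "p m i = p m' i' \<longleftrightarrow> p' m i = p' m' i'" for m i m' i'
    using le[of i i' m m'] le[of i' i m' m] nat_le_linear[of i i'] by metis
  define \<phi> where "\<phi> g = (SOME h. \<exists>m i. g = p m i \<and> h = p' m i)" for g
  have \<phi>: "\<phi> (p m i) = p' m i" for m i
  proof -
    have "\<exists>m' i'. p m i = p m' i' \<and> \<phi> (p m i) = p' m' i'"
      unfolding \<phi>_def by (rule someI_ex) blast
    then show ?thesis using eq by metis
  qed
  have G: "carrier G = {p m i |m i. True}" and H: "carrier H = {p' m i |m i. True}"
    unfolding p_def p'_def using G.decomp H.decomp by auto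
  have "\<phi> \<in> Group.iso G H"
    unfolding Group.iso_def
  proof (intro CollectI conjI homI)
    fix x assume "x \<in> carrier G"
    then obtain m i where "x = p m i" unfolding G by blast
    then show "\<phi> x \<in> carrier H" unfolding H by (auto simp: \<phi>)
  next
    fix x y assume "x \<in> carrier G" "y \<in> carrier G"
    then obtain m i m' i' where "x = p m i" "y = p m' i'" unfolding G by blast
    then show "\<phi> (x \<otimes>\<^bsub>G\<^esub> y) = \<phi> x \<otimes>\<^bsub>H\<^esub> \<phi> y"
      using \<phi>[of "\<lambda>x. m x + (rot n ^^ i) m' x" "i + i'"] \<phi>[of m i] \<phi>[of m' i']
      by (simp only: p_def p'_def G.product_mult H.product_mult)
  next
    have "inj_on \<phi> (carrier G)"
    proof (rule inj_onI)
      fix x y assume "x \<in> carrier G" "y \<in> carrier G" "\<phi> x = \<phi> y"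
      moreover from this obtain m i m' i' where "x = p m i" "y = p m' i'" unfolding G by blast
      ultimately show "x = y" by (simp only: \<phi> eq)
    qed
    moreover have "\<phi> ` carrier G = carrier H"
      unfolding G H by (force simp: \<phi>)
    ultimately show "bij_betw \<phi> (carrier G) (carrier H)" by (simp add: bij_betw_def)
  qed
  then show ?thesis by (auto simp: is_iso_def)
qed

section \<open>Realizations by isometries\<close>

lemma isometry_group_nat_pow: "f [^]\<^bsub>isometry_group\<^esub> (k::nat) = f ^^ k"
proof -
  interpret group isometry_group by (rule group_isometry_group)
  show ?thesis
    by (induction k) (simp_all add: funpow_Suc_right del: funpow.simps(2))
qed

text \<open>The abstract elements are transported along the inverse of the given isomorphism, whose
  values are actual isometries.\<close>

lemma flat_lattice_of_iso:
  fixes L :: "('a::euclidean_space \<Rightarrow> 'a) set" and G (structure)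
  assumes L: "bieberbach_group L" and iso: "isometry_group\<lparr>carrier := L\<rparr> \<cong> G"
    and G: "twisted_lattice G \<alpha> E n s N"
  obtains \<alpha>' E' where "flat_lattice L \<alpha>' E' N n s"
proof -
  let ?L = "isometry_group\<lparr>carrier := L\<rparr>"
  interpret twisted_lattice G \<alpha> E n s N by (rule G)
  have sub: "subgroup L isometry_group" using L by (simp add: bieberbach_group_def)
  interpret L: group ?L
    by (rule group.subgroup_imp_group[OF group_isometry_group sub])
  obtain \<phi> where \<phi>: "\<phi> \<in> Group.iso G ?L"
    using L.iso_sym[OF iso] unfolding is_iso_def by blast
  then have hom: "\<phi> \<in> hom G ?L" and bij: "bij_betw \<phi> (carrier G) L"
    by (simp_all add: Group.iso_def)
  interpret \<phi>: group_hom G ?L \<phi>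
    by unfold_locales (rule hom)
  have mult: "\<phi> (x \<otimes> y) = \<phi> x \<circ> \<phi> y" if "x \<in> carrier G" "y \<in> carrier G" for x y
    using \<phi>.hom_mult[OF that] by simp
  have in_L: "\<phi> x \<in> L" if "x \<in> carrier G" for x
    using \<phi>.hom_closed[OF that] by simp
  have pow: "\<phi> (\<alpha> [^] i) = \<phi> \<alpha> ^^ i" for i :: nat
  proof (induction i)
    case 0
    show ?case using \<phi>.hom_one by simp
  next
    case (Suc i)
    then show ?case by (simp only: nat_pow_Suc mult nat_pow_closed \<alpha>_closed funpow_Suc_right)
  qed
  have inj: "\<phi> x = \<phi> y \<longleftrightarrow> x = y" if "x \<in> carrier G" "y \<in> carrier G" for x y
    using bij that by (auto simp: bij_betw_def inj_on_def)
  have "flat_lattice L (\<phi> \<alpha>) (\<lambda>m. \<phi> (E m)) N n s"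
  proof
    show "L \<subseteq> isometries" using subgroup.subset[OF sub] by simp
    show "discrete_isometries L" "cocompact L" using L by (simp_all add: bieberbach_group_def)
    show "\<phi> (E (\<lambda>x. m x + m' x)) = \<phi> (E m) \<circ> \<phi> (E m')" for m m'
      by (simp only: E_add mult E_closed)
    show "\<phi> (E m) = \<phi> (E m') \<longleftrightarrow> (\<forall>x\<in>{..<N} \<times> {..<n}. m x = m' x)" for m m'
      by (simp only: inj E_closed E_eq_iff)
    show "\<phi> \<alpha> \<circ> \<phi> (E m) = \<phi> (E (rot n m)) \<circ> \<phi> \<alpha>" for m
      by (simp only: mult[symmetric] E_closed \<alpha>_closed twist)
    show "\<exists>m i. f = \<phi> (E m) \<circ> \<phi> \<alpha> ^^ i" if f: "f \<in> L" for f
    proof -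
      obtain x where x: "x \<in> carrier G" "f = \<phi> x" using bij f by (auto simp: bij_betw_def)
      obtain m and i :: nat where "x = E m \<otimes> \<alpha> [^] i" using decomp[OF x(1)] by blast
      then have "f = \<phi> (E m) \<circ> \<phi> \<alpha> ^^ i"
        by (simp only: x(2) mult E_closed nat_pow_closed \<alpha>_closed pow)
      then show ?thesis by blast
    qed
    show "\<phi> \<alpha> ^^ (n * n) = \<phi> (E s)" by (simp only: pow[symmetric] power)
    show "\<phi> \<alpha> ^^ i \<in> L" for i
      using in_L[of "\<alpha> [^] i"] by (simp only: pow[symmetric] nat_pow_closed \<alpha>_closed)
  qed (simp_all add: in_L n_pos N_pos)
  then show ?thesis by (rule that)
qed

text \<open>An explicit realization: the coordinates are numbered by orbit and position, and
  \<open>a\<close> rotates every block of n coordinates and then shifts the one at position 0. Since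
  the total shift over n steps is the same in all positions of a block, s must be constant on
  blocks.\<close>

locale rotation_model =
  fixes e :: "nat \<times> nat \<Rightarrow> 'a::euclidean_space" and n :: nat and s :: "nat \<times> nat \<Rightarrow> int" and N :: nat
  assumes e_bij: "bij_betw e ({..<N} \<times> {..<n}) Basis"
    and s_const: "\<lbrakk>k < N; j < n\<rbrakk> \<Longrightarrow> s (k, j) = s (k, 0)"
    and s_0: "s (0, 0) = 1" and n_pos: "n > 0" and N_pos: "N > 0"
begin

abbreviation I :: "(nat \<times> nat) set" where
  "I \<equiv> {..<N} \<times> {..<n}"

definition vec :: "(nat \<times> nat \<Rightarrow> real) \<Rightarrow> 'a" where
  "vec f = (\<Sum>x\<in>I. f x *\<^sub>R e x)"

definition prev :: "nat \<times> nat \<Rightarrow> nat \<times> nat" where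
  "prev x = (fst x, (snd x + n - 1) mod n)"

text \<open>The translation part \<open>c\<close> of \<open>a\<close> is chosen so that \<open>a ^^ (n * n)\<close> is the translation by \<open>s\<close>.\<close>

definition c :: "nat \<times> nat \<Rightarrow> real" where
  "c x = (if snd x = 0 then real_of_int (s x) / real n else 0)"

definition a :: "'a \<Rightarrow> 'a" where
  "a v = vec (\<lambda>x. v \<bullet> e (prev x) + c x)"

definition tr :: "(nat \<times> nat \<Rightarrow> int) \<Rightarrow> 'a \<Rightarrow> 'a" where
  "tr m v = v + vec (\<lambda>x. real_of_int (m x))"

lemma e_Basis: "x \<in> I \<Longrightarrow> e x \<in> Basis"
  using e_bij by (auto simp: bij_betw_def)

lemma inner_e: "\<lbrakk>x \<in> I; y \<in> I\<rbrakk> \<Longrightarrow> e x \<bullet> e y = (if x = y then 1 else 0)"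
  using e_bij inner_Basis[OF e_Basis e_Basis, of x y] by (auto simp: bij_betw_def inj_on_eq_iff)

lemma vec_inner: "x \<in> I \<Longrightarrow> vec f \<bullet> e x = f x"
proof -
  assume x: "x \<in> I"
  have "vec f \<bullet> e x = (\<Sum>y\<in>I. if y = x then f x else 0)"
    unfolding vec_def inner_sum_left by (rule sum.cong) (use x in \<open>auto simp: inner_e\<close>)
  with x show ?thesis by simp
qed

lemma eqI: "(\<And>x. x \<in> I \<Longrightarrow> v \<bullet> e x = w \<bullet> e x) \<Longrightarrow> v = w"
proof (rule euclidean_eqI)
  fix b :: 'a assume *: "\<And>x. x \<in> I \<Longrightarrow> v \<bullet> e x = w \<bullet> e x" and "b \<in> Basis"
  then obtain x where "x \<in> I" "b = e x" using e_bij unfolding bij_betw_def by blast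
  with * show "v \<bullet> b = w \<bullet> b" by blast
qed

lemma prev_in: "x \<in> I \<Longrightarrow> prev x \<in> I"
  using n_pos by (auto simp: prev_def)

lemma prev_pow_in: "x \<in> I \<Longrightarrow> (prev ^^ i) x \<in> I"
  by (induction i) (simp_all only: funpow.simps id_apply o_apply prev_in)

lemma a_inner: "x \<in> I \<Longrightarrow> a v \<bullet> e x = v \<bullet> e (prev x) + c x"
  by (simp only: a_def vec_inner)

lemma tr_inner: "x \<in> I \<Longrightarrow> tr m v \<bullet> e x = v \<bullet> e x + real_of_int (m x)"
  by (simp only: tr_def inner_add_left vec_inner)

lemma a_pow_inner:
  "x \<in> I \<Longrightarrow> (a ^^ i) v \<bullet> e x = v \<bullet> e ((prev ^^ i) x) + (\<Sum>l<i. c ((prev ^^ l) x))"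
proof (induction i arbitrary: x)
  case (Suc i)
  have "(a ^^ Suc i) v \<bullet> e x = (a ^^ i) v \<bullet> e (prev x) + c x"
    using Suc.prems by (simp add: a_inner)
  also have "\<dots> = v \<bullet> e ((prev ^^ i) (prev x)) + ((\<Sum>l<i. c ((prev ^^ l) (prev x))) + c x)"
    by (simp only: Suc.IH[OF prev_in[OF Suc.prems]] add.assoc)
  also have "(\<Sum>l<i. c ((prev ^^ l) (prev x))) + c x = (\<Sum>l<Suc i. c ((prev ^^ l) x))"
    unfolding sum.lessThan_Suc_shift by (simp add: funpow_swap1)
  finally show ?case by (simp add: funpow_swap1)
qed simp

lemma prev_pow:
  "\<lbrakk>j < n; l \<le> n\<rbrakk> \<Longrightarrow> (prev ^^ l) (k, j) = (k, if l \<le> j then j - l else n + j - l)"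
proof (induction l)
  case (Suc l)
  then have "(prev ^^ Suc l) (k, j) = prev (k, if l \<le> j then j - l else n + j - l)" by simp
  also have "\<dots> = (k, if Suc l \<le> j then j - Suc l else n + j - Suc l)"
  proof -
    have "(b + n - 1) mod n = (if b = 0 then n - 1 else b - 1)" if "b < n" for b
      using that by (cases b) simp_all
    moreover have "(if l \<le> j then j - l else n + j - l) < n" using Suc.prems by auto
    ultimately show ?thesis using Suc.prems by (auto simp: prev_def)
  qed
  finally show ?case .
qed simp

text \<open>In n steps back through its block each coordinate meets position 0 exactly once and
  collects the shift there, which by \<open>s_const\<close> is s x / n.\<close>

lemma a_pow_n_inner:
  assumes "x \<in> I"
  shows "(a ^^ n) v \<bullet> e x = v \<bullet> e x + real_of_int (s x) / real n"
proof -
  obtain k j where x: "x = (k, j)" "k < N" "j < n" using assms by blast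
  have "(\<Sum>l<n. c ((prev ^^ l) x)) = (\<Sum>l<n. if l = j then real_of_int (s x) / real n else 0)"
  proof (rule sum.cong)
    fix l assume "l \<in> {..<n}"
    then show "c ((prev ^^ l) x) = (if l = j then real_of_int (s x) / real n else 0)"
      using x s_const[of k j] by (auto simp: c_def prev_pow)
  qed simp
  also have "\<dots> = real_of_int (s x) / real n" using x by simp
  finally show ?thesis using assms x prev_pow[of j n k] by (simp add: a_pow_inner)
qed

lemma a_pow_multiple_inner:
  assumes "x \<in> I"
  shows "(a ^^ (n * d)) v \<bullet> e x = v \<bullet> e x + real d * (real_of_int (s x) / real n)"
proof -
  have "((a ^^ n) ^^ d) v \<bullet> e x = v \<bullet> e x + real d * (real_of_int (s x) / real n)"
    by (induction d) (simp_all add: a_pow_n_inner[OF assms] distrib_right add_divide_distrib)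
  then show ?thesis by (simp only: funpow_mult)
qed

lemma a_pow_square: "a ^^ (n * n) = tr s"
proof (rule ext, rule eqI)
  fix v x assume x: "x \<in> I"
  show "(a ^^ (n * n)) v \<bullet> e x = tr s v \<bullet> e x"
    unfolding a_pow_multiple_inner[OF x] tr_inner[OF x] using n_pos by simp
qed

lemma norm_eq: "v \<bullet> v = (\<Sum>x\<in>I. (v \<bullet> e x)\<^sup>2)"
proof -
  have "v \<bullet> v = (\<Sum>b\<in>Basis. (v \<bullet> b)\<^sup>2)"
    by (subst euclidean_inner) (simp add: power2_eq_square)
  then show ?thesis by (simp only: sum.reindex_bij_betw[OF e_bij, of "\<lambda>b. (v \<bullet> b)\<^sup>2"])
qed

lemma a_isometry: "a \<in> isometries"
proof -
  have "dist (a v) (a w) = dist v w" for v w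
  proof -
    have "(a v - a w) \<bullet> (a v - a w) = (\<Sum>x\<in>I. ((v - w) \<bullet> e (prev x))\<^sup>2)"
      unfolding norm_eq by (rule sum.cong) (simp_all only: inner_diff_left a_inner add_diff_cancel_right)
    also have "\<dots> = (\<Sum>k<N. \<Sum>j<n. ((v - w) \<bullet> e (k, (j + n - 1) mod n))\<^sup>2)"
      by (simp add: sum.cartesian_product split_beta prev_def)
    also have "\<dots> = (\<Sum>k<N. \<Sum>j<n. ((v - w) \<bullet> e (k, j))\<^sup>2)"
      by (simp only: sum_rotate[OF n_pos, of "\<lambda>j. ((v - w) \<bullet> e (_, j))\<^sup>2"])
    also have "\<dots> = (v - w) \<bullet> (v - w)"
      unfolding norm_eq by (simp add: sum.cartesian_product split_beta)
    finally show ?thesis by (simp add: dist_norm norm_eq_sqrt_inner)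
  qed
  moreover have "surj a"
  proof (rule surjI)
    fix y
    \<comment> \<open>A preimage of y: the power with exponent n * n is the translation by s, so the
      translation by -s is applied first and one factor \<open>a\<close> is left out.\<close>
    have "(a ^^ Suc (n * n - 1)) (tr (\<lambda>x. - s x) y) = y"
    proof (rule eqI)
      fix x assume x: "x \<in> I"
      have "Suc (n * n - 1) = n * n" using n_pos by simp
      then show "(a ^^ Suc (n * n - 1)) (tr (\<lambda>x. - s x) y) \<bullet> e x = y \<bullet> e x"
        by (simp add: a_pow_square tr_inner[OF x] del: funpow.simps)
    qed
    then show "a ((a ^^ (n * n - 1)) (tr (\<lambda>x. - s x) y)) = y" by simp
  qed
  ultimately show ?thesis by (simp add: isometries_def)
qed

lemma tr_add: "tr (\<lambda>x. m x + m' x) = tr m \<circ> tr m'"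
  by (rule ext, rule eqI) (simp only: o_apply tr_inner of_int_add add.assoc add.commute)

lemma tr_eq_iff: "tr m = tr m' \<longleftrightarrow> (\<forall>x\<in>I. m x = m' x)"
proof
  assume "tr m = tr m'"
  then have "real_of_int (m x) = real_of_int (m' x)" if "x \<in> I" for x
    using tr_inner[OF that, of m 0] tr_inner[OF that, of m' 0] by simp
  then show "\<forall>x\<in>I. m x = m' x" by (simp only: of_int_eq_iff) blast
next
  assume "\<forall>x\<in>I. m x = m' x"
  then show "tr m = tr m'" by (intro ext eqI) (simp only: tr_inner)
qed

lemma tr_isometry: "tr m \<in> isometries"
proof -
  have "surj (tr m)" unfolding tr_def by (rule surj_plus_right)
  then show ?thesis by (simp add: isometries_def tr_def)
qed

lemma tr_twist: "a \<circ> tr m = tr (rot n m) \<circ> a"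
proof (rule ext, rule eqI)
  fix v x assume x: "x \<in> I"
  have "rot n m x = m (prev x)" by (simp only: rot_def prev_def)
  then show "(a \<circ> tr m) v \<bullet> e x = (tr (rot n m) \<circ> a) v \<bullet> e x"
    by (simp only: o_apply a_inner[OF x] tr_inner[OF x] tr_inner[OF prev_in[OF x]] add.assoc add.commute)
qed

sublocale rotation_extension isometry_group a tr n s
proof -
  interpret group isometry_group by (rule group_isometry_group)
  show "rotation_extension isometry_group a tr n s"
    by unfold_locales (simp_all add: a_isometry tr_isometry tr_add tr_twist isometry_group_nat_pow a_pow_square n_pos)
qed

lemma in_products_iff: "f \<in> products \<longleftrightarrow> (\<exists>m i. f = tr m \<circ> a ^^ i)"
  by (simp add: products_def isometry_group_nat_pow)

lemma products_inner:
  assumes "x \<in> I"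
  shows "(tr m \<circ> a ^^ i) v \<bullet> e x = v \<bullet> e ((prev ^^ i) x) + (tr m \<circ> a ^^ i) 0 \<bullet> e x"
  by (simp only: o_apply tr_inner[OF assms] a_pow_inner[OF assms] inner_zero_left add_0_left add.assoc)

text \<open>The coordinates of \<open>f 0\<close> lie in multiples of 1 / n, so a displacement below
  1 / n forces \<open>f 0\<close> to vanish. A non-trivial permutation of coordinates would then
  move some basis vector by at least 1.\<close>

lemma products_discrete: "discrete_isometries products"
  unfolding discrete_isometries_def
proof (intro exI[of _ "1 / real n"] conjI ballI impI)
  show "1 / real n > 0" using n_pos by simp
  fix f assume "f \<in> products" and small: "\<forall>v\<in>cball 0 1. dist (f v) v < 1 / real n"
  then obtain m i where f: "f = tr m \<circ> a ^^ i" unfolding in_products_iff by blast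
  have "1 / real n \<le> 1" using n_pos by simp
  have f0: "f 0 \<bullet> e x = 0" if x: "x \<in> I" for x
  proof -
    have nc: "real n * c y \<in> \<int>" for y using n_pos by (simp add: c_def)
    have "real n * ((\<Sum>l<i. c ((prev ^^ l) x)) + real_of_int (m x)) \<in> \<int>"
      unfolding distrib_left sum_distrib_left by (intro Ints_add Ints_sum nc) (simp add: Ints_mult)
    then have "real n * (f 0 \<bullet> e x) \<in> \<int>"
      by (simp only: f o_apply tr_inner[OF x] a_pow_inner[OF x] inner_zero_left add_0_left)
    moreover have "\<bar>f 0 \<bullet> e x\<bar> < 1 / real n"
      using small[rule_format, of 0] Basis_le_norm[OF e_Basis[OF x], of "f 0"] by simp
    then have "\<bar>real n * (f 0 \<bullet> e x)\<bar> < 1"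
      using n_pos by (simp add: abs_mult field_simps)
    ultimately have "real n * (f 0 \<bullet> e x) = 0" by (rule Ints_nonzero_abs_less1)
    then show ?thesis using n_pos by simp
  qed
  have inner: "f v \<bullet> e x = v \<bullet> e ((prev ^^ i) x)" if x: "x \<in> I" for v x
    using products_inner[OF x, of m i v] f0[OF x] by (simp only: f add_0_right)
  have "(prev ^^ i) x = x" if x: "x \<in> I" for x
  proof (rule ccontr)
    assume "(prev ^^ i) x \<noteq> x"
    then have "(f (e x) - e x) \<bullet> e x = - 1"
      using inner_e[OF x prev_pow_in[OF x, of i]] inner_e[OF x x]
      by (simp only: inner_diff_left inner[OF x]) auto
    moreover have "\<bar>(f (e x) - e x) \<bullet> e x\<bar> \<le> dist (f (e x)) (e x)"
      unfolding dist_norm by (rule Basis_le_norm[OF e_Basis[OF x]])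
    moreover have "dist (f (e x)) (e x) < 1 / real n"
      by (rule small[rule_format]) (simp add: norm_Basis[OF e_Basis[OF x]])
    ultimately show False using \<open>1 / real n \<le> 1\<close> by simp
  qed
  then show "f = id" by (intro ext eqI) (simp only: inner id_apply)
qed

lemma products_cocompact: "cocompact products"
  unfolding cocompact_def
proof (intro exI[of _ "cbox 0 One"] conjI)
  have "v \<in> (\<Union>f\<in>products. f ` cbox 0 One)" for v
  proof -
    define m where "m x = \<lfloor>v \<bullet> e x\<rfloor>" for x
    define w where "w = tr (\<lambda>x. - m x) v"
    have "w \<in> cbox 0 One"
      unfolding mem_box
    proof
      fix b :: 'a assume b: "b \<in> Basis"
      then obtain x where x: "x \<in> I" "b = e x" using e_bij unfolding bij_betw_def by blast
      have "w \<bullet> b = v \<bullet> e x - of_int \<lfloor>v \<bullet> e x\<rfloor>"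
        by (simp add: w_def m_def x(2) tr_inner[OF x(1)])
      moreover have "of_int \<lfloor>v \<bullet> e x\<rfloor> \<le> v \<bullet> e x" "v \<bullet> e x < of_int \<lfloor>v \<bullet> e x\<rfloor> + 1"
        by linarith+
      ultimately have "0 \<le> w \<bullet> b" "w \<bullet> b \<le> 1" by linarith+
      then show "0 \<bullet> b \<le> w \<bullet> b \<and> w \<bullet> b \<le> One \<bullet> b"
        using b by simp
    qed
    moreover have "v = (tr m \<circ> a ^^ 0) w"
      by (rule eqI) (simp add: tr_inner w_def)
    moreover have "tr m \<circ> a ^^ 0 \<in> products" unfolding in_products_iff by blast
    ultimately show ?thesis by blast
  qed
  then show "(\<Union>f\<in>products. f ` cbox 0 One) = UNIV" by blast
qed (rule compact_cbox)

text \<open>The functional \<open>l\<close> sums the coordinates of orbit 0. It increases by 1 / n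
  under \<open>a\<close>, thanks to \<open>s_0\<close>, and by an integer under \<open>tr m\<close>.
  Finite order forces the total increase of f to be 0, so n divides i; then f is a translation, and
  one of finite order is trivial.\<close>

lemma products_torsion_free:
  assumes "f \<in> products" "k > 0" "f ^^ k = id"
  shows "f = id"
proof -
  obtain m i where f: "f = tr m \<circ> a ^^ i" using assms(1) unfolding in_products_iff by blast
  define l where "l v = (\<Sum>j<n. v \<bullet> e (0, j))" for v
  have l_tr: "l (tr m v) = l v + of_int (\<Sum>j<n. m (0, j))" for v
    using N_pos by (simp add: l_def tr_inner sum.distrib)
  have "l (a v) = l v + 1 / real n" for v
  proof -
    have "l (a v) = (\<Sum>j<n. v \<bullet> e (0, (j + n - 1) mod n)) + (\<Sum>j<n. c (0, j))"
      using N_pos by (simp add: l_def a_inner sum.distrib prev_def)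
    moreover have "(\<Sum>j<n. c (0, j)) = (\<Sum>j<n. if j = 0 then 1 / real n else 0)"
      by (rule sum.cong) (simp_all add: c_def s_0)
    ultimately show ?thesis
      using n_pos sum_rotate[OF n_pos, of "\<lambda>j. v \<bullet> e (0, j)"] by (simp add: l_def)
  qed
  then have l_a: "l ((a ^^ i) v) = l v + real i / real n" for v i
    by (induction i) (simp_all add: add_divide_distrib)
  have "l ((f ^^ k) v) = l v + real k * (real i / real n + of_int (\<Sum>j<n. m (0, j)))" for k v
    by (induction k) (simp_all add: f l_tr l_a algebra_simps add_divide_distrib)
  from this[of k 0] have "real i / real n + of_int (\<Sum>j<n. m (0, j)) = 0"
    using assms(2,3) by simp
  then have "real_of_int (int i) = real_of_int (int n * (- (\<Sum>j<n. m (0, j))))"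
    using n_pos by (simp add: field_simps)
  then have "int n dvd int i" by (simp only: of_int_eq_iff dvd_triv_left)
  then obtain d where d: "i = n * d" by (auto elim: dvdE)
  define b where "b x = real d * (real_of_int (s x) / real n) + real_of_int (m x)" for x
  have fb: "f v \<bullet> e x = v \<bullet> e x + b x" if "x \<in> I" for v x
    using that by (simp add: f d tr_inner a_pow_multiple_inner b_def)
  have "(f ^^ k) v \<bullet> e x = v \<bullet> e x + real k * b x" if "x \<in> I" for v x k
    by (induction k) (simp_all add: fb[OF that] algebra_simps)
  from this[where k = k] have "b x = 0" if "x \<in> I" for x
    using that assms(2,3) by simp
  then show ?thesis by (intro ext eqI) (simp add: fb)
qed

lemma bieberbach_products: "bieberbach_group products"
  unfolding bieberbach_group_def
  using products_subgroup products_discrete products_cocompact products_torsion_free by blast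

end

lemma twisted_lattice_realization:
  assumes G: "twisted_lattice G \<alpha> E n s N" and dim: "DIM('a::euclidean_space) = N * n"
  shows "\<exists>L :: ('a \<Rightarrow> 'a) set. bieberbach_group L \<and> isometry_group\<lparr>carrier := L\<rparr> \<cong> G"
proof -
  interpret twisted_lattice G \<alpha> E n s N by (rule G)
  have "card ({..<N} \<times> {..<n}) = card (Basis :: 'a set)" using dim by simp
  then obtain e :: "nat \<times> nat \<Rightarrow> 'a" where e: "bij_betw e ({..<N} \<times> {..<n}) Basis"
    using finite_same_card_bij[of "{..<N} \<times> {..<n}" "Basis :: 'a set"] by auto
  interpret M: rotation_model e n s N
    using e s_const s_0 n_pos N_pos by unfold_locales
  have "twisted_lattice (isometry_group\<lparr>carrier := M.products\<rparr>) M.a M.tr n s N"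
    using M.tr_eq_iff s_0 N_pos by (rule M.products_twisted_lattice)
  then have "isometry_group\<lparr>carrier := M.products\<rparr> \<cong> G"
    using G by (rule twisted_lattice_unique)
  with M.bieberbach_products show ?thesis by blast
qed

theorem corollary15:
  fixes p r u :: nat
  assumes "Factorial_Ring.prime p" and "odd p" and "u \<ge> 1" and "r \<ge> 1" and "p ^ r = 4 * u + 1"
  shows "(DIM('a::euclidean_space) = 2 * u * (4 * u + 1) \<longrightarrow>
           (\<exists>G :: ('a \<Rightarrow> 'a) set. bieberbach_group G \<and>
              isometry_group\<lparr>carrier := G\<rparr> \<cong> Gamma_group (p ^ r))) \<and>
         (\<forall>G :: ('a \<Rightarrow> 'a) set. bieberbach_group G \<and>
              isometry_group\<lparr>carrier := G\<rparr> \<cong> Gamma_group (p ^ r) \<longrightarrow>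
            DIM('a) = 2 * u * (4 * u + 1) \<and>
            (\<forall>x. holonomy_group G standard_metric x \<cong> integer_mod_group (p ^ r)) \<and>
            (\<exists>g J \<omega>. flat_metric g \<and> calabi_yau_structure (u * (4 * u + 1)) G g J \<omega>))"
proof -
  let ?n = "4 * u + 1"
  \<comment> \<open>For n = 4u + 1 the number h of orbits is 2u, which
    \<open>even_flat_lattice\<close> later splits as u + u.\<close>
  interpret odd_braid_quot ?n "braid_quotient ?n" "2 * u"
    using assms(3) by unfold_locales simp_all
  obtain s where s: "twisted_lattice (Gamma_group ?n) alpha E ?n s (2 * u)"
    by (rule Gamma_group_twisted_lattice)
  have "DIM('a) = 2 * u * ?n \<longrightarrow>
      (\<exists>G :: ('a \<Rightarrow> 'a) set. bieberbach_group G \<and> isometry_group\<lparr>carrier := G\<rparr> \<cong> Gamma_group ?n)"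
    using twisted_lattice_realization[OF s, where 'a = 'a] by blast
  moreover have "DIM('a) = 2 * u * ?n \<and>
      (\<forall>x. holonomy_group G standard_metric x \<cong> integer_mod_group ?n) \<and>
      (\<exists>g J \<omega>. flat_metric g \<and> calabi_yau_structure (u * ?n) G g J \<omega>)"
    if G: "bieberbach_group G" "isometry_group\<lparr>carrier := G\<rparr> \<cong> Gamma_group ?n" for G :: "('a \<Rightarrow> 'a) set"
  proof -
    obtain \<alpha> E where "flat_lattice G \<alpha> E (2 * u) ?n s"
      using G s by (rule flat_lattice_of_iso)
    then interpret F: flat_lattice G \<alpha> E "2 * u" ?n s .
    interpret even_flat_lattice G \<alpha> E "2 * u" ?n s u
      by unfold_locales simp_all
    show ?thesis using F.dim_eq F.holonomy_group_iso calabi_yau by blast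
  qed
  ultimately show ?thesis unfolding assms(5) by blast
qed

end
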